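(* Let $\mathbf{A}$ be a commutative ring, $A\in\mathbf{A}^{m\times n}$ a matrix, $t$ an indeterminate, $A^\circ=Q_n^{-1}\,{}^{\mathrm t}\!A\,Q_m$, and write $P_{AA^\circ}(Z)=\det(\mathrm{I}_m+ZAA^\circ)=1+\sum_{\ell\ge1}g_\ell(t)Z^\ell$ (and $g_0=1$). Let $k\ge 0$ be an integer. The following are equivalent: 1. $A$ is locally simple of rank $k$ over $\mathbf{A}$. 2. $A$ is locally simple of rank $k$ over $\mathbf{A}(t)$. 3. $A$ is simple of rank $k$ over $\mathbf{A}(t)$. 4. $A$ is of rank $\le k$ and the polynomial $t^{k(n-k)}g_k(t)$ is primitive. 5. $A$ and $A^\circ$ are crossed over $\mathbf{A}(t)$, of rank $k$. 6. $A$ and $A^\circ$ are crossed over $\mathbf{A}(t)$, $\deg_Z(P_{AA^\circ})\le k$ and $t^{k(n-k)}g_k(t)$ is primitive. 7. $\deg_Z(P_{AA^\circ})\le k$, the polynomial $t^{k(n-k)}g_k(t)$ is primitive, and $A\,\mathrm{Adj}^{(k)}_{A^\circ}(A)\,A=g_k(t)\,A$, where $$\mathrm{Adj}^{(k)}_{A^\circ}(A)=g_{k-1}(t)A^\circ-g_{k-2}(t)A^\circ AA^\circ+\cdots+(-1)^{k-1}(A^\circ A)^{k-1}A^\circ.$$ If $\mathbf{A}$ is reduced, condition 7 simplifies to: $\deg_Z(P_{AA^\circ})\le k$ and the polynomial $t^{k(n-k)}g_k(t)$ is primitive. When these conditions hold, the matrix $\mathrm{Adj}^{(k)}_{A^\circ}(A)/g_k(t)$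 is the generalized inverse of $A$ via $A^\circ$ over the ring $\mathbf{A}(t)$.
   Context: $Q_r$ denotes the $r\times r$ diagonal matrix with entries $1,t,t^2,\dots,t^{r-1}$; so if $A=(a_{i,j})$, then $A^\circ=(t^{j-i}a_{j,i})\in\mathbf{A}[t,1/t]^{n\times m}$. A polynomial in $\mathbf{A}[t]$ is primitive if its coefficients generate the ideal $\langle1\rangle$ of $\mathbf{A}$. $\mathbf{A}(t)=S^{-1}\mathbf{A}[t]$ where $S$ is the set of primitive polynomials. Matrices are identified with linear maps between free modules. $\mathcal{D}_j(A)$ is the ideal generated by the minors of order $j$ of $A$ (equal to $\langle 1\rangle$ for $j\le0$ and to $0$ for $j>\min(m,n)$). $A$ is of rank $\le k$ if $\mathcal{D}_{k+1}(A)=0$. $A$ is locally simple if its image is a direct summand of the target (equivalently there is $B$ with $ABA=A$); it is locally simple of rank $k$ if moreover $\mathcal{D}_k(A)=\langle1\rangle$ and $\mathcal{D}_{k+1}(A)=0$ (i.e. the image is projective of constant rank $k$). $A$ is simple of rank $k$ if $A=U\,\mathrm{I}_{k,m,n}V$ with $U,V$ invertible square matrices, where $\mathrm{I}_{k,m,n}$ is the $m\times n$ matrix with $\mathrm{I}_k$ in the upper left corner and zeros elsewhere. Two linear maps $\varphi:E\to F$, $\varphi^\bullet:F\to E$ are crossed if $\operatorname{Im}\varphi\oplus\operatorname{Ker}\varphi^\bullet=F$ and $\operatorname{Ker}\varphi\oplus\operatorname{Im}\varphi^\bullet=E$; they are crossed of rank $k$ if moreover $\operatorname{Im}\varphi$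 is projective of constant rank $k$. The generalized inverse of $\varphi$ via $\varphi^\bullet$ is then the unique linear map $\psi:F\to E$ such that $\varphi\psi$ is the projection onto $\operatorname{Im}\varphi$ along $\operatorname{Ker}\varphi^\bullet$ and $\psi\varphi$ is the projection onto $\operatorname{Im}\varphi^\bullet$ along $\operatorname{Ker}\varphi$. An empty sum is $0$. *)

theory Defs
  imports
    "HOL-Computational_Algebra.Polynomial"
    "HOL-Algebra.Ideal"
    "Jordan_Normal_Form.Matrix_Kernel"
    "Jordan_Normal_Form.DL_Submatrix"
begin

section \<open>Primitive polynomials\<close>

definition primitive :: "'a::comm_ring_1 poly \<Rightarrow> bool" where
  "primitive p \<longleftrightarrow> Idl\<^bsub>class_ring\<^esub> (range (coeff p)) = UNIV"

lemma Idl_mono_ideal: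
  fixes S J :: "'a::comm_ring_1 set"
  assumes "ideal J class_ring" "S \<subseteq> J"
  shows "Idl\<^bsub>class_ring\<^esub> S \<subseteq> J"
  using assms by (auto simp: genideal_def)

lemma ideal_class_ringI:
  fixes J :: "'a::comm_ring_1 set"
  assumes "0 \<in> J" "\<And>x y. x \<in> J \<Longrightarrow> y \<in> J \<Longrightarrow> x + y \<in> J" "\<And>r x. x \<in> J \<Longrightarrow> r * x \<in> J"
  shows "ideal J class_ring"
proof (rule idealI)
  show "ring (class_ring :: 'a ring)" by (rule class_ring.ring_axioms)
  show "subgroup J (add_monoid (class_ring :: 'a ring))"
  proof (rule group.subgroupI)
    show "Group.group (add_monoid (class_ring :: 'a ring))"
      using class_ring.add.is_group by simp
    show "inv\<^bsub>add_monoid (class_ring :: 'a ring)\<^esub> x \<in> J" if "x \<in> J" for x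
    proof -
      have "inv\<^bsub>add_monoid (class_ring :: 'a ring)\<^esub> x = - x"
        using class_ring_simps by (metis a_inv_def)
      then show ?thesis using assms(3)[OF that, of "-1"] by simp
    qed
  qed (use assms in auto)
  show "x \<otimes>\<^bsub>class_ring\<^esub> a \<in> J" if "a \<in> J" for a x
    using that assms(3) by simp
  show "a \<otimes>\<^bsub>class_ring\<^esub> x \<in> J" if "a \<in> J" for a x
    using that assms(3)[OF that, of x] by (simp add: mult.commute)
qed

lemma ideal_class_ringD:
  fixes J :: "'a::comm_ring_1 set"
  assumes "ideal J class_ring"
  shows "0 \<in> J" "x \<in> J \<Longrightarrow> y \<in> J \<Longrightarrow> x + y \<in> J" "x \<in> J \<Longrightarrow> r * x \<in> J"
  using additive_subgroup.zero_closed[OF ideal.axioms(1)[OF assms]]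
    additive_subgroup.a_closed[OF ideal.axioms(1)[OF assms], of x y]
    ideal.I_l_closed[OF assms, of x r]
  by auto

lemma ideal_genideal: "ideal (Idl\<^bsub>class_ring\<^esub> S) (class_ring :: 'a::comm_ring_1 ring)"
  by (rule ring.genideal_ideal[OF class_ring.ring_axioms]) simp

lemma genideal_superset: "(S :: 'a::comm_ring_1 set) \<subseteq> Idl\<^bsub>class_ring\<^esub> S"
  by (auto simp: genideal_def)

lemma primitive_cancel:
  fixes p q :: "'a::comm_ring_1 poly"
  assumes J: "ideal J class_ring" and p: "primitive p" and pq: "\<And>i. coeff (p * q) i \<in> J"
  shows "coeff q j \<in> J"
proof -
  note D = ideal_class_ringD[OF J]
  have sumJ: "sum f X \<in> J" if "\<And>x. x \<in> X \<Longrightarrow> f x \<in> J" for f and X :: "nat set"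
    using that by (induction X rule: infinite_finite_induct) (auto intro: D)
  have from_all: "coeff q j \<in> J" if *: "\<And>i j. coeff p i * coeff q j \<in> J" for q j
  proof -
    have "ideal {c. c * coeff q j \<in> J} class_ring"
      by (rule ideal_class_ringI) (auto simp: distrib_right mult.assoc intro: D)
    then have "Idl\<^bsub>class_ring\<^esub> (range (coeff p)) \<subseteq> {c. c * coeff q j \<in> J}"
      by (rule Idl_mono_ideal) (use * in auto)
    then have "1 \<in> {c. c * coeff q j \<in> J}" using p unfolding primitive_def by blast
    then show ?thesis by simp
  qed
  have main: "\<forall>q. (\<forall>i. coeff (p * q) i \<in> J) \<longrightarrow> (\<forall>j\<ge>n. coeff q j \<in> J) \<longrightarrow> (\<forall>j. coeff q j \<in> J)" for n
  proof (induction n)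
    case 0
    then show ?case by auto
  next
    case (Suc n)
    show ?case
    proof (intro allI impI)
      fix q j
      assume pq: "\<forall>i. coeff (p * q) i \<in> J" and q: "\<forall>j\<ge>Suc n. coeff q j \<in> J"
      have step: "\<forall>j. coeff p i * coeff q j \<in> J" for i
      proof (induction "degree p - i" arbitrary: i rule: less_induct)
        case (less i)
        have gt: "coeff p u * coeff q j \<in> J" if "u > i" for u j
        proof (cases "u \<le> degree p")
          case True
          then show ?thesis using less[of u] that by auto
        next
          case False
          then show ?thesis by (simp add: coeff_eq_0 D(1))
        qed
        have "coeff (p * q) (i + n) = (\<Sum>u\<le>i+n. coeff p u * coeff q (i + n - u))"
          by (simp add: coeff_mult)
        also have "\<dots> = coeff p i * coeff q n + (\<Sum>u\<in>{..i+n}-{i}. coeff p u * coeff q (i + n - u))"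
          by (subst sum.remove[of _ i]) auto
        finally have eq: "coeff p i * coeff q n =
            coeff (p * q) (i + n) + (-1) * (\<Sum>u\<in>{..i+n}-{i}. coeff p u * coeff q (i + n - u))"
          by simp
        have "(\<Sum>u\<in>{..i+n}-{i}. coeff p u * coeff q (i + n - u)) \<in> J"
        proof (rule sumJ)
          fix u assume "u \<in> {..i+n} - {i}"
          then consider "u > i" | "u < i" by fastforce
          then show "coeff p u * coeff q (i + n - u) \<in> J"
          proof cases
            case 1
            then show ?thesis by (rule gt)
          next
            case 2
            then have "coeff q (i + n - u) \<in> J" using q by auto
            then show ?thesis by (rule D(3))
          qed
        qed
        then have top: "coeff p i * coeff q n \<in> J"
          unfolding eq using pq by (intro D(2) D(3)) auto
        have "\<forall>l. coeff (p * Polynomial.smult (coeff p i) q) l \<in> J"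
          using pq by (auto intro: D(3))
        moreover have "\<forall>l\<ge>n. coeff (Polynomial.smult (coeff p i) q) l \<in> J"
        proof (intro allI impI)
          fix l assume "l \<ge> n"
          then show "coeff (Polynomial.smult (coeff p i) q) l \<in> J"
            using top q by (cases "l = n") (auto intro: D(3))
        qed
        ultimately have "\<forall>l. coeff (Polynomial.smult (coeff p i) q) l \<in> J" using Suc by blast
        then show ?case by simp
      qed
      show "coeff q j \<in> J" using from_all step by blast
    qed
  qed
  have "\<forall>j\<ge>Suc (degree q). coeff q j \<in> J" by (auto simp: coeff_eq_0 D(1))
  then show ?thesis using main pq by blast
qed

lemma primitive_regular:
  fixes p q :: "'a::comm_ring_1 poly"
  assumes "primitive p" "p * q = 0"
  shows "q = 0"
proof -
  have "ideal {0} (class_ring :: 'a ring)" by (rule ideal_class_ringI) auto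
  from primitive_cancel[OF this assms(1), of q] assms(2) have "coeff q j = 0" for j by auto
  then show ?thesis by (simp add: poly_eq_iff)
qed

lemma primitive_mult [intro]:
  fixes p q :: "'a::comm_ring_1 poly"
  assumes "primitive p" "primitive q"
  shows "primitive (p * q)"
proof -
  let ?J = "Idl\<^bsub>class_ring\<^esub> (range (coeff (p * q)))"
  have "coeff (p * q) i \<in> ?J" for i by (rule subsetD[OF genideal_superset]) simp
  then have "coeff q j \<in> ?J" for j by (rule primitive_cancel[OF ideal_genideal assms(1)])
  then have "Idl\<^bsub>class_ring\<^esub> (range (coeff q)) \<subseteq> ?J"
    by (intro Idl_mono_ideal ideal_genideal) auto
  then show ?thesis using assms(2) unfolding primitive_def by blast
qed

lemma primitive_monom [simp, intro]: "primitive (monom (1::'a::comm_ring_1) n)"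
proof -
  let ?J = "Idl\<^bsub>class_ring\<^esub> (range (coeff (monom (1::'a) n)))"
  have "coeff (monom (1::'a) n) n \<in> ?J" by (rule subsetD[OF genideal_superset]) simp
  then have "1 \<in> ?J" by simp
  then have "r * 1 \<in> ?J" for r by (rule ideal_class_ringD(3)[OF ideal_genideal])
  then show ?thesis unfolding primitive_def by auto
qed

lemma primitive_1 [simp, intro]: "primitive (1 :: 'a::comm_ring_1 poly)"
  using primitive_monom[of 0] by (simp add: monom_0 one_pCons)

lemma not_primitive_0 [simp]: "\<not> primitive (0 :: 'a::comm_ring_1 poly)"
  using primitive_regular[of 0 1] by auto


section \<open>The ring \<open>A(t)\<close> (Nagata ring)\<close>

text \<open>
  The localization of \<open>A[t]\<close> at the multiplicative set of primitive polynomials. Primitive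
  polynomials are regular (\<open>primitive_regular\<close>), so equality of fractions is cross-multiplication.
\<close>

lifting_forget poly.lifting

definition nagata_rel :: "'a::comm_ring_1 poly \<times> 'a poly \<Rightarrow> 'a poly \<times> 'a poly \<Rightarrow> bool" where
  "nagata_rel x y \<longleftrightarrow> primitive (snd x) \<and> primitive (snd y) \<and> fst x * snd y = fst y * snd x"

lemma primitive_mult_left_cancel:
  fixes p q r :: "'a::comm_ring_1 poly"
  assumes "primitive p" "p * q = p * r"
  shows "q = r"
  using primitive_regular[OF assms(1), of "q - r"] assms(2) by (simp add: algebra_simps)

lemma part_equivp_nagata_rel: "part_equivp (nagata_rel :: 'a::comm_ring_1 poly \<times> 'a poly \<Rightarrow> _)"
proof (rule part_equivpI)
  show "\<exists>x. nagata_rel x (x :: 'a poly \<times> 'a poly)"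
    by (rule exI[of _ "(0, 1)"]) (simp add: nagata_rel_def)
  show "symp (nagata_rel :: 'a poly \<times> 'a poly \<Rightarrow> _)" by (auto simp: symp_def nagata_rel_def)
  show "transp (nagata_rel :: 'a poly \<times> 'a poly \<Rightarrow> _)"
  proof (rule transpI, unfold split_paired_all)
    fix a b a' b' a'' b'' :: "'a poly"
    assume A: "nagata_rel (a, b) (a', b')" and B: "nagata_rel (a', b') (a'', b'')"
    have "b' * (a * b'') = b'' * (a * b')" by (simp add: ac_simps)
    also from A have "a * b' = a' * b" by (simp add: nagata_rel_def)
    also have "b'' * (a' * b) = b * (a' * b'')" by (simp add: ac_simps)
    also from B have "a' * b'' = a'' * b'" by (simp add: nagata_rel_def)
    also have "b * (a'' * b') = b' * (a'' * b)" by (simp add: ac_simps)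
    finally have "b' * (a * b'') = b' * (a'' * b)" .
    moreover from B have "primitive b'" by (simp add: nagata_rel_def)
    ultimately have "a * b'' = a'' * b" by (metis primitive_mult_left_cancel)
    with A B show "nagata_rel (a, b) (a'', b'')" by (auto simp: nagata_rel_def)
  qed
qed

quotient_type (overloaded) 'a nagata = "'a::comm_ring_1 poly \<times> 'a poly" / partial: nagata_rel
  by (rule part_equivp_nagata_rel)

text \<open>\<open>nagata_Fract a b\<close> is \<open>a / b\<close>, meaningful for primitive \<open>b\<close> only.\<close>

lift_definition nagata_Fract :: "'a::comm_ring_1 poly \<Rightarrow> 'a poly \<Rightarrow> 'a nagata"
  is "\<lambda>a b. if primitive b then (a, b) else (0, 1)"
  by (simp add: nagata_rel_def)

lemma nagata_cases [cases type: nagata]: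
  obtains a b where "q = nagata_Fract a b" "primitive b"
  by transfer (auto simp: nagata_rel_def)

lemma eq_nagata:
  "primitive b \<Longrightarrow> primitive d \<Longrightarrow> nagata_Fract a b = nagata_Fract c d \<longleftrightarrow> a * d = c * b"
  by transfer (simp add: nagata_rel_def)

instantiation nagata :: (comm_ring_1) comm_ring_1
begin

lift_definition zero_nagata :: "'a nagata" is "(0, 1)" by (simp add: nagata_rel_def)

lift_definition one_nagata :: "'a nagata" is "(1, 1)" by (simp add: nagata_rel_def)

lift_definition plus_nagata :: "'a nagata \<Rightarrow> 'a nagata \<Rightarrow> 'a nagata"
  is "\<lambda>q r. (fst q * snd r + fst r * snd q, snd q * snd r)"
proof -
  fix q q' r r' :: "'a poly \<times> 'a poly"
  assume q: "nagata_rel q q'" and r: "nagata_rel r r'"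
  have "(fst q * snd r + fst r * snd q) * (snd q' * snd r') =
      (fst q * snd q') * (snd r * snd r') + (fst r * snd r') * (snd q * snd q')"
    by (simp add: algebra_simps)
  also have "\<dots> = (fst q' * snd q) * (snd r * snd r') + (fst r' * snd r) * (snd q * snd q')"
    using q r by (simp add: nagata_rel_def)
  also have "\<dots> = (fst q' * snd r' + fst r' * snd q') * (snd q * snd r)"
    by (simp add: algebra_simps)
  finally show "nagata_rel (fst q * snd r + fst r * snd q, snd q * snd r)
      (fst q' * snd r' + fst r' * snd q', snd q' * snd r')"
    using q r by (auto simp: nagata_rel_def)
qed

lift_definition uminus_nagata :: "'a nagata \<Rightarrow> 'a nagata" is "\<lambda>x. (- fst x, snd x)"
  by (simp add: nagata_rel_def)

definition minus_nagata :: "'a nagata \<Rightarrow> 'a nagata \<Rightarrow> 'a nagata" where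
  "minus_nagata q r = q + - r"

lift_definition times_nagata :: "'a nagata \<Rightarrow> 'a nagata \<Rightarrow> 'a nagata"
  is "\<lambda>q r. (fst q * fst r, snd q * snd r)"
proof -
  fix q q' r r' :: "'a poly \<times> 'a poly"
  assume q: "nagata_rel q q'" and r: "nagata_rel r r'"
  have "(fst q * fst r) * (snd q' * snd r') = (fst q * snd q') * (fst r * snd r')"
    by (simp add: algebra_simps)
  also have "\<dots> = (fst q' * snd q) * (fst r' * snd r)"
    using q r by (simp add: nagata_rel_def)
  also have "\<dots> = (fst q' * fst r') * (snd q * snd r)" by (simp add: algebra_simps)
  finally show "nagata_rel (fst q * fst r, snd q * snd r) (fst q' * fst r', snd q' * snd r')"
    using q r by (auto simp: nagata_rel_def)
qed

lemma Zero_nagata_def: "0 = nagata_Fract 0 1"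
  by transfer (simp add: nagata_rel_def)

lemma One_nagata_def: "1 = nagata_Fract 1 1"
  by transfer (simp add: nagata_rel_def)

lemma add_nagata:
  "primitive b \<Longrightarrow> primitive d \<Longrightarrow>
    nagata_Fract a b + nagata_Fract c d = nagata_Fract (a * d + c * b) (b * d)"
  by transfer (auto simp: nagata_rel_def)

lemma uminus_nagata: "primitive b \<Longrightarrow> - nagata_Fract a b = nagata_Fract (- a) b"
  by transfer (auto simp: nagata_rel_def)

lemma mult_nagata:
  "primitive b \<Longrightarrow> primitive d \<Longrightarrow>
    nagata_Fract a b * nagata_Fract c d = nagata_Fract (a * c) (b * d)"
  by transfer (auto simp: nagata_rel_def)

instance
proof
  fix q r s :: "'a nagata"
  obtain a b c d e f where [simp]: "q = nagata_Fract a b" "primitive b"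
    "r = nagata_Fract c d" "primitive d" "s = nagata_Fract e f" "primitive f"
    by (meson nagata_cases)
  note [simp] = add_nagata mult_nagata uminus_nagata eq_nagata primitive_mult
  show "(q * r) * s = q * (r * s)" by (simp add: algebra_simps)
  show "q * r = r * q" by (simp add: algebra_simps)
  show "1 * q = q" by (simp add: One_nagata_def)
  show "(q + r) + s = q + (r + s)" by (simp add: algebra_simps)
  show "q + r = r + q" by (simp add: algebra_simps)
  show "0 + q = q" by (simp add: Zero_nagata_def)
  show "- q + q = 0" by (simp add: Zero_nagata_def algebra_simps)
  show "q - r = q + - r" by (simp add: minus_nagata_def)
  show "(q + r) * s = q * s + r * s" by (simp add: algebra_simps)
  show "(0::'a nagata) \<noteq> 1" by (simp add: Zero_nagata_def One_nagata_def)
qed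

end

definition nagata_of_poly :: "'a::comm_ring_1 poly \<Rightarrow> 'a nagata" where
  "nagata_of_poly p = nagata_Fract p 1"

definition nagata_const :: "'a::comm_ring_1 \<Rightarrow> 'a nagata" where
  "nagata_const a = nagata_of_poly [:a:]"

text \<open>
  The integer powers \<open>t\<^sup>e\<close>; since \<open>t\<close> is primitive, \<open>A[t, 1/t]\<close> is a subring of \<open>A(t)\<close>.
\<close>

definition nagata_tpow :: "int \<Rightarrow> 'a::comm_ring_1 nagata" where
  "nagata_tpow e = nagata_Fract (monom 1 (nat e)) (monom 1 (nat (- e)))"

lemma nagata_of_poly_eq_iff: "nagata_of_poly p = nagata_of_poly q \<longleftrightarrow> p = q"
  by (simp add: nagata_of_poly_def eq_nagata)

lemma nagata_of_poly_hom:
  "nagata_of_poly 0 = 0" "nagata_of_poly 1 = 1"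
  "nagata_of_poly (p + q) = nagata_of_poly p + nagata_of_poly q"
  "nagata_of_poly (p * q) = nagata_of_poly p * nagata_of_poly q"
  by (simp_all add: nagata_of_poly_def Zero_nagata_def One_nagata_def add_nagata mult_nagata)

lemma nagata_of_poly_mult_Fract:
  "primitive b \<Longrightarrow> nagata_of_poly b * nagata_Fract a b = nagata_of_poly a"
  by (simp add: nagata_of_poly_def mult_nagata eq_nagata)

lemma nagata_tpow_add: "nagata_tpow (d + e) = (nagata_tpow d * nagata_tpow e :: 'a::comm_ring_1 nagata)"
proof -
  have "nat (d + e) + (nat (- d) + nat (- e)) = nat d + nat e + nat (- (d + e))" by linarith
  then show ?thesis
    by (simp add: nagata_tpow_def mult_nagata eq_nagata primitive_mult mult_monom)
qed

lemma nagata_tpow_0: "nagata_tpow 0 = (1 :: 'a::comm_ring_1 nagata)"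
  by (simp add: nagata_tpow_def One_nagata_def monom_0 one_pCons)

lemma nagata_tpow_1: "nagata_tpow 1 = (nagata_of_poly [:0, 1:] :: 'a::comm_ring_1 nagata)"
  by (simp add: nagata_tpow_def nagata_of_poly_def monom_altdef flip: one_pCons)

definition is_primitive_poly_in_nagata :: "'a::comm_ring_1 nagata \<Rightarrow> bool" where
  "is_primitive_poly_in_nagata x \<longleftrightarrow> (\<exists>p. primitive p \<and> x = nagata_of_poly p)"


section \<open>Images, direct sums, determinantal ideals\<close>

definition mat_range :: "'a::comm_ring_1 mat \<Rightarrow> 'a vec set" where
  "mat_range A = (\<lambda>v. A *\<^sub>v v) ` carrier_vec (dim_col A)"

text \<open>Internal direct sum \<open>M \<oplus> N = R\<^sup>d\<close> of submodules.\<close>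

definition is_direct_sum :: "nat \<Rightarrow> 'a::comm_ring_1 vec set \<Rightarrow> 'a vec set \<Rightarrow> bool" where
  "is_direct_sum d M N \<longleftrightarrow>
     submodule class_ring M (module_vec TYPE('a) d) \<and>
     submodule class_ring N (module_vec TYPE('a) d) \<and>
     M \<inter> N = {0\<^sub>v d} \<and> {x + y | x y. x \<in> M \<and> y \<in> N} = carrier_vec d"

definition det_ideal :: "nat \<Rightarrow> 'a::comm_ring_1 mat \<Rightarrow> 'a set" where
  "det_ideal j A = Idl\<^bsub>class_ring\<^esub> {det (submatrix A I J) | I J.
     I \<subseteq> {..<dim_row A} \<and> J \<subseteq> {..<dim_col A} \<and> card I = j \<and> card J = j}"

definition rank_le :: "nat \<Rightarrow> 'a::comm_ring_1 mat \<Rightarrow> bool" where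
  "rank_le k A \<longleftrightarrow> det_ideal (Suc k) A = {0}"

definition locally_simple :: "'a::comm_ring_1 mat \<Rightarrow> bool" where
  "locally_simple A \<longleftrightarrow> (\<exists>N. is_direct_sum (dim_row A) (mat_range A) N)"

definition locally_simple_of_rank :: "nat \<Rightarrow> 'a::comm_ring_1 mat \<Rightarrow> bool" where
  "locally_simple_of_rank k A \<longleftrightarrow> locally_simple A \<and> det_ideal k A = UNIV \<and> det_ideal (Suc k) A = {0}"

text \<open>The block matrix only makes sense for \<open>k \<le> min m n\<close>.\<close>

definition I_block :: "nat \<Rightarrow> nat \<Rightarrow> nat \<Rightarrow> 'a::comm_ring_1 mat" where
  "I_block k m n = mat m n (\<lambda>(i, j). if i = j \<and> i < k then 1 else 0)"

definition simple_of_rank :: "nat \<Rightarrow> 'a::comm_ring_1 mat \<Rightarrow> bool" where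
  "simple_of_rank k A \<longleftrightarrow> k \<le> dim_row A \<and> k \<le> dim_col A \<and>
     (\<exists>U V. U \<in> carrier_mat (dim_row A) (dim_row A) \<and> V \<in> carrier_mat (dim_col A) (dim_col A) \<and>
        invertible_mat U \<and> invertible_mat V \<and> A = U * I_block k (dim_row A) (dim_col A) * V)"

text \<open>
  A submodule \<open>M\<close> of a free module is projective of constant rank \<open>k\<close> if it is isomorphic to the
  image of an idempotent matrix \<open>F\<close> (i.e. it is finitely generated projective) that is of rank \<open>k\<close>.
\<close>

definition projective_of_rank :: "nat \<Rightarrow> 'a::comm_ring_1 vec set \<Rightarrow> bool" where
  "projective_of_rank k M \<longleftrightarrow>
     (\<exists>r F \<theta>. F \<in> carrier_mat r r \<and> F * F = F \<and> det_ideal k F = UNIV \<and> det_ideal (Suc k) F = {0} \<and>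
        bij_betw \<theta> M (mat_range F) \<and>
        (\<forall>x\<in>M. \<forall>y\<in>M. \<theta> (x + y) = \<theta> x + \<theta> y) \<and>
        (\<forall>c. \<forall>x\<in>M. \<theta> (c \<cdot>\<^sub>v x) = c \<cdot>\<^sub>v \<theta> x))"


section \<open>Crossed maps and generalized inverses\<close>

definition crossed :: "'a::comm_ring_1 mat \<Rightarrow> 'a mat \<Rightarrow> bool" where
  "crossed A B \<longleftrightarrow> B \<in> carrier_mat (dim_col A) (dim_row A) \<and>
     is_direct_sum (dim_row A) (mat_range A) (mat_kernel B) \<and>
     is_direct_sum (dim_col A) (mat_kernel A) (mat_range B)"

definition crossed_of_rank :: "nat \<Rightarrow> 'a::comm_ring_1 mat \<Rightarrow> 'a mat \<Rightarrow> bool" where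
  "crossed_of_rank k A B \<longleftrightarrow> crossed A B \<and> projective_of_rank k (mat_range A)"

definition is_projection :: "nat \<Rightarrow> 'a::comm_ring_1 mat \<Rightarrow> 'a vec set \<Rightarrow> 'a vec set \<Rightarrow> bool" where
  "is_projection d P M N \<longleftrightarrow> P \<in> carrier_mat d d \<and> is_direct_sum d M N \<and>
     (\<forall>x\<in>M. P *\<^sub>v x = x) \<and> (\<forall>y\<in>N. P *\<^sub>v y = 0\<^sub>v d)"

text \<open>
  \<open>G\<close> is the generalized inverse of \<open>A\<close> via \<open>B\<close>. The two projection conditions alone do not
  determine \<open>G\<close> (take \<open>A = 0\<close>, \<open>B = 0\<close>); the last equation, \<open>G A G = G\<close>, is what makes it
  unique, see \<open>is_generalized_inverse_unique\<close>.
\<close>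

definition is_generalized_inverse :: "'a::comm_ring_1 mat \<Rightarrow> 'a mat \<Rightarrow> 'a mat \<Rightarrow> bool" where
  "is_generalized_inverse A B G \<longleftrightarrow> crossed A B \<and> G \<in> carrier_mat (dim_col A) (dim_row A) \<and>
     is_projection (dim_row A) (A * G) (mat_range A) (mat_kernel B) \<and>
     is_projection (dim_col A) (G * A) (mat_range B) (mat_kernel A) \<and>
     G * A * G = G"

lemma is_projection_unique:
  fixes P P' :: "'a::comm_ring_1 mat"
  assumes P: "is_projection d P M N" and P': "is_projection d P' M N"
  shows "P = P'"
proof -
  have c: "P \<in> carrier_mat d d" "P' \<in> carrier_mat d d"
    using P P' by (auto simp: is_projection_def)
  have MN: "M \<subseteq> carrier_vec d" "N \<subseteq> carrier_vec d"
    using P by (auto simp: is_projection_def is_direct_sum_def submodule_def module_vec_def)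
  have eq: "P *\<^sub>v v = P' *\<^sub>v v" if "v \<in> carrier_vec d" for v
  proof -
    from that P obtain x y where v: "v = x + y" "x \<in> M" "y \<in> N"
      unfolding is_projection_def is_direct_sum_def by blast
    then have "x \<in> carrier_vec d" "y \<in> carrier_vec d" using MN by auto
    then have "P *\<^sub>v v = P *\<^sub>v x + P *\<^sub>v y" "P' *\<^sub>v v = P' *\<^sub>v x + P' *\<^sub>v y"
      using c v(1) by (auto simp: mult_add_distrib_mat_vec)
    then show ?thesis using P P' v by (simp add: is_projection_def)
  qed
  show ?thesis
  proof (rule eq_matI)
    fix i j assume ij: "i < dim_row P'" "j < dim_col P'"
    have "P *\<^sub>v unit_vec d j = P' *\<^sub>v unit_vec d j" by (rule eq) simp
    then have "(P *\<^sub>v unit_vec d j) $ i = (P' *\<^sub>v unit_vec d j) $ i" by simp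
    then show "P $$ (i, j) = P' $$ (i, j)"
      using ij c by (simp add: scalar_prod_right_unit)
  qed (use c in auto)
qed

lemma is_generalized_inverse_unique:
  assumes G: "is_generalized_inverse A B G" and G': "is_generalized_inverse A B G'"
  shows "G = G'"
proof -
  have c: "A \<in> carrier_mat (dim_row A) (dim_col A)"
    "G \<in> carrier_mat (dim_col A) (dim_row A)" "G' \<in> carrier_mat (dim_col A) (dim_row A)"
    using G G' by (auto simp: is_generalized_inverse_def)
  have AG: "A * G = A * G'" and GA: "G * A = G' * A"
    using G G' is_projection_unique unfolding is_generalized_inverse_def by metis+
  have "G = G * A * G" using G by (simp add: is_generalized_inverse_def)
  also have "\<dots> = G' * (A * G)" using GA c by (simp add: assoc_mult_mat[OF c(3) c(1) c(2)])
  also have "\<dots> = G' * A * G'" using AG c by (simp add: assoc_mult_mat[OF c(3) c(1) c(3)])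
  also have "\<dots> = G'" using G' by (simp add: is_generalized_inverse_def)
  finally show ?thesis .
qed


section \<open>The matrix \<open>A\<degree>\<close>, the Gram polynomial and the adjoint\<close>

definition over_nagata :: "'a::comm_ring_1 mat \<Rightarrow> 'a nagata mat" where
  "over_nagata A = map_mat nagata_const A"

definition Q_mat :: "nat \<Rightarrow> 'a::comm_ring_1 nagata mat" where
  "Q_mat r = mat r r (\<lambda>(i, j). if i = j then nagata_tpow (int i) else 0)"

definition Q_inv :: "nat \<Rightarrow> 'a::comm_ring_1 nagata mat" where
  "Q_inv r = mat r r (\<lambda>(i, j). if i = j then nagata_tpow (- int i) else 0)"

definition circ_mat :: "'a::comm_ring_1 mat \<Rightarrow> 'a nagata mat" where
  "circ_mat A = Q_inv (dim_col A) * transpose_mat (over_nagata A) * Q_mat (dim_row A)"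

lemma Q_inv_mult_left:
  assumes "B \<in> carrier_mat r s"
  shows "Q_inv r * B = mat r s (\<lambda>(i, j). nagata_tpow (- int i) * B $$ (i, j))"
proof (rule eq_matI)
  fix i j
  assume "i < dim_row (mat r s (\<lambda>(i, j). nagata_tpow (- int i) * B $$ (i, j)))"
    and "j < dim_col (mat r s (\<lambda>(i, j). nagata_tpow (- int i) * B $$ (i, j)))"
  then have ij: "i < r" "j < s" by auto
  have "(Q_inv r * B) $$ (i, j) = (\<Sum>l<r. (if i = l then nagata_tpow (- int i) else 0) * B $$ (l, j))"
    using ij assms by (auto simp: Q_inv_def scalar_prod_def lessThan_atLeast0 intro!: sum.cong)
  also have "\<dots> = (\<Sum>l<r. if l = i then nagata_tpow (- int i) * B $$ (i, j) else 0)"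
    by (rule sum.cong) auto
  also have "\<dots> = nagata_tpow (- int i) * B $$ (i, j)" using ij by simp
  finally show "(Q_inv r * B) $$ (i, j) =
      mat r s (\<lambda>(i, j). nagata_tpow (- int i) * B $$ (i, j)) $$ (i, j)"
    using ij by simp
qed (use assms in \<open>auto simp: Q_inv_def\<close>)

lemma mult_Q_mat_right:
  assumes "B \<in> carrier_mat r s"
  shows "B * Q_mat s = mat r s (\<lambda>(i, j). B $$ (i, j) * nagata_tpow (int j))"
proof (rule eq_matI)
  fix i j
  assume "i < dim_row (mat r s (\<lambda>(i, j). B $$ (i, j) * nagata_tpow (int j)))"
    and "j < dim_col (mat r s (\<lambda>(i, j). B $$ (i, j) * nagata_tpow (int j)))"
  then have ij: "i < r" "j < s" by auto
  have "(B * Q_mat s) $$ (i, j) = (\<Sum>l<s. B $$ (i, l) * (if l = j then nagata_tpow (int l) else 0))"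
    using ij assms by (auto simp: Q_mat_def scalar_prod_def lessThan_atLeast0 intro!: sum.cong)
  also have "\<dots> = (\<Sum>l<s. if l = j then B $$ (i, j) * nagata_tpow (int j) else 0)"
    by (rule sum.cong) auto
  also have "\<dots> = B $$ (i, j) * nagata_tpow (int j)" using ij by simp
  finally show "(B * Q_mat s) $$ (i, j) = mat r s (\<lambda>(i, j). B $$ (i, j) * nagata_tpow (int j)) $$ (i, j)"
    using ij by simp
qed (use assms in \<open>auto simp: Q_mat_def\<close>)

lemma Q_inv_mult_Q_mat: "Q_inv r * Q_mat r = 1\<^sub>m r"
proof -
  have "Q_mat r \<in> carrier_mat r r" by (simp add: Q_mat_def)
  note L = Q_inv_mult_left[OF this]
  show ?thesis
    unfolding L by (rule eq_matI) (auto simp: Q_mat_def nagata_tpow_add[symmetric] nagata_tpow_0)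
qed

lemma circ_mat_index:
  assumes "A \<in> carrier_mat m n"
  shows "circ_mat A = mat n m (\<lambda>(i, j). nagata_tpow (int j - int i) * nagata_const (A $$ (j, i)))"
proof -
  have "transpose_mat (over_nagata A) \<in> carrier_mat n m"
    using assms by (simp add: over_nagata_def)
  note L = Q_inv_mult_left[OF this]
  have "Q_inv n * transpose_mat (over_nagata A) \<in> carrier_mat n m" by (simp add: L)
  note R = mult_Q_mat_right[OF this]
  have t: "nagata_tpow (int j - int i) = nagata_tpow (- int i) * (nagata_tpow (int j) :: 'a nagata)" for i j
    by (simp add: nagata_tpow_add[symmetric])
  have d: "dim_row A = m" "dim_col A = n" using assms by auto
  show ?thesis
    unfolding circ_mat_def d R unfolding L
    by (rule eq_matI) (auto simp: d t over_nagata_def mult_ac)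
qed

text \<open>\<open>det (I + Z A B)\<close> as a polynomial in \<open>Z\<close>, and its coefficients \<open>g\<^sub>\<ell>\<close>.\<close>

definition gram_poly :: "'a::comm_ring_1 mat \<Rightarrow> 'a mat \<Rightarrow> 'a poly" where
  "gram_poly A B = det (1\<^sub>m (dim_row A) + [:0, 1:] \<cdot>\<^sub>m map_mat (\<lambda>c. [:c:]) (A * B))"

definition gram_coeff :: "'a::comm_ring_1 mat \<Rightarrow> 'a mat \<Rightarrow> nat \<Rightarrow> 'a" where
  "gram_coeff A B l = coeff (gram_poly A B) l"

definition Adj_cross :: "nat \<Rightarrow> 'a::comm_ring_1 mat \<Rightarrow> 'a mat \<Rightarrow> 'a mat" where
  "Adj_cross k A B = mat (dim_col A) (dim_row A) (\<lambda>ij.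
     \<Sum>l<k. (-1) ^ l * gram_coeff A B (k - 1 - l) * (((B * A) ^\<^sub>m l * B) $$ ij))"

end

theory Submission
  imports Defs
begin

text \<open>
  Everything is reduced to two properties of the determinantal ideals of \<open>A\<close>: the minors of order
  \<open>k + 1\<close> vanish, and the minors of order \<open>k\<close> generate the unit ideal. Both properties pass
  between the base ring and its Nagata ring, because a primitive polynomial with coefficients in an
  ideal forces this ideal to be the whole ring.

  By Cauchy--Binet the coefficient \<open>g\<^sub>k\<close> is the sum of the terms
  \<open>t\<^bsup>w\<^esup> \<mu>\<^sub>I\<^sub>J\<^sup>2\<close>, where \<open>\<mu>\<^sub>I\<^sub>J\<close> runs over the minors of order
  \<open>k\<close> of \<open>A\<close> and the weight \<open>w\<close> is the sum of \<open>I\<close> minus the sum of \<open>J\<close>. Different minors may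
  have the same weight, so an ideal \<open>\<aa>\<close> that contains the coefficients of \<open>g\<^sub>k\<close> only
  contains sums of squares of minors. The heart of the proof (\<open>minors_in_radical\<close>) is that each minor
  lies in the radical of \<open>\<aa>\<close> nevertheless, provided that the minors of order \<open>k + 1\<close> vanish:
  a relation of Pluecker type (\<open>minor_exchange\<close>) writes the product of two different minors of
  equal weight in terms of minors of larger weight. So, going down in the weight, all products of
  different minors of one weight are already in the radical, and the sum of squares
  isolates one cube. Hence \<open>g\<^sub>k\<close> is primitive, up to a power of \<open>t\<close>, exactly if the minors
  of order \<open>k\<close> generate the unit ideal; and if \<open>g\<^sub>k = 0\<close>, then the minors of order \<open>k\<close>
  are nilpotent, both times under the assumption on the minors of order \<open>k + 1\<close>.

  The vanishing of the minors of order \<open>k + 1\<close> also bounds the degree of \<open>det (I + Z A C)\<close> by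
  \<open>k\<close> for every matrix \<open>C\<close>. Comparing two matrices \<open>C\<close> that differ in one entry shows that the
  coefficient of \<open>Z\<^sup>k\<close> in \<open>adj (I + Z A B) A\<close> is zero, which is the identity
  \<open>A Adj A = g\<^sub>k A\<close> (\<open>Adj_cross_identity\<close>). When \<open>g\<^sub>k\<close> is a unit, the adjoint divided by
  \<open>g\<^sub>k\<close> is therefore the generalized inverse, and the maps are crossed.

  Conversely, crossed maps and the identity \<open>A Adj A = g\<^sub>k A\<close> both provide a matrix \<open>B\<close>
  with \<open>A B A = A\<close>, so that the determinantal ideals of \<open>A\<close> over the Nagata ring are idempotent.
  If \<open>g\<^sub>l = 0\<close> for all \<open>l > k\<close>, then, going down from large \<open>l\<close>, these ideals are
  generated by nilpotent elements and idempotent, hence zero (\<open>minors_vanish_of_nilpotent\<close>). Over a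
  reduced ring the nilpotent minors vanish without the help of \<open>B\<close>.

  For the normal form \<open>U I\<^sub>k V\<close>, a matrix over the Nagata ring is reduced one pivot at a time:
  if its entries generate the unit ideal, then adding multiples of its rows and columns by sparse
  powers of \<open>t\<close> to the first ones produces an entry in which all coefficients of all entries are
  visible separately; this entry is a primitive polynomial up to a denominator, hence a unit
  (\<open>nagata_bilinear_unit\<close>).
\<close>

section \<open>Minors and determinantal ideals\<close>

text \<open>
  Rows and columns are selected by arbitrary functions on \<open>{..<k}\<close>, neither increasing nor injective.
  Replacing one row of a minor is then a function update, which keeps the exchange relations below
  free of sorting signs; \<open>minor_sorted\<close> leads back to increasing selections.
\<close>

definition minor :: "nat \<Rightarrow> 'a::comm_ring_1 mat \<Rightarrow> (nat \<Rightarrow> nat) \<Rightarrow> (nat \<Rightarrow> nat) \<Rightarrow> 'a" where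
  "minor k A f g = det (mat k k (\<lambda>(a, b). A $$ (f a, g b)))"

definition k_subsets :: "nat \<Rightarrow> nat \<Rightarrow> nat set set" where
  "k_subsets k n = {I. I \<subseteq> {..<n} \<and> card I = k}"

lemma finite_k_subsets [simp]: "finite (k_subsets k n)"
  by (rule finite_subset[of _ "Pow {..<n}"]) (auto simp: k_subsets_def)

lemma pick_k_subset:
  assumes "I \<in> k_subsets k n"
  shows "bij_betw (pick I) {..<k} I" "inj_on (pick I) {..<k}" "pick I ` {..<k} = I"
    "a < k \<Longrightarrow> pick I a \<in> I" "a < k \<Longrightarrow> pick I a < n"
proof -
  have I: "I \<subseteq> {..<n}" "card I = k" "finite I" using assms finite_subset
    by (auto simp: k_subsets_def)
  show "a < k \<Longrightarrow> pick I a \<in> I" "a < k \<Longrightarrow> pick I a < n"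
    using pick_in_set_le[of a I] I by auto
  show inj: "inj_on (pick I) {..<k}"
  proof (rule inj_onI)
    fix x y assume xy: "x \<in> {..<k}" "y \<in> {..<k}" "pick I x = pick I y"
    show "x = y"
      using pick_mono_le[of y I x] pick_mono_le[of x I y] xy I(2) by (cases x y rule: linorder_cases) auto
  qed
  show img: "pick I ` {..<k} = I"
  proof (rule card_subset_eq)
    show "pick I ` {..<k} \<subseteq> I" using pick_in_set_le[of _ I] I by auto
    show "card (pick I ` {..<k}) = card I" using card_image[OF inj] I by simp
  qed (use I in auto)
  show "bij_betw (pick I) {..<k} I" using inj img by (simp add: bij_betw_def)
qed

lemma minor_leibniz:
  "minor k A f g = (\<Sum>p | p permutes {..<k}. signof p * (\<Prod>a<k. A $$ (f a, g (p a))))"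
  unfolding minor_def
  by (subst det_def'[of _ k]) (auto simp: atLeast0LessThan intro!: sum.cong prod.cong dest: permutes_in_image)

lemma minor_cong:
  "(\<And>a. a < k \<Longrightarrow> f a = f' a) \<Longrightarrow> (\<And>a. a < k \<Longrightarrow> g a = g' a) \<Longrightarrow> minor k A f g = minor k A f' g'"
  unfolding minor_def by (rule arg_cong[of _ _ det]) auto

lemma minor_transpose:
  assumes "A \<in> carrier_mat m n" "\<And>a. a < k \<Longrightarrow> f a < m" "\<And>a. a < k \<Longrightarrow> g a < n"
  shows "minor k (transpose_mat A) g f = minor k A f g"
proof -
  have "mat k k (\<lambda>(a, b). transpose_mat A $$ (g a, f b)) = transpose_mat (mat k k (\<lambda>(a, b). A $$ (f a, g b)))"
    using assms by (intro eq_matI) auto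
  then show ?thesis unfolding minor_def by (simp add: det_transpose[where n = k])
qed

lemma minor_permute_rows:
  assumes "p permutes {..<k}"
  shows "minor k A (\<lambda>a. f (p a)) g = signof p * minor k A f g"
proof -
  have "mat k k (\<lambda>(a, b). A $$ (f (p a), g b)) =
      mat k k (\<lambda>(a, b). mat k k (\<lambda>(a, b). A $$ (f a, g b)) $$ (p a, b))"
    using permutes_in_image[OF assms] by (intro eq_matI) auto
  then show ?thesis unfolding minor_def
    using det_permute_rows[of "mat k k (\<lambda>(a, b). A $$ (f a, g b))" k p] assms
      by (simp add: atLeast0LessThan)
qed

lemma minor_permute_cols:
  assumes "p permutes {..<k}"
  shows "minor k A f (\<lambda>a. g (p a)) = signof p * minor k A f g"
proof -
  let ?M = "\<lambda>g. mat k k (\<lambda>(a, b). A $$ (f a, g b))"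
  have *: "transpose_mat (?M g) = mat k k (\<lambda>(b, a). A $$ (f a, g b))" for g by (intro eq_matI) auto
  have "det (?M (\<lambda>a. g (p a))) = det (mat k k (\<lambda>(b, a). A $$ (f a, g (p b))))"
    using det_transpose[of "?M (\<lambda>a. g (p a))" k] * by simp
  also have "\<dots> = det (mat k k (\<lambda>(b, a). transpose_mat (?M g) $$ (p b, a)))"
    using permutes_in_image[OF assms] by (intro arg_cong[of _ _ det] eq_matI) auto
  also have "\<dots> = signof p * det (transpose_mat (?M g))"
    using assms by (intro det_permute_rows) (auto simp: atLeast0LessThan)
  finally show ?thesis unfolding minor_def by (simp add: det_transpose[where n = k])
qed

lemma minor_eq_rows:
  assumes "a < k" "a' < k" "a \<noteq> a'" "f a = f a'"
  shows "minor k A f g = 0"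
  unfolding minor_def using assms by (intro det_identical_rows[of _ k a a']) (auto intro!: eq_vecI)

lemma minor_eq_cols:
  assumes "b < k" "b' < k" "b \<noteq> b'" "g b = g b'"
  shows "minor k A f g = 0"
  unfolding minor_def using assms by (intro det_identical_columns[of _ k b b']) (auto intro!: eq_vecI)

lemma minor_row_expand:
  assumes "a < k"
  shows "minor k A (f(a := i)) g =
    (\<Sum>b<k. A $$ (i, g b) * cofactor (mat k k (\<lambda>(a, b). A $$ (f a, g b))) a b)"
proof -
  have "cofactor (mat k k (\<lambda>(c, b). A $$ ((f(a := i)) c, g b))) a b =
      cofactor (mat k k (\<lambda>(a, b). A $$ (f a, g b))) a b" for b
    unfolding cofactor_def mat_delete_def
      by (intro arg_cong2[of _ _ _ _ "(*)"] refl arg_cong[of _ _ det] eq_matI) auto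
  then show ?thesis unfolding minor_def
    by (subst laplace_expansion_row[of _ k a]) (use assms in \<open>auto intro!: sum.cong\<close>)
qed

lemma inj_eq_pick_permutation:
  assumes "inj_on f {..<k}" "\<And>a. a < k \<Longrightarrow> f a < n"
  obtains p where "f ` {..<k} \<in> k_subsets k n" "p permutes {..<k}" "\<And>a. a < k \<Longrightarrow> f a = pick (f ` {..<k}) (p a)"
proof -
  let ?I = "f ` {..<k}"
  have I: "?I \<in> k_subsets k n" using assms by (auto simp: k_subsets_def card_image)
  define p where "p = (\<lambda>a. if a \<in> {..<k} then inv_into {..<k} (pick ?I) (f a) else a)"
  have "bij_betw (inv_into {..<k} (pick ?I) \<circ> f) {..<k} {..<k}"
    by (rule bij_betw_trans[OF _ bij_betw_inv_into[OF pick_k_subset(1)[OF I]]])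
      (use assms(1) in \<open>simp add: bij_betw_def\<close>)
  then have "bij_betw p {..<k} {..<k}" unfolding p_def by (subst bij_betw_cong) auto
  then have "p permutes {..<k}" by (rule bij_imp_permutes) (auto simp: p_def)
  moreover have "f a = pick ?I (p a)" if "a < k" for a
    using that f_inv_into_f[of "f a" "pick ?I" "{..<k}"] pick_k_subset(3)[OF I] by (auto simp: p_def)
  ultimately show ?thesis using that I by blast
qed

text \<open>
  A minor that is not zero has distinct rows and distinct columns, and sorting these changes it by a
  sign only. This is why the two families of minors generate the same ideals.
\<close>

lemma minor_sorted:
  assumes f: "\<And>a. a < k \<Longrightarrow> f a < m" and g: "\<And>a. a < k \<Longrightarrow> g a < n" and nz: "minor k A f g \<noteq> 0"
  shows "inj_on f {..<k}" "inj_on g {..<k}" "f ` {..<k} \<in> k_subsets k m" "g ` {..<k} \<in> k_subsets k n"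
    "\<exists>s. (s = 1 \<or> s = -1) \<and> minor k A f g = s * minor k A (pick (f ` {..<k})) (pick (g ` {..<k}))"
proof -
  show injf: "inj_on f {..<k}" and injg: "inj_on g {..<k}"
    using nz minor_eq_rows[of _ k _ f A g] minor_eq_cols[of _ k _ g A f] by (force simp: inj_on_def)+
  obtain p where p: "f ` {..<k} \<in> k_subsets k m" "p permutes {..<k}"
    "\<And>a. a < k \<Longrightarrow> f a = pick (f ` {..<k}) (p a)"
    using inj_eq_pick_permutation[OF injf f] by blast
  obtain q where q: "g ` {..<k} \<in> k_subsets k n" "q permutes {..<k}"
    "\<And>a. a < k \<Longrightarrow> g a = pick (g ` {..<k}) (q a)"
    using inj_eq_pick_permutation[OF injg g] by blast
  show "f ` {..<k} \<in> k_subsets k m" "g ` {..<k} \<in> k_subsets k n" by fact+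
  have "minor k A f g = minor k A (\<lambda>a. pick (f ` {..<k}) (p a)) (\<lambda>a. pick (g ` {..<k}) (q a))"
    by (rule minor_cong) (use p q in auto)
  also have "\<dots> = signof p * (signof q * minor k A (pick (f ` {..<k})) (pick (g ` {..<k})))"
    by (simp add: minor_permute_rows[OF p(2), of A "pick (f ` {..<k})"] minor_permute_cols[OF q(2), of A _ "pick (g ` {..<k})"])
  finally have *: "minor k A f g = (signof p * signof q) * minor k A (pick (f ` {..<k})) (pick (g ` {..<k}))"
    by (simp add: mult.assoc)
  show "\<exists>s. (s = 1 \<or> s = -1) \<and> minor k A f g = s * minor k A (pick (f ` {..<k})) (pick (g ` {..<k}))"
    by (rule exI, rule conjI[OF _ *]) (auto simp: sign_def)
qed

lemma det_submatrix_eq_minor: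
  assumes "A \<in> carrier_mat m n" "I \<in> k_subsets k m" "J \<in> k_subsets k n"
  shows "det (submatrix A I J) = minor k A (pick I) (pick J)"
proof -
  have "{i. i < dim_row A \<and> i \<in> I} = I" "{j. j < dim_col A \<and> j \<in> J} = J" "card I = k" "card J = k"
    using assms by (auto simp: k_subsets_def)
  then show ?thesis by (simp add: submatrix_def minor_def)
qed

lemma det_ideal_pick:
  assumes "A \<in> carrier_mat m n"
  shows "det_ideal k A = Idl\<^bsub>class_ring\<^esub> {minor k A (pick I) (pick J) | I J. I \<in> k_subsets k m \<and> J \<in> k_subsets k n}"
proof -
  have "{det (submatrix A I J) | I J. I \<subseteq> {..<dim_row A} \<and> J \<subseteq> {..<dim_col A} \<and> card I = k \<and> card J = k}
     = {minor k A (pick I) (pick J) | I J. I \<in> k_subsets k m \<and> J \<in> k_subsets k n}"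
    using assms det_submatrix_eq_minor[OF assms, of _ k] by (auto simp: k_subsets_def) metis+
  then show ?thesis unfolding det_ideal_def by simp
qed

lemma ideal_det_ideal: "ideal (det_ideal k A) class_ring"
  unfolding det_ideal_def by (rule ideal_genideal)

lemma minor_in_det_ideal:
  assumes A: "A \<in> carrier_mat m n" and f: "\<And>a. a < k \<Longrightarrow> f a < m" and g: "\<And>a. a < k \<Longrightarrow> g a < n"
  shows "minor k A f g \<in> det_ideal k A"
proof (cases "minor k A f g = 0")
  case True
  then show ?thesis using ideal_class_ringD(1)[OF ideal_det_ideal[of k A]] by simp
next
  case False
  note S = minor_sorted[OF f g False]
  obtain s where "minor k A f g = s * minor k A (pick (f ` {..<k})) (pick (g ` {..<k}))" using S(5) by blast
  moreover have "minor k A (pick (f ` {..<k})) (pick (g ` {..<k})) \<in> det_ideal k A"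
    unfolding det_ideal_pick[OF A] using S(3,4) by (intro subsetD[OF genideal_superset]) blast
  ultimately show ?thesis
    using ideal_class_ringD(3)[OF ideal_det_ideal[of k A]] by simp
qed

lemma det_ideal_subset:
  assumes A: "A \<in> carrier_mat m n" and J: "ideal J class_ring"
    and "\<And>f g. (\<And>a. a < k \<Longrightarrow> f a < m) \<Longrightarrow> (\<And>a. a < k \<Longrightarrow> g a < n) \<Longrightarrow> minor k A f g \<in> J"
  shows "det_ideal k A \<subseteq> J"
  unfolding det_ideal_pick[OF A] using assms(3) pick_k_subset(5) by (intro Idl_mono_ideal J) blast

lemma ideal_sum:
  fixes J :: "'a::comm_ring_1 set"
  assumes "ideal J class_ring" "\<And>x. x \<in> X \<Longrightarrow> f x \<in> J"
  shows "sum f X \<in> J"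
  using assms(2) by (induction X rule: infinite_finite_induct) (auto intro: ideal_class_ringD[OF assms(1)])

lemma ideal_eq_UNIV_iff:
  fixes J :: "'a::comm_ring_1 set"
  assumes "ideal J class_ring"
  shows "J = UNIV \<longleftrightarrow> 1 \<in> J"
  using ideal_class_ringD(3)[OF assms, of 1] by auto

text \<open>
  All selection functions are admitted, so that the property applies to the selections that arise
  from row replacements.
\<close>

definition minors_vanish :: "nat \<Rightarrow> 'a::comm_ring_1 mat \<Rightarrow> bool" where
  "minors_vanish k A \<longleftrightarrow> (\<forall>f g. (\<forall>a<k. f a < dim_row A) \<longrightarrow> (\<forall>a<k. g a < dim_col A) \<longrightarrow> minor k A f g = 0)"

lemma ideal_zero: "ideal {0::'a::comm_ring_1} class_ring"
  by (rule ideal_class_ringI) auto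

lemma det_ideal_zero_iff: "det_ideal k A = {0} \<longleftrightarrow> minors_vanish k A"
proof
  assume "det_ideal k A = {0}"
  then show "minors_vanish k A"
    unfolding minors_vanish_def using minor_in_det_ideal[of A "dim_row A" "dim_col A" k] by auto
next
  assume "minors_vanish k A"
  then have "det_ideal k A \<subseteq> {0}"
    unfolding minors_vanish_def
      by (intro det_ideal_subset[OF _ ideal_zero, of A "dim_row A" "dim_col A"]) auto
  then show "det_ideal k A = {0}" using ideal_class_ringD(1)[OF ideal_det_ideal] by blast
qed

lemma minors_vanishD:
  assumes "minors_vanish k A" "A \<in> carrier_mat m n" "\<And>a. a < k \<Longrightarrow> f a < m" "\<And>a. a < k \<Longrightarrow> g a < n"
  shows "minor k A f g = 0"
  using assms unfolding minors_vanish_def by auto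

lemma minors_vanish_large:
  assumes "A \<in> carrier_mat m n" "k > m"
  shows "minors_vanish k A"
  unfolding minors_vanish_def
proof (intro allI impI, rule ccontr)
  fix f g assume *: "\<forall>a<k. f a < dim_row A" "\<forall>a<k. g a < dim_col A" "minor k A f g \<noteq> 0"
  then have "f ` {..<k} \<in> k_subsets k m" using minor_sorted(3)[of k f m g n A] assms by auto
  then have "k \<le> card {..<m}" unfolding k_subsets_def
    by (metis (mono_tags, lifting) card_mono finite_lessThan mem_Collect_eq)
  then show False using assms by simp
qed

lemma minor_Suc_row_expand:
  assumes "A \<in> carrier_mat m n" "\<And>b. b < Suc k \<Longrightarrow> f b < m" "\<And>b. b < Suc k \<Longrightarrow> g b < n" "a < Suc k"
  obtains c where "minor (Suc k) A f g = (\<Sum>b<Suc k. A $$ (f a, g b) * c b)" "\<And>b. b < Suc k \<Longrightarrow> c b \<in> det_ideal k A"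
proof -
  let ?M = "mat (Suc k) (Suc k) (\<lambda>(a, b). A $$ (f a, g b))"
  have "minor (Suc k) A f g = (\<Sum>b<Suc k. A $$ (f a, g b) * cofactor ?M a b)"
    using minor_row_expand[OF assms(4), of A f "f a" g] by simp
  moreover have "cofactor ?M a b \<in> det_ideal k A" if "b < Suc k" for b
  proof -
    have "mat_delete ?M a b = mat k k (\<lambda>(i, j). A $$ (f (if i < a then i else Suc i), g (if j < b then j else Suc j)))"
      unfolding mat_delete_def by (intro eq_matI) auto
    then have "det (mat_delete ?M a b) = minor k A (\<lambda>i. f (if i < a then i else Suc i)) (\<lambda>j. g (if j < b then j else Suc j))"
      by (simp add: minor_def)
    also have "\<dots> \<in> det_ideal k A" by (rule minor_in_det_ideal[OF assms(1)]) (use assms in auto)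
    finally show ?thesis unfolding cofactor_def by (rule ideal_class_ringD(3)[OF ideal_det_ideal])
  qed
  ultimately show ?thesis using that by blast
qed

lemma det_ideal_Suc_subset:
  "det_ideal (Suc k) A \<subseteq> det_ideal k A"
proof (rule det_ideal_subset[of _ "dim_row A" "dim_col A"])
  fix f g assume fg: "\<And>a. a < Suc k \<Longrightarrow> f a < dim_row A" "\<And>a. a < Suc k \<Longrightarrow> g a < dim_col A"
  obtain c where c: "minor (Suc k) A f g = (\<Sum>b<Suc k. A $$ (f 0, g b) * c b)" "\<And>b. b < Suc k \<Longrightarrow> c b \<in> det_ideal k A"
    using minor_Suc_row_expand[of A "dim_row A" "dim_col A" k f g 0] fg by blast
  show "minor (Suc k) A f g \<in> det_ideal k A"
    unfolding c(1) using c(2)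
      by (intro ideal_sum[OF ideal_det_ideal] ideal_class_ringD(3)[OF ideal_det_ideal]) auto
qed (auto intro: ideal_det_ideal)

lemma det_ideal_antimono:
  assumes "j \<le> k"
  shows "det_ideal k A \<subseteq> det_ideal j A"
  using assms by (induction rule: dec_induct) (use det_ideal_Suc_subset in blast)+

lemma minors_vanish_mono:
  assumes "minors_vanish j A" "j \<le> k"
  shows "minors_vanish k A"
proof -
  have "det_ideal k A \<subseteq> {0}" using assms det_ideal_antimono[of j k A]
    by (simp add: det_ideal_zero_iff[symmetric])
  then show ?thesis
    using ideal_class_ringD(1)[OF ideal_det_ideal, of k A] by (auto simp: det_ideal_zero_iff[symmetric])
qed

section \<open>The Cauchy--Binet formula\<close>

text \<open>
  Multilinearity in the rows, before terms with the same column set are collected.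
\<close>

lemma minor_mult_functions:
  assumes X: "X \<in> carrier_mat m n" and Y: "Y \<in> carrier_mat n q"
    and f: "\<And>a. a < k \<Longrightarrow> f a < m" and g: "\<And>a. a < k \<Longrightarrow> g a < q"
  shows "minor k (X * Y) f g = (\<Sum>h\<in>{..<k} \<rightarrow>\<^sub>E {..<n}. (\<Prod>a<k. X $$ (f a, h a)) * minor k Y h g)"
proof -
  have "minor k (X * Y) f g = (\<Sum>p | p permutes {..<k}. signof p * (\<Prod>a<k. \<Sum>l<n. X $$ (f a, l) * Y $$ (l, g (p a))))"
    unfolding minor_leibniz
  proof (intro sum.cong refl arg_cong2[of _ _ _ _ "(*)"] prod.cong)
    fix p a assume "p \<in> {p. p permutes {..<k}}" "a \<in> {..<k}"
    then have "f a < m" "g (p a) < q" using f g permutes_in_image[of p "{..<k}" a] by auto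
    then show "(X * Y) $$ (f a, g (p a)) = (\<Sum>l<n. X $$ (f a, l) * Y $$ (l, g (p a)))"
      using X Y by (simp add: scalar_prod_def atLeast0LessThan)
  qed
  also have "\<dots> = (\<Sum>p | p permutes {..<k}. \<Sum>h\<in>{..<k} \<rightarrow>\<^sub>E {..<n}. (\<Prod>a<k. X $$ (f a, h a)) * (signof p * (\<Prod>a<k. Y $$ (h a, g (p a)))))"
    by (simp add: prod_sum_PiE prod.distrib sum_distrib_left mult_ac)
  also have "\<dots> = (\<Sum>h\<in>{..<k} \<rightarrow>\<^sub>E {..<n}. (\<Prod>a<k. X $$ (f a, h a)) * minor k Y h g)"
    by (subst sum.swap) (simp add: minor_leibniz sum_distrib_left)
  finally show ?thesis .
qed

text \<open>
  An injective selection is the same as its image together with a permutation. This collects the terms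
  of \<open>minor_mult_functions\<close> that belong to one column set into a single product of minors.
\<close>

lemma bij_betw_sorted_functions:
  "bij_betw (\<lambda>(J, p). restrict (\<lambda>a. pick J (p a)) {..<k}) (k_subsets k n \<times> {p. p permutes {..<k}})
     {h \<in> {..<k} \<rightarrow>\<^sub>E {..<n}. inj_on h {..<k}}"
  unfolding bij_betw_def
proof (intro conjI)
  let ?F = "\<lambda>(J, p). restrict (\<lambda>a. pick J (p a)) {..<k}"
  have im: "?F (J, p) ` {..<k} = J" if "J \<in> k_subsets k n" "p permutes {..<k}" for J p
  proof -
    have "?F (J, p) ` {..<k} = pick J ` (p ` {..<k})" by (auto simp: image_image)
    then show ?thesis using permutes_image[OF that(2)] pick_k_subset(3)[OF that(1)] by simp
  qed
  show "inj_on ?F (k_subsets k n \<times> {p. p permutes {..<k}})"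
  proof (rule inj_onI, clarify)
    fix J p J' p' assume J: "J \<in> k_subsets k n" "J' \<in> k_subsets k n" and p: "p permutes {..<k}" "p' permutes {..<k}"
      and eq: "restrict (\<lambda>a. pick J (p a)) {..<k} = restrict (\<lambda>a. pick J' (p' a)) {..<k}"
    have JJ: "J = J'" using im[OF J(1) p(1)] im[OF J(2) p(2)] eq by simp
    have "p a = p' a" for a
    proof (cases "a < k")
      case True
      then have "pick J (p a) = pick J (p' a)" using fun_cong[OF eq, of a] JJ by simp
      moreover have "p a \<in> {..<k}" "p' a \<in> {..<k}" using True permutes_in_image p
        by (metis lessThan_iff)+
      ultimately show ?thesis using pick_k_subset(2)[OF J(1)] by (meson inj_onD)
    next
      case False
      then show ?thesis using p by (auto simp: permutes_def)
    qed
    then show "J = J' \<and> p = p'" using JJ by auto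
  qed
  show "?F ` (k_subsets k n \<times> {p. p permutes {..<k}}) = {h \<in> {..<k} \<rightarrow>\<^sub>E {..<n}. inj_on h {..<k}}"
  proof (intro subset_antisym subsetI)
    fix h assume "h \<in> ?F ` (k_subsets k n \<times> {p. p permutes {..<k}})"
    then obtain J p where h: "h = restrict (\<lambda>a. pick J (p a)) {..<k}" "J \<in> k_subsets k n" "p permutes {..<k}" by auto
    have "p a < k" if "a < k" for a using that permutes_in_image[OF h(3), of a] by simp
    then have "h \<in> {..<k} \<rightarrow>\<^sub>E {..<n}" using h pick_k_subset(5)[OF h(2)] by auto
    moreover have "card (h ` {..<k}) = card {..<k}" using im[OF h(2,3)] h(1,2) by (simp add: k_subsets_def)
    then have "inj_on h {..<k}" by (rule eq_card_imp_inj_on[rotated]) simp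
    ultimately show "h \<in> {h \<in> {..<k} \<rightarrow>\<^sub>E {..<n}. inj_on h {..<k}}" by simp
  next
    fix h assume "h \<in> {h \<in> {..<k} \<rightarrow>\<^sub>E {..<n}. inj_on h {..<k}}"
    then have h: "h \<in> {..<k} \<rightarrow>\<^sub>E {..<n}" "inj_on h {..<k}" by auto
    obtain p where p: "h ` {..<k} \<in> k_subsets k n" "p permutes {..<k}" "\<And>a. a < k \<Longrightarrow> h a = pick (h ` {..<k}) (p a)"
      using inj_eq_pick_permutation[OF h(2), of n] h(1) by (metis PiE_mem lessThan_iff)
    have "h = ?F (h ` {..<k}, p)"
      using p(3) PiE_arb[OF h(1)] by (intro ext) (simp add: restrict_def)
    then show "h \<in> ?F ` (k_subsets k n \<times> {p. p permutes {..<k}})" using p by blast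
  qed
qed

theorem minor_mult:
  assumes X: "X \<in> carrier_mat m n" and Y: "Y \<in> carrier_mat n q"
    and f: "\<And>a. a < k \<Longrightarrow> f a < m" and g: "\<And>a. a < k \<Longrightarrow> g a < q"
  shows "minor k (X * Y) f g = (\<Sum>J\<in>k_subsets k n. minor k X f (pick J) * minor k Y (pick J) g)"
proof -
  let ?t = "\<lambda>h. (\<Prod>a<k. X $$ (f a, h a)) * minor k Y h g"
  have "minor k (X * Y) f g = (\<Sum>h\<in>{..<k} \<rightarrow>\<^sub>E {..<n}. ?t h)"
    by (rule minor_mult_functions[OF X Y f g])
  also have "\<dots> = (\<Sum>h\<in>{h \<in> {..<k} \<rightarrow>\<^sub>E {..<n}. inj_on h {..<k}}. ?t h)"
  proof (rule sum.mono_neutral_right)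
    show "\<forall>h\<in>({..<k} \<rightarrow>\<^sub>E {..<n}) - {h \<in> {..<k} \<rightarrow>\<^sub>E {..<n}. inj_on h {..<k}}. ?t h = 0"
      using minor_eq_rows[of _ k _ _ Y g] by (fastforce simp: inj_on_def)
  qed (auto intro!: finite_PiE)
  also have "\<dots> = (\<Sum>Jp\<in>k_subsets k n \<times> {p. p permutes {..<k}}. ?t (case Jp of (J, p) \<Rightarrow> restrict (\<lambda>a. pick J (p a)) {..<k}))"
    by (rule sum.reindex_bij_betw[OF bij_betw_sorted_functions, symmetric])
  also have "\<dots> = (\<Sum>J\<in>k_subsets k n. \<Sum>p | p permutes {..<k}. ?t (restrict (\<lambda>a. pick J (p a)) {..<k}))"
    unfolding sum.cartesian_product by (intro sum.cong refl) (simp add: case_prod_beta)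
  also have "\<dots> = (\<Sum>J\<in>k_subsets k n. \<Sum>p | p permutes {..<k}. signof p * (\<Prod>a<k. X $$ (f a, pick J (p a))) * minor k Y (pick J) g)"
  proof (intro sum.cong refl)
    fix J p assume "p \<in> {p. p permutes {..<k}}"
    then have "minor k Y (restrict (\<lambda>a. pick J (p a)) {..<k}) g = signof p * minor k Y (pick J) g"
      by (subst minor_permute_rows[symmetric]) (auto intro: minor_cong)
    then show "?t (restrict (\<lambda>a. pick J (p a)) {..<k}) = signof p * (\<Prod>a<k. X $$ (f a, pick J (p a))) * minor k Y (pick J) g"
      by (simp add: mult_ac)
  qed
  also have "\<dots> = (\<Sum>J\<in>k_subsets k n. minor k X f (pick J) * minor k Y (pick J) g)"
    by (simp add: minor_leibniz[of _ X] sum_distrib_right)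
  finally show ?thesis .
qed

lemma det_ideal_mult_left:
  assumes X: "X \<in> carrier_mat m n" and Y: "Y \<in> carrier_mat n q"
  shows "det_ideal k (X * Y) \<subseteq> det_ideal k Y"
proof (rule det_ideal_subset[of _ m q])
  fix f g assume fg: "\<And>a. a < k \<Longrightarrow> f a < m" "\<And>a. a < k \<Longrightarrow> g a < q"
  show "minor k (X * Y) f g \<in> det_ideal k Y"
    by (subst minor_mult[OF X Y fg])
      (auto intro!: ideal_sum[OF ideal_det_ideal] ideal_class_ringD(3)[OF ideal_det_ideal] minor_in_det_ideal[OF Y] fg pick_k_subset(5))
qed (use X Y ideal_det_ideal in auto)

lemma det_ideal_mult_right:
  assumes X: "X \<in> carrier_mat m n" and Y: "Y \<in> carrier_mat n q"
  shows "det_ideal k (X * Y) \<subseteq> det_ideal k X"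
proof (rule det_ideal_subset[of _ m q])
  fix f g assume fg: "\<And>a. a < k \<Longrightarrow> f a < m" "\<And>a. a < k \<Longrightarrow> g a < q"
  have "minor k X f (pick J) * minor k Y (pick J) g \<in> det_ideal k X" if "J \<in> k_subsets k n" for J
    unfolding mult.commute[of "minor k X f (pick J)"]
    by (rule ideal_class_ringD(3)[OF ideal_det_ideal], rule minor_in_det_ideal[OF X]) (use that fg pick_k_subset(5) in auto)
  then show "minor k (X * Y) f g \<in> det_ideal k X"
    by (subst minor_mult[OF X Y fg]) (auto intro!: ideal_sum[OF ideal_det_ideal])
qed (use X Y ideal_det_ideal in auto)

section \<open>Coefficients of the Gram polynomial\<close>

lemma index_mult_mat_sum:
  assumes "A \<in> carrier_mat m n" "B \<in> carrier_mat n q" "i < m" "j < q"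
  shows "(A * B) $$ (i, j) = (\<Sum>r<n. A $$ (i, r) * B $$ (r, j))"
  using assms by (simp add: scalar_prod_def atLeast0LessThan)

lemma map_permutation_apply_image:
  "inj_on f A \<Longrightarrow> x \<in> A \<Longrightarrow> map_permutation A f p (f x) = f (p x)"
  by (simp add: map_permutation_apply)

lemma bij_betw_map_permutation:
  assumes "bij_betw f A B"
  shows "bij_betw (map_permutation A f) {p. p permutes A} {p. p permutes B}"
proof -
  have "map_permutation A f = (\<lambda>\<pi> x. if x \<in> B then f (\<pi> (inv_into A f x)) else x)"
    using assms by (auto simp: map_permutation_def restrict_id_def bij_betw_def fun_eq_iff)
  then show ?thesis using bij_betw_permutations[OF assms] by simp
qed

text \<open>
  Permutations of the set \<open>S\<close> itself replace permutations of \<open>{..<k}\<close>, because it is in this form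
  that principal minors appear inside the Leibniz formula of the full determinant.
\<close>

lemma principal_minor_leibniz:
  assumes S: "S \<in> k_subsets k m"
  shows "minor k M (pick S) (pick S) = (\<Sum>p | p permutes S. signof p * (\<Prod>i\<in>S. M $$ (i, p i)))"
proof -
  note P = pick_k_subset[OF S]
  have "(\<Sum>p | p permutes S. signof p * (\<Prod>i\<in>S. M $$ (i, p i))) =
    (\<Sum>p | p permutes {..<k}. signof (map_permutation {..<k} (pick S) p) * (\<Prod>i\<in>S. M $$ (i, map_permutation {..<k} (pick S) p i)))"
    by (rule sum.reindex_bij_betw[symmetric], rule bij_betw_map_permutation[OF P(1)])
  also have "\<dots> = (\<Sum>p | p permutes {..<k}. signof p * (\<Prod>a<k. M $$ (pick S a, pick S (p a))))"
  proof (intro sum.cong refl arg_cong2[of _ _ _ _ "(*)"])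
    fix p assume p: "p \<in> {p. p permutes {..<k}}"
    then show "(signof (map_permutation {..<k} (pick S) p) :: 'a) = signof p"
      using sign_map_permutation[OF P(2), of p] by simp
    have "(\<Prod>i\<in>S. M $$ (i, map_permutation {..<k} (pick S) p i)) =
      (\<Prod>a<k. M $$ (pick S a, map_permutation {..<k} (pick S) p (pick S a)))"
      by (rule prod.reindex_bij_betw[OF P(1), symmetric])
    also have "\<dots> = (\<Prod>a<k. M $$ (pick S a, pick S (p a)))"
      using map_permutation_apply_image[OF P(2)] by (intro prod.cong) auto
    finally show "(\<Prod>i\<in>S. M $$ (i, map_permutation {..<k} (pick S) p i)) = (\<Prod>a<k. M $$ (pick S a, pick S (p a)))" .
  qed
  finally show ?thesis by (simp add: minor_leibniz)
qed

text \<open>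
  In the Leibniz expansion each factor is either taken from \<open>Z M\<close> or from the identity; let \<open>S\<close> be
  the set of rows of the first kind. The permutations that contribute fix all other rows, so that they
  are the permutations of \<open>S\<close>.
\<close>

lemma det_one_plus_var:
  fixes M :: "'a::comm_ring_1 mat"
  assumes M: "M \<in> carrier_mat m m"
  shows "det (1\<^sub>m m + [:0, 1:] \<cdot>\<^sub>m map_mat (\<lambda>c. [:c:]) M) =
    (\<Sum>S\<in>Pow {..<m}. monom (minor (card S) M (pick S) (pick S)) (card S))"
proof -
  have sub: "(\<Sum>p | p permutes {..<m}. signof p * ((\<Prod>i\<in>S. M $$ (i, p i)) * (\<Prod>i\<in>{..<m} - S. if i = p i then 1 else 0)))
      = minor (card S) M (pick S) (pick S)" if S: "S \<in> Pow {..<m}" for S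
  proof -
    have "(\<Sum>p | p permutes {..<m}. signof p * ((\<Prod>i\<in>S. M $$ (i, p i)) * (\<Prod>i\<in>{..<m} - S. if i = p i then 1 else 0)))
       = (\<Sum>p | p permutes S. signof p * ((\<Prod>i\<in>S. M $$ (i, p i)) * (\<Prod>i\<in>{..<m} - S. if i = p i then 1 else 0)))"
    proof (rule sum.mono_neutral_right)
      show "{p. p permutes S} \<subseteq> {p. p permutes {..<m}}" using S permutes_subset by auto
      show "\<forall>p\<in>{p. p permutes {..<m}} - {p. p permutes S}.
        signof p * ((\<Prod>i\<in>S. M $$ (i, p i)) * (\<Prod>i\<in>{..<m} - S. if i = p i then 1 else 0)) = 0"
      proof
        fix p assume p: "p \<in> {p. p permutes {..<m}} - {p. p permutes S}"
        then obtain i where "i \<notin> S" "p i \<noteq> i" using permutes_superset[of p "{..<m}" S] by auto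
        moreover then have "i \<in> {..<m}" using p by (auto simp: permutes_def)
        ultimately have "(\<Prod>i\<in>{..<m} - S. if i = p i then 1 else (0::'a)) = 0"
          by (intro prod_zero bexI[of _ i]) auto
        then show "signof p * ((\<Prod>i\<in>S. M $$ (i, p i)) * (\<Prod>i\<in>{..<m} - S. if i = p i then 1 else 0)) = 0" by simp
      qed
    qed (auto intro: finite_permutations)
    also have "\<dots> = (\<Sum>p | p permutes S. signof p * (\<Prod>i\<in>S. M $$ (i, p i)))"
    proof (intro sum.cong refl)
      fix p assume p: "p \<in> {p. p permutes S}"
      have "(\<Prod>i\<in>{..<m} - S. if i = p i then 1 else (0::'a)) = 1" using p
        by (intro prod.neutral) (auto simp: permutes_def)
      then show "signof p * ((\<Prod>i\<in>S. M $$ (i, p i)) * (\<Prod>i\<in>{..<m} - S. if i = p i then 1 else 0)) =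
         signof p * (\<Prod>i\<in>S. M $$ (i, p i))" by simp
    qed
    also have "\<dots> = minor (card S) M (pick S) (pick S)"
      using S by (intro principal_minor_leibniz[symmetric, of S _ m]) (auto simp: k_subsets_def)
    finally show ?thesis .
  qed
  have "det (1\<^sub>m m + [:0, 1:] \<cdot>\<^sub>m map_mat (\<lambda>c. [:c:]) M) =
    (\<Sum>p | p permutes {..<m}. signof p * (\<Prod>i<m. monom (M $$ (i, p i)) 1 + [:if i = p i then 1 else 0:]))"
  proof (subst det_def'[of _ m])
    show "1\<^sub>m m + [:0, 1:] \<cdot>\<^sub>m map_mat (\<lambda>c. [:c:]) M \<in> carrier_mat m m"
      using M by simp
    show "(\<Sum>p | p permutes {0..<m}. signof p * (\<Prod>i = 0..<m. (1\<^sub>m m + [:0, 1:] \<cdot>\<^sub>m map_mat (\<lambda>c. [:c:]) M) $$ (i, p i))) =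
      (\<Sum>p | p permutes {..<m}. signof p * (\<Prod>i<m. monom (M $$ (i, p i)) 1 + [:if i = p i then 1 else 0:]))"
      unfolding atLeast0LessThan
    proof (intro sum.cong refl arg_cong2[of _ _ _ _ "(*)"] prod.cong)
      fix p i assume "p \<in> {p. p permutes {..<m}}" "i \<in> {..<m}"
      then have "i < m" "p i < m" using permutes_in_image[of p "{..<m}" i] by auto
      then show "(1\<^sub>m m + [:0, 1:] \<cdot>\<^sub>m map_mat (\<lambda>c. [:c:]) M) $$ (i, p i) = monom (M $$ (i, p i)) 1 + [:if i = p i then 1 else 0:]"
        using M by (auto simp: monom_altdef one_pCons)
    qed
  qed
  also have "\<dots> = (\<Sum>p | p permutes {..<m}. signof p * (\<Sum>S\<in>Pow {..<m}.
      monom ((\<Prod>i\<in>S. M $$ (i, p i)) * (\<Prod>i\<in>{..<m} - S. if i = p i then 1 else 0)) (card S)))"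
  proof (intro sum.cong refl arg_cong2[of _ _ _ _ "(*)"])
    fix p
    have *: "(\<Prod>i\<in>S. monom (f i) 1) = monom (\<Prod>i\<in>S. f i) (card S)"
      if "finite S" for S :: "nat set" and f :: "nat \<Rightarrow> 'a"
      using that by (induction S rule: finite_induct) (auto simp: mult_monom)
    have **: "(\<Prod>i\<in>S. [:f i:]) = [:\<Prod>i\<in>S. f i:]"
      if "finite S" for S :: "nat set" and f :: "nat \<Rightarrow> 'a"
      using that by (induction S rule: finite_induct) (auto simp: one_pCons)
    show "(\<Prod>i<m. monom (M $$ (i, p i)) 1 + [:if i = p i then 1 else 0:]) =
      (\<Sum>S\<in>Pow {..<m}. monom ((\<Prod>i\<in>S. M $$ (i, p i)) * (\<Prod>i\<in>{..<m} - S. if i = p i then 1 else 0)) (card S))"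
      unfolding prod_add[OF finite_lessThan]
    proof (intro sum.cong refl)
      fix S assume "S \<in> Pow {..<m}"
      then have "finite S" using finite_subset by auto
      then show "(\<Prod>i\<in>S. monom (M $$ (i, p i)) 1) * (\<Prod>i\<in>{..<m} - S. [:if i = p i then 1 else 0:]) =
        monom ((\<Prod>i\<in>S. M $$ (i, p i)) * (\<Prod>i\<in>{..<m} - S. if i = p i then 1 else 0)) (card S)"
        unfolding *[OF \<open>finite S\<close>] **[OF finite_Diff[OF finite_lessThan]]
        by (simp add: smult_monom mult.commute)
    qed
  qed
  also have "\<dots> = (\<Sum>S\<in>Pow {..<m}. \<Sum>p | p permutes {..<m}. monom (signof p *
      ((\<Prod>i\<in>S. M $$ (i, p i)) * (\<Prod>i\<in>{..<m} - S. if i = p i then 1 else 0))) (card S))"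
    by (subst sum.swap, simp only: sum_distrib_left) (auto simp: sign_def minus_monom intro!: sum.cong)
  also have "\<dots> = (\<Sum>S\<in>Pow {..<m}. monom (minor (card S) M (pick S) (pick S)) (card S))"
    by (intro sum.cong refl) (simp only: monom_sum[symmetric] sub)
  finally show ?thesis .
qed

text \<open>
  Principal minors of \<open>A B\<close>, expanded by Cauchy--Binet. The formula is symmetric in \<open>A\<close> and \<open>B\<close>,
  and for the matrix \<open>A\<degree>\<close> it becomes a weighted sum of squares.
\<close>

theorem gram_coeff_minors:
  assumes A: "A \<in> carrier_mat m n" and B: "B \<in> carrier_mat n m"
  shows "gram_coeff A B l =
    (\<Sum>I\<in>k_subsets l m. \<Sum>J\<in>k_subsets l n. minor l A (pick I) (pick J) * minor l B (pick J) (pick I))"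
proof -
  have "gram_coeff A B l = (\<Sum>S\<in>Pow {..<m}. if card S = l then minor (card S) (A * B) (pick S) (pick S) else 0)"
    unfolding gram_coeff_def gram_poly_def carrier_matD(1)[OF A] det_one_plus_var[OF mult_carrier_mat[OF A B]]
    by (auto simp: coeff_sum intro!: sum.cong)
  also have "\<dots> = (\<Sum>S\<in>k_subsets l m. minor l (A * B) (pick S) (pick S))"
    by (rule sum.mono_neutral_cong_right) (auto simp: k_subsets_def)
  also have "\<dots> = (\<Sum>I\<in>k_subsets l m. \<Sum>J\<in>k_subsets l n. minor l A (pick I) (pick J) * minor l B (pick J) (pick I))"
    by (intro sum.cong refl minor_mult[OF A B]) (auto simp: pick_k_subset(5))
  finally show ?thesis .
qed

lemma gram_coeff_commute:
  assumes A: "A \<in> carrier_mat m n" and B: "B \<in> carrier_mat n m"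
  shows "gram_coeff A B l = gram_coeff B A l"
  unfolding gram_coeff_minors[OF A B] gram_coeff_minors[OF B A]
  by (subst sum.swap) (simp add: mult.commute)

lemma gram_coeff_vanish:
  assumes A: "A \<in> carrier_mat m n" and B: "B \<in> carrier_mat n m"
    and "minors_vanish l A"
  shows "gram_coeff A B l = 0"
  unfolding gram_coeff_minors[OF A B]
  using minors_vanishD[OF assms(3) A] pick_k_subset(5) by (auto intro!: sum.neutral)

lemma degree_gram_poly_le_iff:
  "degree (gram_poly A B) \<le> k \<longleftrightarrow> (\<forall>l>k. gram_coeff A B l = 0)"
  unfolding gram_coeff_def using coeff_eq_0 degree_le by (metis le_less_trans)

section \<open>The adjoint identity\<close>

lemma Adj_cross_carrier:
  "A \<in> carrier_mat m n \<Longrightarrow> Adj_cross k A B \<in> carrier_mat n m"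
  unfolding Adj_cross_def by auto

lemma Adj_cross_0:
  "A \<in> carrier_mat m n \<Longrightarrow> Adj_cross 0 A B = 0\<^sub>m n m"
  unfolding Adj_cross_def by auto

lemma pow_mat_Suc_left: "M \<in> carrier_mat n n \<Longrightarrow> M ^\<^sub>m Suc l = M * M ^\<^sub>m l"
proof (induction l)
  case (Suc l)
  have "M ^\<^sub>m Suc (Suc l) = (M * M ^\<^sub>m l) * M" using Suc by simp
  also have "\<dots> = M * (M ^\<^sub>m l * M)" using Suc.prems by (intro assoc_mult_mat) auto
  finally show ?case by simp
qed simp

text \<open>
  The coefficients of \<open>adj (I + Z A B) A\<close> satisfy a parallel recursion; all algebraic properties of
  the adjoint are proved by induction from this one.
\<close>

lemma Adj_cross_Suc:
  assumes A: "A \<in> carrier_mat m n" and B: "B \<in> carrier_mat n m"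
  shows "Adj_cross (Suc k) A B = gram_coeff A B k \<cdot>\<^sub>m B - (B * A) * Adj_cross k A B"
proof (rule eq_matI)
  let ?M = "B * A" and ?g = "gram_coeff A B"
  have M: "?M \<in> carrier_mat n n" using A B by simp
  have Mp: "?M ^\<^sub>m l * B \<in> carrier_mat n m" for l using pow_carrier_mat[OF M] B
    by (rule mult_carrier_mat)
  fix i j assume "i < dim_row (?g k \<cdot>\<^sub>m B - ?M * Adj_cross k A B)" "j < dim_col (?g k \<cdot>\<^sub>m B - ?M * Adj_cross k A B)"
  then have ij: "i < n" "j < m" using A B Adj_cross_carrier[OF A, of k B] by auto
  have step: "(?M ^\<^sub>m Suc l * B) $$ (i, j) = (\<Sum>r<n. ?M $$ (i, r) * (?M ^\<^sub>m l * B) $$ (r, j))" for l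
  proof -
    have "?M ^\<^sub>m Suc l * B = ?M * (?M ^\<^sub>m l * B)"
      unfolding pow_mat_Suc_left[OF M] by (rule assoc_mult_mat[OF M pow_carrier_mat[OF M] B])
    also have "\<dots> $$ (i, j) = (\<Sum>r<n. ?M $$ (i, r) * (?M ^\<^sub>m l * B) $$ (r, j))"
      by (rule index_mult_mat_sum[OF M Mp ij])
    finally show ?thesis .
  qed
  have "Adj_cross (Suc k) A B $$ (i, j) = (\<Sum>l<Suc k. (-1) ^ l * ?g (k - l) * (?M ^\<^sub>m l * B) $$ (i, j))"
    using A B ij unfolding Adj_cross_def by simp
  also have "\<dots> = ?g k * B $$ (i, j) + (\<Sum>l<k. (-1) ^ Suc l * ?g (k - Suc l) * (?M ^\<^sub>m Suc l * B) $$ (i, j))"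
    using A B by (subst sum.lessThan_Suc_shift) simp
  also have "(\<Sum>l<k. (-1) ^ Suc l * ?g (k - Suc l) * (?M ^\<^sub>m Suc l * B) $$ (i, j)) =
     - (\<Sum>l<k. \<Sum>r<n. ?M $$ (i, r) * ((-1) ^ l * ?g (k - 1 - l) * (?M ^\<^sub>m l * B) $$ (r, j)))"
    unfolding step by (simp add: sum_negf sum_distrib_left mult_ac)
  also have "(\<Sum>l<k. \<Sum>r<n. ?M $$ (i, r) * ((-1) ^ l * ?g (k - 1 - l) * (?M ^\<^sub>m l * B) $$ (r, j))) =
     (\<Sum>r<n. ?M $$ (i, r) * Adj_cross k A B $$ (r, j))"
    by (subst sum.swap) (use A B ij in \<open>simp add: Adj_cross_def sum_distrib_left\<close>)
  also have "\<dots> = (?M * Adj_cross k A B) $$ (i, j)"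
    by (rule index_mult_mat_sum[OF M Adj_cross_carrier[OF A] ij, symmetric])
  also have "?g k * B $$ (i, j) + - (?M * Adj_cross k A B) $$ (i, j) = (?g k \<cdot>\<^sub>m B - ?M * Adj_cross k A B) $$ (i, j)"
    using M Adj_cross_carrier[OF A, of k B] B A ij by (simp del: index_mult_mat(1))
  finally show "Adj_cross (Suc k) A B $$ (i, j) = (?g k \<cdot>\<^sub>m B - ?M * Adj_cross k A B) $$ (i, j)" .
qed (use A B carrier_matD[OF Adj_cross_carrier[OF A, of _ B]] in auto)

text \<open>
  Let \<open>Y = adj (I + Z A B) A\<close>. Comparing coefficients in \<open>(I + Z A B) Y = det (I + Z A B) A\<close>
  gives \<open>Y\<^sub>l = g\<^sub>l A - A Adj\<^sub>l A\<close>, so the identity says that \<open>Y\<^sub>k = 0\<close>. Adding \<open>1\<close> to the entry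
  \<open>(j, i)\<close> of \<open>B\<close> adds \<open>Z\<close> times column \<open>j\<close> of \<open>A\<close> to column \<open>i\<close> of \<open>I + Z A B\<close>, and
  hence adds \<open>Z Y\<^sub>i\<^sub>j\<close> to the determinant. Both determinants have degree at most \<open>k\<close>, since their
  higher coefficients are combinations of minors of \<open>A\<close> of order greater than \<open>k\<close>.
\<close>

theorem Adj_cross_identity:
  fixes A :: "'a::comm_ring_1 mat"
  assumes A: "A \<in> carrier_mat m n" and B: "B \<in> carrier_mat n m" and van: "minors_vanish (Suc k) A"
  shows "A * Adj_cross k A B * A = gram_coeff A B k \<cdot>\<^sub>m A"
proof -
  let ?g = "gram_coeff A B" and ?X = "\<lambda>l. Adj_cross l A B"
  define N where "N = (\<lambda>B. 1\<^sub>m m + [:0, 1:] \<cdot>\<^sub>m map_mat (\<lambda>c. [:c:]) (A * B))"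
  define Y where "Y = adj_mat (N B) * map_mat (\<lambda>c. [:c:]) A"
  define M where "M = A * B"
  have M: "M \<in> carrier_mat m m" using A B by (simp add: M_def)
  have N: "N C \<in> carrier_mat m m" if "C \<in> carrier_mat n m" for C using A that by (simp add: N_def)
  have PN: "gram_poly A C = det (N C)" for C using A by (simp add: gram_poly_def N_def)
  have Ap: "map_mat (\<lambda>c. [:c:]) A \<in> carrier_mat m n" using A by simp
  have Y: "Y \<in> carrier_mat m n" unfolding Y_def by (rule mult_carrier_mat[OF adj_mat(1)[OF N[OF B]] Ap])
  have X: "?X l \<in> carrier_mat n m" for l by (rule Adj_cross_carrier[OF A])
  have Nij: "N C $$ (i, j) = [:if i = j then 1 else 0, (A * C) $$ (i, j):]"
    if "i < m" "j < m" "C \<in> carrier_mat n m" for i j C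
    using that A by (auto simp: N_def one_pCons)
  have NY: "N B * Y = gram_poly A B \<cdot>\<^sub>m map_mat (\<lambda>c. [:c:]) A"
  proof -
    have "N B * Y = (N B * adj_mat (N B)) * map_mat (\<lambda>c. [:c:]) A"
      unfolding Y_def by (rule assoc_mult_mat[OF N[OF B] adj_mat(1)[OF N[OF B]] Ap, symmetric])
    also have "\<dots> = (gram_poly A B \<cdot>\<^sub>m 1\<^sub>m m) * map_mat (\<lambda>c. [:c:]) A"
      by (simp add: adj_mat(2)[OF N[OF B]] PN)
    also have "\<dots> = gram_poly A B \<cdot>\<^sub>m map_mat (\<lambda>c. [:c:]) A"
      using Ap by (subst mult_smult_assoc_mat[of _ m m _ n]) auto
    finally show ?thesis .
  qed
  have rec: "Y $$ (i, j) + (\<Sum>r<m. [:0, M $$ (i, r):] * Y $$ (r, j)) = Polynomial.smult (A $$ (i, j)) (gram_poly A B)"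
    if ij: "i < m" "j < n" for i j
  proof -
    have "(N B * Y) $$ (i, j) = (\<Sum>r<m. [:if i = r then 1 else 0, M $$ (i, r):] * Y $$ (r, j))"
      unfolding index_mult_mat_sum[OF N[OF B] Y ij] using ij Nij[OF _ _ B] by (simp add: M_def)
    also have "\<dots> = (\<Sum>r<m. (if i = r then Y $$ (r, j) else 0) + [:0, M $$ (i, r):] * Y $$ (r, j))"
      by (intro sum.cong refl) (simp add: one_pCons algebra_simps)
    also have "\<dots> = Y $$ (i, j) + (\<Sum>r<m. [:0, M $$ (i, r):] * Y $$ (r, j))"
      using ij by (simp add: sum.distrib)
    finally show ?thesis using NY ij A by simp
  qed
  define y where "y = (\<lambda>l. mat m n (\<lambda>ij. coeff (Y $$ ij) l))"
  have y: "y l \<in> carrier_mat m n" for l by (simp add: y_def)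
  have y0: "y 0 = ?g 0 \<cdot>\<^sub>m A"
  proof (rule eq_matI)
    fix i j assume "i < dim_row (?g 0 \<cdot>\<^sub>m A)" "j < dim_col (?g 0 \<cdot>\<^sub>m A)"
    then have ij: "i < m" "j < n" using A by auto
    show "y 0 $$ (i, j) = (?g 0 \<cdot>\<^sub>m A) $$ (i, j)"
      using arg_cong[OF rec[OF ij], of "\<lambda>p. coeff p 0"] ij A
      by (simp add: y_def gram_coeff_def coeff_sum mult.commute)
  qed (use A in \<open>auto simp: y_def\<close>)
  have yS: "y (Suc l) = ?g (Suc l) \<cdot>\<^sub>m A - M * y l" for l
  proof (rule eq_matI)
    fix i j assume "i < dim_row (?g (Suc l) \<cdot>\<^sub>m A - M * y l)" "j < dim_col (?g (Suc l) \<cdot>\<^sub>m A - M * y l)"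
    then have ij: "i < m" "j < n" using A M y[of l] by auto
    have "(M * y l) $$ (i, j) = (\<Sum>r<m. M $$ (i, r) * coeff (Y $$ (r, j)) l)"
      unfolding index_mult_mat_sum[OF M y ij] using ij by (simp add: y_def)
    then show "y (Suc l) $$ (i, j) = (?g (Suc l) \<cdot>\<^sub>m A - M * y l) $$ (i, j)"
      using arg_cong[OF rec[OF ij], of "\<lambda>p. coeff p (Suc l)"] ij A M y[of l]
      by (simp add: y_def gram_coeff_def coeff_sum mult.commute eq_diff_eq del: index_mult_mat(1))
  qed (use A M y in \<open>auto simp: y_def\<close>)
  have yX: "y l = ?g l \<cdot>\<^sub>m A - A * ?X l * A" for l
  proof (induction l)
    case 0
    have "A * 0\<^sub>m n m * A = 0\<^sub>m m n" using A by simp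
    then show ?case using y0 A by (simp add: Adj_cross_0[OF A]) (intro eq_matI; simp)
  next
    case (Suc l)
    have AX: "A * ?X l \<in> carrier_mat m m" using A X by simp
    have "A * ?X (Suc l) = A * (?g l \<cdot>\<^sub>m B) - A * ((B * A) * ?X l)"
      unfolding Adj_cross_Suc[OF A B] using A B X[of l]
      by (intro mult_minus_distrib_mat[of _ m n _ m]) auto
    also have "A * ((B * A) * ?X l) = M * (A * ?X l)"
      unfolding M_def using A B X[of l]
        by (simp add: assoc_mult_mat[of _ m n _ m _ m] assoc_mult_mat[of _ n m _ n _ m])
    also have "A * (?g l \<cdot>\<^sub>m B) = ?g l \<cdot>\<^sub>m M" unfolding M_def
      by (rule mult_smult_distrib[OF A B])
    finally have "A * ?X (Suc l) * A = ?g l \<cdot>\<^sub>m M * A - M * (A * ?X l) * A"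
      using A M AX by (simp add: minus_mult_distrib_mat[of _ m m _ _ n])
    also have "\<dots> = M * (?g l \<cdot>\<^sub>m A) - M * (A * ?X l * A)"
      using A M AX by (simp add: mult_smult_distrib[of _ m m _ n] mult_smult_assoc_mat[of _ m m _ n] assoc_mult_mat[of _ m m _ m _ n])
    also have "\<dots> = M * y l"
      unfolding Suc.IH using A M AX by (intro mult_minus_distrib_mat[symmetric, of _ m m _ n]) auto
    finally show ?case unfolding yS by simp
  qed
  have "coeff (Y $$ (i, j)) k = 0" if ij: "i < m" "j < n" for i j
  proof -
    \<comment> \<open>The perturbation of \<open>B\<close> whose effect on the determinant is \<open>Z Y\<^sub>i\<^sub>j\<close>.\<close>
    define E where "E = mat n m (\<lambda>(a, b). if a = j \<and> b = i then 1 else (0::'a))"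
    have E: "E \<in> carrier_mat n m" by (simp add: E_def)
    have BE: "B + E \<in> carrier_mat n m" using B E by simp
    have AE: "(A * E) $$ (r, c) = (if c = i then A $$ (r, j) else 0)" if "r < m" "c < m" for r c
    proof -
      have "(A * E) $$ (r, c) = (\<Sum>s<n. if s = j then A $$ (r, j) * (if c = i then 1 else 0) else 0)"
        unfolding index_mult_mat_sum[OF A E that] using that by (intro sum.cong) (auto simp: E_def)
      also have "\<dots> = (if c = i then A $$ (r, j) else 0)" using ij by simp
      finally show ?thesis .
    qed
    have N': "N (B + E) $$ (r, c) = N B $$ (r, c) + (if c = i then [:0, A $$ (r, j):] else 0)"
      if "r < m" "c < m" for r c
    proof -
      have "(A * (B + E)) $$ (r, c) = M $$ (r, c) + (A * E) $$ (r, c)"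
        unfolding mult_add_distrib_mat[OF A B E] M_def using that A B E by (simp del: index_mult_mat(1))
      then show ?thesis unfolding Nij[OF that BE] Nij[OF that B] AE[OF that] by (simp add: M_def)
    qed
    have cof: "cofactor (N (B + E)) r i = cofactor (N B) r i" if "r < m" for r
      unfolding cofactor_def
    proof (intro arg_cong2[of _ _ _ _ "(*)"] refl arg_cong[of _ _ det] eq_matI)
      fix a b assume "a < dim_row (mat_delete (N B) r i)" "b < dim_col (mat_delete (N B) r i)"
      then show "mat_delete (N (B + E)) r i $$ (a, b) = mat_delete (N B) r i $$ (a, b)"
        using N[OF B] N[OF BE] N' by (auto simp: mat_delete_def)
    qed (use N[OF B] N[OF BE] in auto)
    have Yij: "Y $$ (i, j) = (\<Sum>r<m. cofactor (N B) r i * [:A $$ (r, j):])"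
      unfolding Y_def index_mult_mat_sum[OF adj_mat(1)[OF N[OF B]] Ap ij]
      using N[OF B] A ij by (simp add: adj_mat_def)
    have "gram_poly A (B + E) = (\<Sum>r<m. (N B $$ (r, i) + [:0, A $$ (r, j):]) * cofactor (N B) r i)"
      unfolding PN laplace_expansion_column[OF N[OF BE] ij(1)] using N' ij cof by (intro sum.cong) auto
    also have "\<dots> = gram_poly A B + [:0, 1:] * Y $$ (i, j)"
      unfolding PN laplace_expansion_column[OF N[OF B] ij(1)] Yij
      by (simp add: sum.distrib algebra_simps sum_distrib_left)
    finally have "gram_coeff A (B + E) (Suc k) = ?g (Suc k) + coeff (Y $$ (i, j)) k"
      by (simp add: gram_coeff_def)
    then show ?thesis using gram_coeff_vanish[OF A BE van] gram_coeff_vanish[OF A B van] by simp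
  qed
  then have "y k = 0\<^sub>m m n" by (auto simp: y_def)
  then have *: "?g k \<cdot>\<^sub>m A - A * ?X k * A = 0\<^sub>m m n" using yX by simp
  show ?thesis
  proof (rule eq_matI)
    fix i j assume "i < dim_row (?g k \<cdot>\<^sub>m A)" "j < dim_col (?g k \<cdot>\<^sub>m A)"
    then have ij: "i < m" "j < n" using A by auto
    show "(A * ?X k * A) $$ (i, j) = (?g k \<cdot>\<^sub>m A) $$ (i, j)"
      using arg_cong[OF *, of "\<lambda>M. M $$ (i, j)"] ij A by (simp del: index_mult_mat(1))
  qed (use A in auto)
qed

section \<open>Crossed maps and the generalized inverse\<close>

text \<open>
  Moving one factor from the left to the right end turns the adjoint of the pair \<open>(A, B)\<close> into that of
  \<open>(B, A)\<close>. This yields \<open>B A Adj = g\<^sub>k B\<close> from the adjoint identity for the exchanged pair.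
\<close>

lemma Adj_cross_intertwine:
  assumes A: "A \<in> carrier_mat m n" and B: "B \<in> carrier_mat n m"
  shows "A * Adj_cross k A B = Adj_cross k B A * B"
proof (induction k)
  case 0
  then show ?case using A B by (simp add: Adj_cross_0[OF A] Adj_cross_0[OF B])
next
  case (Suc k)
  note X = Adj_cross_carrier[OF A, of k B] and X' = Adj_cross_carrier[OF B, of k A]
  have "A * Adj_cross (Suc k) A B = A * (gram_coeff A B k \<cdot>\<^sub>m B) - A * ((B * A) * Adj_cross k A B)"
    unfolding Adj_cross_Suc[OF A B] using A B X by (intro mult_minus_distrib_mat[of _ m n _ m]) auto
  also have "A * ((B * A) * Adj_cross k A B) = A * B * (A * Adj_cross k A B)"
    using A B X by (simp add: assoc_mult_mat[of _ m n _ m _ m] assoc_mult_mat[of _ n m _ n _ m])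
  also have "A * (gram_coeff A B k \<cdot>\<^sub>m B) = gram_coeff B A k \<cdot>\<^sub>m A * B"
    unfolding gram_coeff_commute[OF A B] mult_smult_distrib[OF A B] mult_smult_assoc_mat[OF A B] ..
  also have "A * B * (A * Adj_cross k A B) = A * B * Adj_cross k B A * B"
    unfolding Suc using A B X' by (intro assoc_mult_mat[symmetric, of _ m m _ n _ m]) auto
  also have "gram_coeff B A k \<cdot>\<^sub>m A * B - A * B * Adj_cross k B A * B =
      (gram_coeff B A k \<cdot>\<^sub>m A - A * B * Adj_cross k B A) * B"
    using A B X' by (intro minus_mult_distrib_mat[symmetric, of _ m n]) auto
  finally show ?case unfolding Adj_cross_Suc[OF B A] .
qed

text \<open>
  The factor \<open>B\<close> on the right makes the kernel of \<open>B\<close> contained in that of the adjoint, the factor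
  \<open>B\<close> on the left makes the range of the adjoint contained in that of \<open>B\<close>.
\<close>

lemma Adj_cross_factor:
  assumes A: "A \<in> carrier_mat m n" and B: "B \<in> carrier_mat n m"
  shows "\<exists>W\<in>carrier_mat m m. Adj_cross k A B = B * W" "\<exists>W\<in>carrier_mat n n. Adj_cross k A B = W * B"
proof -
  show "\<exists>W\<in>carrier_mat m m. Adj_cross k A B = B * W"
  proof (induction k)
    case 0
    then show ?case using A B by (intro bexI[of _ "0\<^sub>m m m"]) (auto simp: Adj_cross_0[OF A])
  next
    case (Suc k)
    then obtain W where W: "W \<in> carrier_mat m m" "Adj_cross k A B = B * W" by blast
    let ?W = "gram_coeff A B k \<cdot>\<^sub>m 1\<^sub>m m - A * B * W"
    have "B * ?W = B * (gram_coeff A B k \<cdot>\<^sub>m 1\<^sub>m m) - B * (A * B * W)"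
      using A B W by (intro mult_minus_distrib_mat[of _ n m _ m]) auto
    also have "\<dots> = gram_coeff A B k \<cdot>\<^sub>m B - B * A * (B * W)"
      using A B W by (simp add: mult_smult_distrib[of _ n m _ m] assoc_mult_mat[of _ m n _ m _ m] assoc_mult_mat[of _ n m _ n _ m])
    finally have "Adj_cross (Suc k) A B = B * ?W" unfolding Adj_cross_Suc[OF A B] W(2) ..
    then show ?case using A B W by (intro bexI[of _ ?W]) auto
  qed
  show "\<exists>W\<in>carrier_mat n n. Adj_cross k A B = W * B"
  proof (induction k)
    case 0
    then show ?case using A B by (intro bexI[of _ "0\<^sub>m n n"]) (auto simp: Adj_cross_0[OF A])
  next
    case (Suc k)
    then obtain W where W: "W \<in> carrier_mat n n" "Adj_cross k A B = W * B" by blast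
    let ?W = "gram_coeff A B k \<cdot>\<^sub>m 1\<^sub>m n - B * A * W"
    have "?W * B = gram_coeff A B k \<cdot>\<^sub>m 1\<^sub>m n * B - B * A * W * B"
      using A B W by (intro minus_mult_distrib_mat[of _ n n _ _ m]) auto
    also have "\<dots> = gram_coeff A B k \<cdot>\<^sub>m B - B * A * (W * B)"
      using A B W assoc_mult_mat[of "B * A" n n W n B m] by (simp add: mult_smult_assoc_mat[of _ n n _ m])
    finally have "Adj_cross (Suc k) A B = ?W * B" unfolding Adj_cross_Suc[OF A B] W(2) ..
    then show ?case using A B W by (intro bexI[of _ ?W]) auto
  qed
qed

lemma mult_mat_vec_smult:
  fixes A :: "'a::comm_ring_1 mat"
  assumes "A \<in> carrier_mat m n" "v \<in> carrier_vec n"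
  shows "A *\<^sub>v (c \<cdot>\<^sub>v v) = c \<cdot>\<^sub>v (A *\<^sub>v v)"
  using assms by (intro eq_vecI) (auto simp: scalar_prod_smult_distrib[of _ n])

lemma mult_mat_vec_zero:
  fixes A :: "'a::comm_ring_1 mat"
  assumes "A \<in> carrier_mat m n"
  shows "A *\<^sub>v 0\<^sub>v n = 0\<^sub>v m"
  using assms by (intro eq_vecI) auto

lemma submodule_vec_iff:
  fixes N :: "'a::comm_ring_1 vec set"
  shows "submodule class_ring N (module_vec TYPE('a) d) \<longleftrightarrow>
    N \<subseteq> carrier_vec d \<and> 0\<^sub>v d \<in> N \<and> (\<forall>v\<in>N. \<forall>w\<in>N. v + w \<in> N) \<and> (\<forall>c. \<forall>v\<in>N. c \<cdot>\<^sub>v v \<in> N)"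
proof -
  interpret vec_module "TYPE('a)" d .
  show ?thesis unfolding submodule_def using module_axioms by (auto simp: module_vec_simps)
qed

lemma submodule_mat_range:
  fixes A :: "'a::comm_ring_1 mat"
  assumes A: "A \<in> carrier_mat m n"
  shows "submodule class_ring (mat_range A) (module_vec TYPE('a) m)"
  unfolding submodule_vec_iff
proof (intro conjI ballI allI)
  show "mat_range A \<subseteq> carrier_vec m" using A by (auto simp: mat_range_def)
  show "0\<^sub>v m \<in> mat_range A" using A mult_mat_vec_zero[OF A]
    by (auto simp: mat_range_def intro!: image_eqI[of _ _ "0\<^sub>v n"])
  fix v assume "v \<in> mat_range A"
  then obtain x where x: "x \<in> carrier_vec n" "v = A *\<^sub>v x" using A by (auto simp: mat_range_def)
  show "c \<cdot>\<^sub>v v \<in> mat_range A" for c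
    unfolding mat_range_def
      by (rule image_eqI[of _ _ "c \<cdot>\<^sub>v x"]) (use A x in \<open>auto simp: mult_mat_vec_smult\<close>)
  fix w assume "w \<in> mat_range A"
  then obtain z where z: "z \<in> carrier_vec n" "w = A *\<^sub>v z" using A by (auto simp: mat_range_def)
  show "v + w \<in> mat_range A"
    unfolding mat_range_def
      by (rule image_eqI[of _ _ "x + z"]) (use A x z in \<open>auto simp: mult_add_distrib_mat_vec\<close>)
qed

lemma submodule_mat_kernel:
  fixes A :: "'a::comm_ring_1 mat"
  assumes A: "A \<in> carrier_mat m n"
  shows "submodule class_ring (mat_kernel A) (module_vec TYPE('a) n)"
  unfolding submodule_vec_iff mat_kernel[OF A] using A
  by (auto simp: mult_add_distrib_mat_vec mult_mat_vec_smult[OF A] mult_mat_vec_zero[OF A])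

lemma is_projection_range_kernel:
  fixes A :: "'a::comm_ring_1 mat"
  assumes A: "A \<in> carrier_mat m n" and P: "P \<in> carrier_mat m m" and B: "B \<in> carrier_mat r m"
    and P_range: "\<And>v. v \<in> carrier_vec n \<Longrightarrow> P *\<^sub>v (A *\<^sub>v v) = A *\<^sub>v v"
    and P_in: "\<And>v. v \<in> carrier_vec m \<Longrightarrow> P *\<^sub>v v \<in> mat_range A"
    and P_ker: "\<And>v. v \<in> carrier_vec m \<Longrightarrow> B *\<^sub>v v = 0\<^sub>v r \<longleftrightarrow> P *\<^sub>v v = 0\<^sub>v m"
  shows "is_projection m P (mat_range A) (mat_kernel B)"
proof -
  have sub: "mat_range A \<subseteq> carrier_vec m" using A by (auto simp: mat_range_def)
  have PP: "P *\<^sub>v v = v" if "v \<in> mat_range A" for v using that P_range A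
    by (auto simp: mat_range_def)
  have "is_direct_sum m (mat_range A) (mat_kernel B)"
    unfolding is_direct_sum_def
  proof (intro conjI submodule_mat_range[OF A] submodule_mat_kernel[OF B])
    show "mat_range A \<inter> mat_kernel B = {0\<^sub>v m}"
    proof (intro subset_antisym subsetI)
      fix x assume x: "x \<in> mat_range A \<inter> mat_kernel B"
      then have "x \<in> carrier_vec m" "B *\<^sub>v x = 0\<^sub>v r" using mat_kernelD[OF B] by auto
      then show "x \<in> {0\<^sub>v m}" using PP[of x] P_ker x by simp
    next
      fix x :: "'a vec" assume "x \<in> {0\<^sub>v m}"
      then show "x \<in> mat_range A \<inter> mat_kernel B"
        using submodule_mat_range[OF A] submodule_mat_kernel[OF B] by (auto simp: submodule_vec_iff)
    qed
    show "{x + y |x y. x \<in> mat_range A \<and> y \<in> mat_kernel B} = carrier_vec m"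
    proof (intro subset_antisym subsetI)
      fix x assume "x \<in> {x + y |x y. x \<in> mat_range A \<and> y \<in> mat_kernel B}"
      then show "x \<in> carrier_vec m" using sub mat_kernel_carrier[OF B] by (auto intro!: add_carrier_vec)
    next
      fix x :: "'a vec" assume x: "x \<in> carrier_vec m"
      have Px: "P *\<^sub>v x \<in> mat_range A" "P *\<^sub>v x \<in> carrier_vec m"
        using P_in[OF x] sub by auto
      have "P *\<^sub>v (x - P *\<^sub>v x) = 0\<^sub>v m"
        using x P Px PP[OF Px(1)] by (simp add: mult_minus_distrib_mat_vec)
      then have "x - P *\<^sub>v x \<in> mat_kernel B" using x Px P_ker[of "x - P *\<^sub>v x"]
        by (intro mat_kernelI[OF B]) auto
      moreover have "x = P *\<^sub>v x + (x - P *\<^sub>v x)" using x Px(2) P by (intro eq_vecI) auto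
      ultimately show "x \<in> {x + y |x y. x \<in> mat_range A \<and> y \<in> mat_kernel B}"
        using Px(1) by blast
    qed
  qed
  then show "is_projection m P (mat_range A) (mat_kernel B)"
    unfolding is_projection_def using P PP P_ker mat_kernelD[OF B] by auto
qed

lemma is_direct_sum_commute: "is_direct_sum d M N \<Longrightarrow> is_direct_sum d N M"
proof -
  assume *: "is_direct_sum d M N"
  then have c: "M \<subseteq> carrier_vec d" "N \<subseteq> carrier_vec d"
    by (auto simp: is_direct_sum_def submodule_vec_iff)
  have "{x + y |x y. x \<in> N \<and> y \<in> M} = {x + y |x y. x \<in> M \<and> y \<in> N}"
    using c comm_add_vec by (smt (verit) Collect_cong subsetD)
  then show ?thesis using * by (auto simp: is_direct_sum_def)
qed

lemma generalized_inverseI: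
  fixes A :: "'a::comm_ring_1 mat"
  assumes A: "A \<in> carrier_mat m n" and B: "B \<in> carrier_mat n m" and G: "G \<in> carrier_mat n m"
    and W: "W \<in> carrier_mat m m" "G = B * W" and W': "W' \<in> carrier_mat n n" "G = W' * B"
    and eq: "A * G * A = A" "G * A * G = G" "B * A * G = B" "G * A * B = B"
  shows "is_generalized_inverse A B G"
proof -
  have AG: "A * G \<in> carrier_mat m m" and GA: "G * A \<in> carrier_mat n n" using A G by auto
  have 1: "is_projection m (A * G) (mat_range A) (mat_kernel B)"
  proof (rule is_projection_range_kernel[OF A AG B])
    fix v :: "'a vec"
    show "A * G *\<^sub>v (A *\<^sub>v v) = A *\<^sub>v v" if "v \<in> carrier_vec n" for v
      using assoc_mult_mat_vec[OF AG A that] eq(1) by simp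
    show "A * G *\<^sub>v v \<in> mat_range A" if "v \<in> carrier_vec m" for v
      using assoc_mult_mat_vec[OF A G that] A G that by (auto simp: mat_range_def)
    show "(B *\<^sub>v v = 0\<^sub>v n) = (A * G *\<^sub>v v = 0\<^sub>v m)" if v: "v \<in> carrier_vec m" for v
    proof
      assume "B *\<^sub>v v = 0\<^sub>v n"
      then have "G *\<^sub>v v = 0\<^sub>v n"
        unfolding W'(2) assoc_mult_mat_vec[OF W'(1) B v] using mult_mat_vec_zero[OF W'(1)] by simp
      then show "A * G *\<^sub>v v = 0\<^sub>v m"
        unfolding assoc_mult_mat_vec[OF A G v] using mult_mat_vec_zero[OF A] by simp
    next
      assume *: "A * G *\<^sub>v v = 0\<^sub>v m"
      have "B * A * G = B * (A * G)" by (rule assoc_mult_mat[OF B A G])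
      then have "B *\<^sub>v v = B *\<^sub>v (A * G *\<^sub>v v)"
        using assoc_mult_mat_vec[OF B AG v] eq(3) by simp
      then show "B *\<^sub>v v = 0\<^sub>v n" unfolding * using mult_mat_vec_zero[OF B] by simp
    qed
  qed
  have 2: "is_projection n (G * A) (mat_range B) (mat_kernel A)"
  proof (rule is_projection_range_kernel[OF B GA A])
    show "G * A *\<^sub>v (B *\<^sub>v v) = B *\<^sub>v v" if "v \<in> carrier_vec m" for v
      using assoc_mult_mat_vec[OF GA B that] eq(4) by simp
    show "G * A *\<^sub>v v \<in> mat_range B" if v: "v \<in> carrier_vec n" for v
    proof -
      have "A *\<^sub>v v \<in> carrier_vec m" using A v by simp
      then have "G * A *\<^sub>v v = B *\<^sub>v (W *\<^sub>v (A *\<^sub>v v))"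
        using assoc_mult_mat_vec[OF G A v] assoc_mult_mat_vec[OF B W(1)] W(2) by simp
      then show ?thesis using A B W(1) v by (auto simp: mat_range_def)
    qed
    show "(A *\<^sub>v v = 0\<^sub>v m) = (G * A *\<^sub>v v = 0\<^sub>v n)" if v: "v \<in> carrier_vec n" for v
    proof
      assume "A *\<^sub>v v = 0\<^sub>v m"
      then show "G * A *\<^sub>v v = 0\<^sub>v n"
        unfolding assoc_mult_mat_vec[OF G A v] using mult_mat_vec_zero[OF G] by simp
    next
      assume *: "G * A *\<^sub>v v = 0\<^sub>v n"
      have "A * G * A = A * (G * A)" by (rule assoc_mult_mat[OF A G A])
      then have "A *\<^sub>v v = A *\<^sub>v (G * A *\<^sub>v v)"
        using assoc_mult_mat_vec[OF A GA v] eq(1) by simp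
      then show "A *\<^sub>v v = 0\<^sub>v m" unfolding * using mult_mat_vec_zero[OF A] by simp
    qed
  qed
  show ?thesis
    unfolding is_generalized_inverse_def crossed_def
    using A B G 1 2 is_direct_sum_commute eq(2) by (auto simp: is_projection_def)
qed

theorem Adj_cross_generalized_inverse:
  fixes A :: "'a::comm_ring_1 mat"
  assumes A: "A \<in> carrier_mat m n" and B: "B \<in> carrier_mat n m"
    and vA: "minors_vanish (Suc k) A" and vB: "minors_vanish (Suc k) B"
    and c: "c * gram_coeff A B k = 1"
  shows "is_generalized_inverse A B (c \<cdot>\<^sub>m Adj_cross k A B)"
proof -
  define X where "X = Adj_cross k A B"
  define X' where "X' = Adj_cross k B A"
  define g where "g = gram_coeff A B k"
  have X: "X \<in> carrier_mat n m" and X': "X' \<in> carrier_mat m n"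
    unfolding X_def X'_def using Adj_cross_carrier A B by blast+
  obtain W where W: "W \<in> carrier_mat m m" "X = B * W"
    using Adj_cross_factor(1)[OF A B, of k] X_def by auto
  obtain W' where W': "W' \<in> carrier_mat n n" "X = W' * B"
    using Adj_cross_factor(2)[OF A B, of k] X_def by auto
  have AXA: "A * X * A = g \<cdot>\<^sub>m A" unfolding X_def g_def by (rule Adj_cross_identity[OF A B vA])
  have BXB: "B * X' * B = g \<cdot>\<^sub>m B" unfolding X'_def g_def gram_coeff_commute[OF A B]
    by (rule Adj_cross_identity[OF B A vB])
  have AX: "A * X = X' * B" and XA: "X * A = B * X'"
    unfolding X_def X'_def using Adj_cross_intertwine[OF A B] Adj_cross_intertwine[OF B A] by simp_all
  have BAX: "B * A * X = g \<cdot>\<^sub>m B"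
    using AX BXB A B X X' by (simp add: assoc_mult_mat[of _ n m _ n _ m])
  have XAB: "X * A * B = g \<cdot>\<^sub>m B" using XA BXB by simp
  have XAX: "X * A * X = g \<cdot>\<^sub>m X"
  proof -
    have "X * A * X = X * A * (B * W)" by (simp only: W(2)[symmetric])
    also have "\<dots> = X * A * B * W" using X A B W(1)
      by (intro assoc_mult_mat[symmetric, of _ n n _ m _ m]) auto
    also have "\<dots> = g \<cdot>\<^sub>m (B * W)" unfolding XAB by (rule mult_smult_assoc_mat[OF B W(1)])
    also have "B * W = X" using W(2) by simp
    finally show ?thesis .
  qed
  have cg: "c * g = 1" using c by (simp add: g_def)
  have sm: "c \<cdot>\<^sub>m (g \<cdot>\<^sub>m M) = M" for M using cg
    by (intro eq_matI) (auto simp: mult.assoc[symmetric])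
  have cX: "c \<cdot>\<^sub>m X \<in> carrier_mat n m" using X by simp
  show ?thesis
    unfolding X_def[symmetric]
  proof (rule generalized_inverseI[OF A B cX])
    show "c \<cdot>\<^sub>m W \<in> carrier_mat m m" "c \<cdot>\<^sub>m W' \<in> carrier_mat n n"
      using W W' by auto
    show "c \<cdot>\<^sub>m X = B * (c \<cdot>\<^sub>m W)"
      unfolding W(2) using mult_smult_distrib[OF B W(1)] by simp
    show "c \<cdot>\<^sub>m X = c \<cdot>\<^sub>m W' * B"
      unfolding W'(2) using mult_smult_assoc_mat[OF W'(1) B] by simp
    have Ac: "A * (c \<cdot>\<^sub>m X) = c \<cdot>\<^sub>m (A * X)" by (rule mult_smult_distrib[OF A X])
    have cA: "c \<cdot>\<^sub>m X * A = c \<cdot>\<^sub>m (X * A)" by (rule mult_smult_assoc_mat[OF X A])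
    show "A * (c \<cdot>\<^sub>m X) * A = A"
      unfolding Ac using mult_smult_assoc_mat[of "A * X" m m A n c] A X AXA sm by simp
    show "c \<cdot>\<^sub>m X * A * (c \<cdot>\<^sub>m X) = c \<cdot>\<^sub>m X"
      unfolding cA using mult_smult_assoc_mat[of "X * A" n n "c \<cdot>\<^sub>m X" m c] mult_smult_distrib[of "X * A" n n X m c] A X XAX sm by simp
    show "B * A * (c \<cdot>\<^sub>m X) = B"
      using mult_smult_distrib[of "B * A" n n X m c] A B X BAX sm by simp
    show "c \<cdot>\<^sub>m X * A * B = B"
      unfolding cA using mult_smult_assoc_mat[of "X * A" n n B m c] A B X XAB sm by simp
  qed
qed

section \<open>The exchange relation and quasi-inverses\<close>

text \<open>
  The minor of order \<open>k + 1\<close> that borders the rows \<open>f\<close> by \<open>i\<close> and the columns \<open>g\<close> by \<open>c\<close> vanishes.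
  Expanding it along the last column gives the identity: the cofactor of row \<open>b\<close> is, after row \<open>i\<close> is
  moved into the place of row \<open>b\<close> by a transposition, the negative of the minor with row \<open>b\<close> replaced.
\<close>

lemma minor_bordered:
  assumes van: "minors_vanish (Suc k) A" and A: "A \<in> carrier_mat m n"
    and f: "\<And>a. a < k \<Longrightarrow> f a < m" and g: "\<And>a. a < k \<Longrightarrow> g a < n" and i: "i < m" and c: "c < n"
  shows "minor k A f g * A $$ (i, c) = (\<Sum>b<k. minor k A (f(b := i)) g * A $$ (f b, c))"
proof -
  define bordered where "bordered = (\<lambda>h u. mat (Suc k) (Suc k) (\<lambda>(a, j). if j = k then u a else A $$ (h a, g j)))"
  define \<delta> where "\<delta> = (\<lambda>(a::nat) x. if x = a then 1 else (0::'a))"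
  have bordered: "bordered h u \<in> carrier_mat (Suc k) (Suc k)" for h u by (simp add: bordered_def)
  have cof: "cofactor (bordered h u) a k = cofactor (bordered h u') a k" for h u u' a
    unfolding cofactor_def mat_delete_def
    by (intro arg_cong2[of _ _ _ _ "(*)"] refl arg_cong[of _ _ det] eq_matI) (auto simp: bordered_def)
  have lap: "det (bordered h u) = (\<Sum>a<Suc k. u a * cofactor (bordered h (\<lambda>_. 0)) a k)" for h u
    unfolding laplace_expansion_column[OF bordered, of k, OF lessI]
    by (intro sum.cong refl arg_cong2[of _ _ _ _ "(*)"] cof) (auto simp: bordered_def)
  have lap\<delta>: "det (bordered h (\<delta> a)) = cofactor (bordered h (\<lambda>_. 0)) a k"
    if "a < Suc k" for h a
  proof -
    have "det (bordered h (\<delta> a)) = (\<Sum>x<Suc k. if x = a then cofactor (bordered h (\<lambda>_. 0)) a k else 0)"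
      unfolding lap by (intro sum.cong) (auto simp: \<delta>_def)
    then show ?thesis using that by simp
  qed
  have last: "det (bordered h (\<delta> k)) = minor k A h g" for h
  proof -
    have "mat_delete (bordered h (\<lambda>_. 0)) k k = mat k k (\<lambda>(a, b). A $$ (h a, g b))"
      unfolding mat_delete_def by (intro eq_matI) (auto simp: bordered_def)
    then show ?thesis unfolding lap\<delta>[OF lessI] cofactor_def minor_def by simp
  qed
  \<comment> \<open>Replacing the last column by a unit vector isolates a cofactor; the transposition of rows
    \<open>b\<close> and \<open>k\<close> moves the entry \<open>1\<close> to the corner and the bordering row into place \<open>b\<close>.\<close>
  have swap: "det (bordered h (\<delta> b)) = - minor k A (\<lambda>a. h (transpose b k a)) g" if b: "b < k" for h b
  proof -
    have \<tau>: "transpose b k permutes {0..<Suc k}" using b by (intro permutes_swap_id) auto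
    have "bordered (\<lambda>a. h (transpose b k a)) (\<delta> k) = mat (Suc k) (Suc k) (\<lambda>(a, j). bordered h (\<delta> b) $$ (transpose b k a, j))"
    proof (rule eq_matI)
      fix a j assume "a < dim_row (mat (Suc k) (Suc k) (\<lambda>(a, j). bordered h (\<delta> b) $$ (transpose b k a, j)))"
        "j < dim_col (mat (Suc k) (Suc k) (\<lambda>(a, j). bordered h (\<delta> b) $$ (transpose b k a, j)))"
      then have "a < Suc k" "j < Suc k" "transpose b k a < Suc k"
        using permutes_in_image[OF \<tau>, of a] by auto
      then show "bordered (\<lambda>a. h (transpose b k a)) (\<delta> k) $$ (a, j) =
          mat (Suc k) (Suc k) (\<lambda>(a, j). bordered h (\<delta> b) $$ (transpose b k a, j)) $$ (a, j)"
        using b by (auto simp: bordered_def \<delta>_def transpose_def)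
    qed (auto simp: bordered_def)
    then have "det (bordered (\<lambda>a. h (transpose b k a)) (\<delta> k)) = - det (bordered h (\<delta> b))"
      using det_permute_rows[OF bordered \<tau>] b by (simp add: sign_swap_id)
    then show ?thesis unfolding last by simp
  qed
  let ?h = "f(k := i)"
  have "minor (Suc k) A ?h (g(k := c)) = 0"
    using f g i c by (intro minors_vanishD[OF van A]) (auto simp: less_Suc_eq)
  moreover have "mat (Suc k) (Suc k) (\<lambda>(a, b). A $$ (?h a, (g(k := c)) b)) = bordered ?h (\<lambda>a. A $$ (?h a, c))"
    by (intro eq_matI) (auto simp: bordered_def)
  ultimately have "0 = det (bordered ?h (\<lambda>a. A $$ (?h a, c)))" by (simp add: minor_def)
  also have "\<dots> = (\<Sum>a<Suc k. A $$ (?h a, c) * det (bordered ?h (\<delta> a)))"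
    unfolding lap[where u = "\<lambda>a. A $$ (?h a, c)"]
      by (intro sum.cong refl) (simp add: lap\<delta> del: fun_upd_apply)
  also have "\<dots> = (\<Sum>a<k. A $$ (f a, c) * det (bordered ?h (\<delta> a))) + A $$ (i, c) * minor k A ?h g"
    by (simp add: last)
  also have "minor k A ?h g = minor k A f g" by (rule minor_cong) auto
  also have "(\<Sum>a<k. A $$ (f a, c) * det (bordered ?h (\<delta> a))) = - (\<Sum>b<k. minor k A (f(b := i)) g * A $$ (f b, c))"
    unfolding sum_negf[symmetric]
  proof (intro sum.cong refl)
    fix b assume "b \<in> {..<k}"
    then have b: "b < k" by simp
    have "minor k A (\<lambda>a. ?h (transpose b k a)) g = minor k A (f(b := i)) g"
      by (rule minor_cong) (auto simp: transpose_def)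
    then show "A $$ (f b, c) * det (bordered ?h (\<delta> b)) = - (minor k A (f(b := i)) g * A $$ (f b, c))"
      unfolding swap[OF b] by simp
  qed
  finally show ?thesis by (simp add: mult.commute)
qed

text \<open>
  A Pluecker relation in which the two minors may have different columns. It follows by inserting
  \<open>minor_bordered\<close>, for the rows \<open>f'\<close>, into the expansion of the second minor along row \<open>a\<close>.
\<close>

theorem minor_exchange:
  assumes van: "minors_vanish (Suc k) A" and A: "A \<in> carrier_mat m n"
    and f: "\<And>a. a < k \<Longrightarrow> f a < m" and g: "\<And>a. a < k \<Longrightarrow> g a < n"
    and f': "\<And>a. a < k \<Longrightarrow> f' a < m" and g': "\<And>a. a < k \<Longrightarrow> g' a < n" and a: "a < k"
  shows "minor k A f' g' * minor k A f g = (\<Sum>b<k. minor k A (f'(b := f a)) g' * minor k A (f(a := f' b)) g)"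
proof -
  let ?c = "\<lambda>l. cofactor (mat k k (\<lambda>(a, b). A $$ (f a, g b))) a l"
  have "minor k A f' g' * minor k A f g = (\<Sum>l<k. minor k A f' g' * A $$ (f a, g l) * ?c l)"
    using minor_row_expand[OF a, of A f "f a" g] by (simp add: sum_distrib_left mult.assoc)
  also have "\<dots> = (\<Sum>l<k. \<Sum>b<k. minor k A (f'(b := f a)) g' * (A $$ (f' b, g l) * ?c l))"
    using minor_bordered[OF van A, where f = f' and g = g' and i = "f a"] f' g' f[OF a] g
      by (intro sum.cong refl) (simp add: sum_distrib_right mult.assoc)
  also have "\<dots> = (\<Sum>b<k. minor k A (f'(b := f a)) g' * minor k A (f(a := f' b)) g)"
    unfolding minor_row_expand[OF a, of A f] by (subst sum.swap) (simp add: sum_distrib_left)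
  finally show ?thesis .
qed

lemma minors_vanish_transpose:
  assumes "minors_vanish k A"
  shows "minors_vanish k (transpose_mat A)"
  unfolding minors_vanish_def
proof (intro allI impI)
  fix f g assume fg: "\<forall>a<k. f a < dim_row (transpose_mat A)" "\<forall>a<k. g a < dim_col (transpose_mat A)"
  then have "minor k (transpose_mat A) f g = minor k A g f"
    by (intro minor_transpose[of A "dim_row A" "dim_col A"]) auto
  then show "minor k (transpose_mat A) f g = 0"
    using fg minors_vanishD[OF assms, of "dim_row A" "dim_col A" g f] by auto
qed

text \<open>
  The coefficients in \<open>minor_bordered\<close> are linear in row \<open>i\<close> of \<open>A\<close>, with cofactors as coefficients.
  So the identity has the form \<open>A B A = \<mu> A\<close>, where \<open>B\<close> carries the adjugate of the submatrix.
\<close>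

lemma minor_quasi_inverse:
  assumes van: "minors_vanish (Suc k) A" and A: "A \<in> carrier_mat m n"
    and f: "\<And>a. a < k \<Longrightarrow> f a < m" and g: "\<And>a. a < k \<Longrightarrow> g a < n"
  shows "\<exists>B\<in>carrier_mat n m. A * B * A = minor k A f g \<cdot>\<^sub>m A"
proof -
  \<comment> \<open>\<open>S\<close> and \<open>T\<close> select the columns \<open>g\<close> and the rows \<open>f\<close>; \<open>C\<close> is the adjugate of the submatrix.\<close>
  define S where "S = mat n k (\<lambda>(x, l). if x = g l then 1 else (0::'a))"
  define T where "T = mat k m (\<lambda>(b, y). if y = f b then 1 else (0::'a))"
  define C where "C = mat k k (\<lambda>(l, b). cofactor (mat k k (\<lambda>(a, b). A $$ (f a, g b))) b l)"
  have S: "S \<in> carrier_mat n k" and T: "T \<in> carrier_mat k m" and C: "C \<in> carrier_mat k k"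
    by (auto simp: S_def T_def C_def)
  have AS: "A * S = mat m k (\<lambda>(i, l). A $$ (i, g l))"
  proof (rule eq_matI)
    fix i l assume "i < dim_row (mat m k (\<lambda>(i, l). A $$ (i, g l)))" "l < dim_col (mat m k (\<lambda>(i, l). A $$ (i, g l)))"
    then have il: "i < m" "l < k" by auto
    have "(A * S) $$ (i, l) = (\<Sum>x<n. if x = g l then A $$ (i, g l) else 0)"
      unfolding index_mult_mat_sum[OF A S il] using il by (intro sum.cong) (auto simp: S_def)
    then show "(A * S) $$ (i, l) = mat m k (\<lambda>(i, l). A $$ (i, g l)) $$ (i, l)" using il g by simp
  qed (use A S in auto)
  have TA: "T * A = mat k n (\<lambda>(b, c). A $$ (f b, c))"
  proof (rule eq_matI)
    fix b c assume "b < dim_row (mat k n (\<lambda>(b, c). A $$ (f b, c)))" "c < dim_col (mat k n (\<lambda>(b, c). A $$ (f b, c)))"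
    then have bc: "b < k" "c < n" by auto
    have "(T * A) $$ (b, c) = (\<Sum>y<m. if y = f b then A $$ (f b, c) else 0)"
      unfolding index_mult_mat_sum[OF T A bc] using bc by (intro sum.cong) (auto simp: T_def)
    then show "(T * A) $$ (b, c) = mat k n (\<lambda>(b, c). A $$ (f b, c)) $$ (b, c)" using bc f by simp
  qed (use A T in auto)
  have ASC: "A * S * C \<in> carrier_mat m k" using A S C by simp
  have TA': "T * A \<in> carrier_mat k n" using T A by simp
  have "A * (S * C * T) * A = A * S * C * (T * A)"
  proof -
    have "A * (S * C * T) = A * (S * C) * T"
      by (rule assoc_mult_mat[symmetric, OF A mult_carrier_mat[OF S C] T])
    also have "A * (S * C) = A * S * C" by (rule assoc_mult_mat[symmetric, OF A S C])
    finally show ?thesis using assoc_mult_mat[OF ASC T A] by simp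
  qed
  also have "\<dots> = minor k A f g \<cdot>\<^sub>m A"
  proof (rule eq_matI)
    fix i c assume "i < dim_row (minor k A f g \<cdot>\<^sub>m A)" "c < dim_col (minor k A f g \<cdot>\<^sub>m A)"
    then have ic: "i < m" "c < n" using A by auto
    have "(A * S * C * (T * A)) $$ (i, c) = (\<Sum>b<k. (\<Sum>l<k. A $$ (i, g l) * C $$ (l, b)) * A $$ (f b, c))"
      unfolding index_mult_mat_sum[OF ASC TA' ic]
      using ic index_mult_mat_sum[of "A * S" m k C k i] C unfolding AS TA by (intro sum.cong) auto
    also have "\<dots> = (\<Sum>b<k. minor k A (f(b := i)) g * A $$ (f b, c))"
      by (intro sum.cong refl arg_cong2[of _ _ _ _ "(*)"]) (simp add: minor_row_expand C_def)
    also have "\<dots> = (minor k A f g \<cdot>\<^sub>m A) $$ (i, c)"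
      using minor_bordered[OF van A f g ic] ic A by simp
    finally show "(A * S * C * (T * A)) $$ (i, c) = (minor k A f g \<cdot>\<^sub>m A) $$ (i, c)" .
  qed (use A T C S in auto)
  finally show ?thesis using S C T by (intro bexI[of _ "S * C * T"]) auto
qed

text \<open>
  The equation \<open>A B A = r A\<close> is linear in \<open>(B, r)\<close>. Hence the solvable \<open>r\<close> form an ideal, and quasi-inverses
  for single minors are glued without any localization.
\<close>

theorem quasi_inverse_exists:
  assumes van: "minors_vanish (Suc k) A" and A: "A \<in> carrier_mat m n" and unit: "det_ideal k A = UNIV"
  obtains B where "B \<in> carrier_mat n m" "A * B * A = A"
proof -
  let ?J = "{r. \<exists>B\<in>carrier_mat n m. A * B * A = r \<cdot>\<^sub>m A}"
  have "ideal ?J class_ring"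
  proof (rule ideal_class_ringI)
    have "A * 0\<^sub>m n m * A = 0 \<cdot>\<^sub>m A" using A by (intro eq_matI) auto
    then show "0 \<in> ?J" by (auto intro: bexI[of _ "0\<^sub>m n m"])
  next
    fix x y assume "x \<in> ?J" "y \<in> ?J"
    then obtain B C where B: "B \<in> carrier_mat n m" "A * B * A = x \<cdot>\<^sub>m A"
      and C: "C \<in> carrier_mat n m" "A * C * A = y \<cdot>\<^sub>m A" by blast
    have "A * (B + C) * A = A * B * A + A * C * A"
      using A B(1) C(1) by (simp add: mult_add_distrib_mat[of _ m n _ m] add_mult_distrib_mat[of _ m m _ _ n])
    also have "\<dots> = (x + y) \<cdot>\<^sub>m A" unfolding B C using A
      by (intro eq_matI) (auto simp: distrib_right)
    finally show "x + y \<in> ?J" using B C by (auto intro!: bexI[of _ "B + C"])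
  next
    fix r x assume "x \<in> ?J"
    then obtain B where B: "B \<in> carrier_mat n m" "A * B * A = x \<cdot>\<^sub>m A" by blast
    have "A * (r \<cdot>\<^sub>m B) * A = r \<cdot>\<^sub>m (A * B * A)"
      using A B(1) by (simp add: mult_smult_distrib[of _ m n _ m] mult_smult_assoc_mat[of _ m m _ n])
    also have "\<dots> = (r * x) \<cdot>\<^sub>m A" unfolding B using A
      by (intro eq_matI) (auto simp: mult.assoc)
    finally show "r * x \<in> ?J" using B by (auto intro!: bexI[of _ "r \<cdot>\<^sub>m B"])
  qed
  then have "det_ideal k A \<subseteq> ?J"
    by (rule det_ideal_subset[OF A]) (use minor_quasi_inverse[OF van A] in blast)
  then have "1 \<in> ?J" using unit by blast
  then obtain B where "B \<in> carrier_mat n m" "A * B * A = 1 \<cdot>\<^sub>m A" by blast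
  moreover have "1 \<cdot>\<^sub>m A = A" by (intro eq_matI) auto
  ultimately show ?thesis using that by simp
qed

section \<open>Minors whose weighted squares have sums in an ideal\<close>

definition radical :: "'a::comm_ring_1 set \<Rightarrow> 'a set" where
  "radical J = {x. \<exists>e. x ^ e \<in> J}"

lemma ideal_radical:
  assumes J: "ideal J class_ring"
  shows "ideal (radical J) class_ring"
proof (rule ideal_class_ringI)
  show "0 \<in> radical J"
    unfolding radical_def using ideal_class_ringD(1)[OF J] by (auto intro: exI[of _ 1])
next
  fix r x assume "x \<in> radical J"
  then obtain e where "x ^ e \<in> J" by (auto simp: radical_def)
  then have "(r * x) ^ e \<in> J" unfolding power_mult_distrib by (rule ideal_class_ringD(3)[OF J])
  then show "r * x \<in> radical J" by (auto simp: radical_def)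
next
  fix x y assume "x \<in> radical J" "y \<in> radical J"
  then obtain d e where d: "x ^ d \<in> J" and e: "y ^ e \<in> J" by (auto simp: radical_def)
  have "(x + y) ^ (d + e) \<in> J"
    unfolding binomial_ring
  proof (rule ideal_sum[OF J])
    fix i assume "i \<in> {..d + e}"
    then consider "i \<ge> d" | "d + e - i \<ge> e" by (cases "i \<ge> d") auto
    then show "of_nat (d + e choose i) * x ^ i * y ^ (d + e - i) \<in> J"
    proof cases
      case 1
      then have "x ^ i = x ^ (i - d) * x ^ d" by (simp flip: power_add)
      then have "of_nat (d + e choose i) * x ^ i * y ^ (d + e - i) = (of_nat (d + e choose i) * x ^ (i - d) * y ^ (d + e - i)) * x ^ d"
        by (simp add: mult_ac)
      then show ?thesis using ideal_class_ringD(3)[OF J d] by simp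
    next
      case 2
      then have "y ^ (d + e - i) = y ^ (d + e - i - e) * y ^ e"
        by (metis le_add_diff_inverse2 power_add)
      then have "of_nat (d + e choose i) * x ^ i * y ^ (d + e - i) = (of_nat (d + e choose i) * x ^ i * y ^ (d + e - i - e)) * y ^ e"
        by (simp add: mult_ac)
      then show ?thesis using ideal_class_ringD(3)[OF J e] by simp
    qed
  qed
  then show "x + y \<in> radical J" by (auto simp: radical_def)
qed

lemma radical_superset: "J \<subseteq> radical J"
  unfolding radical_def by (auto intro: exI[of _ 1])

lemma radical_power:
  assumes "x ^ e \<in> radical J"
  shows "x \<in> radical J"
  using assms unfolding radical_def by (auto simp: power_mult[symmetric])

definition weight :: "nat set \<Rightarrow> int" where
  "weight I = (\<Sum>i\<in>I. int i)"

lemma weight_image: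
  assumes "inj_on f {..<k}"
  shows "weight (f ` {..<k}) = (\<Sum>a<k. int (f a))"
  unfolding weight_def using assms by (simp add: sum.reindex)

lemma weight_pick:
  assumes "I \<in> k_subsets k m"
  shows "weight I = (\<Sum>a<k. int (pick I a))"
  using weight_image[OF pick_k_subset(2)[OF assms]] pick_k_subset(3)[OF assms] by simp

lemma sum_fun_upd:
  fixes f :: "nat \<Rightarrow> nat"
  assumes "b < k"
  shows "(\<Sum>a<k. int ((f(b := d)) a)) = (\<Sum>a<k. int (f a)) - int (f b) + int d"
proof -
  have "(\<Sum>a<k. int ((f(b := d)) a)) = int d + (\<Sum>a\<in>{..<k} - {b}. int ((f(b := d)) a))"
    using assms by (subst sum.remove[of _ b]) auto
  also have "(\<Sum>a\<in>{..<k} - {b}. int ((f(b := d)) a)) = (\<Sum>a\<in>{..<k} - {b}. int (f a))"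
    by (intro sum.cong) auto
  also have "\<dots> = (\<Sum>a<k. int (f a)) - int (f b)"
    using assms by (subst (2) sum.remove[of _ b]) auto
  finally show ?thesis by simp
qed

text \<open>
  In the exchange relation for a row \<open>d\<close> in \<open>I\<close> but not in \<open>I'\<close>, the terms that bring in a row of
  \<open>I \<inter> I'\<close> have two equal rows. So only replacements of rows outside \<open>I\<close> have to be controlled.
\<close>

lemma exchange_rows_in_ideal:
  fixes A :: "'a::comm_ring_1 mat"
  assumes van: "minors_vanish (Suc k) A" and A: "A \<in> carrier_mat m n" and R: "ideal R class_ring"
    and I: "I \<in> k_subsets k m" "I' \<in> k_subsets k m" and J: "J \<in> k_subsets k n" "J' \<in> k_subsets k n"
    and d: "d \<in> I" "d \<notin> I'"
    and R': "\<And>b. b < k \<Longrightarrow> pick I' b \<notin> I \<Longrightarrow> minor k A ((pick I')(b := d)) (pick J') \<in> R"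
  shows "minor k A (pick I') (pick J') * minor k A (pick I) (pick J) \<in> R"
proof -
  obtain a where a: "a < k" "pick I a = d" using pick_k_subset(3)[OF I(1)] d(1) by (metis imageE lessThan_iff)
  have "minor k A (pick I') (pick J') * minor k A (pick I) (pick J) =
    (\<Sum>b<k. minor k A ((pick I')(b := pick I a)) (pick J') * minor k A ((pick I)(a := pick I' b)) (pick J))"
    by (rule minor_exchange[OF van A]) (use pick_k_subset(5) I J a in auto)
  also have "\<dots> \<in> R"
  proof (rule ideal_sum[OF R])
    fix b assume "b \<in> {..<k}"
    then have b: "b < k" by simp
    show "minor k A ((pick I')(b := pick I a)) (pick J') * minor k A ((pick I)(a := pick I' b)) (pick J) \<in> R"
    proof (cases "pick I' b \<in> I")
      case True
      then obtain a' where a': "a' < k" "pick I a' = pick I' b" using pick_k_subset(3)[OF I(1)]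
        by (metis imageE lessThan_iff)
      then have "a' \<noteq> a" using pick_k_subset(4)[OF I(2) b] a d by auto
      then have "minor k A ((pick I)(a := pick I' b)) (pick J) = 0"
        using a' a by (intro minor_eq_rows[of a k a']) auto
      then show ?thesis using ideal_class_ringD(1)[OF R] by simp
    next
      case False
      have "minor k A ((pick I')(b := pick I a)) (pick J') \<in> R" using R'[OF b False] a(2) by simp
      then show ?thesis unfolding mult.commute[of "minor k A ((pick I')(b := pick I a)) (pick J')"]
        by (rule ideal_class_ringD(3)[OF R])
    qed
  qed
  finally show ?thesis .
qed

lemma exchange_cols_in_ideal:
  fixes A :: "'a::comm_ring_1 mat"
  assumes van: "minors_vanish (Suc k) A" and A: "A \<in> carrier_mat m n" and R: "ideal R class_ring"
    and I: "I \<in> k_subsets k m" "I' \<in> k_subsets k m" and J: "J \<in> k_subsets k n" "J' \<in> k_subsets k n"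
    and d: "d \<in> J" "d \<notin> J'"
    and R': "\<And>b. b < k \<Longrightarrow> pick J' b \<notin> J \<Longrightarrow> minor k A (pick I') ((pick J')(b := d)) \<in> R"
  shows "minor k A (pick I') (pick J') * minor k A (pick I) (pick J) \<in> R"
proof -
  have t: "minor k (transpose_mat A) v u = minor k A u v"
    if "\<And>a. a < k \<Longrightarrow> u a < m" "\<And>a. a < k \<Longrightarrow> v a < n" for u v
    using that by (intro minor_transpose[OF A]) auto
  have dn: "d < n" using d(1) J(1) by (auto simp: k_subsets_def)
  have upd: "((pick J')(b := d)) a < n" if "a < k" for a b using dn pick_k_subset(5)[OF J(2) that] by simp
  have "minor k (transpose_mat A) (pick J') (pick I') * minor k (transpose_mat A) (pick J) (pick I) \<in> R"
    by (rule exchange_rows_in_ideal[OF minors_vanish_transpose[OF van] _ R J I d])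
      (use A R' t[where u = "pick I'"] pick_k_subset(5)[OF I(2)] pick_k_subset(5)[OF J(2)] dn in \<open>auto simp del: fun_upd_apply simp: upd\<close>)
  then show ?thesis using t pick_k_subset(5)[OF I(1)] pick_k_subset(5)[OF I(2)] pick_k_subset(5)[OF J(1)] pick_k_subset(5)[OF J(2)] by simp
qed

text \<open>
  Induction from large to small weight. Let \<open>(I, J)\<close> and \<open>(I\<^sub>0, J\<^sub>0)\<close> be different index pairs of the
  same weight. If \<open>I \<noteq> I\<^sub>0\<close>, exchange the largest element of the symmetric difference: it replaces
  a smaller element, so the weight increases. If \<open>I = I\<^sub>0\<close>, exchange the smallest element of the
  symmetric difference of the column sets, which enters the weight negatively. In both cases
  the product of the two minors is in the radical. Multiplying the sum of squares by one of its
  minors therefore leaves the cube of this minor.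
\<close>

theorem minors_in_radical:
  fixes A :: "'a::comm_ring_1 mat"
  assumes van: "minors_vanish (Suc k) A" and A: "A \<in> carrier_mat m n" and J: "ideal \<aa> class_ring"
    and sq: "\<And>w. (\<Sum>(I, J) \<in> {(I, J) \<in> k_subsets k m \<times> k_subsets k n. weight I - weight J = w}. minor k A (pick I) (pick J) ^ 2) \<in> \<aa>"
    and f: "\<And>a. a < k \<Longrightarrow> f a < m" and g: "\<And>a. a < k \<Longrightarrow> g a < n"
  shows "minor k A f g \<in> radical \<aa>"
  using f g
  \<comment> \<open>No weight exceeds \<open>k m\<close>; the summand \<open>1\<close> keeps the measure decreasing at weight \<open>k m\<close>.\<close>
proof (induction "nat (int (k * m) + 1 - ((\<Sum>a<k. int (f a)) - (\<Sum>a<k. int (g a))))" arbitrary: f g rule: less_induct)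
  case less
  note R = ideal_radical[OF J]
  let ?w = "(\<Sum>a<k. int (f a)) - (\<Sum>a<k. int (g a))"
  show ?case
  proof (cases "minor k A f g = 0")
    case True
    then show ?thesis using ideal_class_ringD(1)[OF R] by simp
  next
    case False
    define I0 where "I0 = f ` {..<k}"
    define J0 where "J0 = g ` {..<k}"
    let ?\<mu> = "\<lambda>I J. minor k A (pick I) (pick J)"
    have inj: "inj_on f {..<k}" "inj_on g {..<k}" and I0: "I0 \<in> k_subsets k m" and J0: "J0 \<in> k_subsets k n"
      and ex: "\<exists>s. minor k A f g = s * ?\<mu> I0 J0"
      using minor_sorted[OF less.prems(1) less.prems(2) False] by (auto simp: I0_def J0_def)
    have w0: "weight I0 - weight J0 = ?w"
      unfolding I0_def J0_def weight_image[OF inj(1)] weight_image[OF inj(2)] ..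
    have bound: "?w \<le> int (k * m)"
    proof -
      have "(\<Sum>a<k. int (f a)) \<le> (\<Sum>a<k. int m)" using less.prems(1)
        by (intro sum_mono) (simp add: less_imp_le)
      moreover have "(\<Sum>a<k. int (g a)) \<ge> 0" by (intro sum_nonneg) simp
      ultimately show ?thesis by simp
    qed
    have higher: "minor k A f' g' \<in> radical \<aa>"
      if "\<And>a. a < k \<Longrightarrow> f' a < m" "\<And>a. a < k \<Longrightarrow> g' a < n" "(\<Sum>a<k. int (f' a)) - (\<Sum>a<k. int (g' a)) > ?w" for f' g'
      by (rule less.hyps) (use that bound in auto)
    have rows: "?\<mu> I' J' * ?\<mu> I J \<in> radical \<aa>"
      if I: "I \<in> k_subsets k m" "I' \<in> k_subsets k m" and J: "J \<in> k_subsets k n" "J' \<in> k_subsets k n"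
        and w: "weight I' - weight J' = ?w" and d: "d \<in> I" "d \<notin> I'" "\<And>x. x \<in> I' - I \<Longrightarrow> x < d" for I I' J J' d
    proof (rule exchange_rows_in_ideal[OF van A R I J d(1,2)])
      fix b assume *: "b < k" "pick I' b \<notin> I"
      have "d < m" using d(1) I(1) by (auto simp: k_subsets_def)
      then have "((pick I')(b := d)) a < m" if "a < k" for a using pick_k_subset(5)[OF I(2) that] by simp
      then show "minor k A ((pick I')(b := d)) (pick J') \<in> radical \<aa>"
        using w d(3)[of "pick I' b"] pick_k_subset(4)[OF I(2) *(1)] *
        by (intro higher) (auto simp: sum_fun_upd[OF *(1)] weight_pick[OF I(2)] weight_pick[OF J(2)] pick_k_subset(5)[OF J(2)] simp del: fun_upd_apply)
    qed
    have cols: "?\<mu> I' J' * ?\<mu> I J \<in> radical \<aa>"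
      if I: "I \<in> k_subsets k m" "I' \<in> k_subsets k m" and J: "J \<in> k_subsets k n" "J' \<in> k_subsets k n"
        and w: "weight I' - weight J' = ?w" and d: "d \<in> J" "d \<notin> J'" "\<And>x. x \<in> J' - J \<Longrightarrow> d < x" for I I' J J' d
    proof (rule exchange_cols_in_ideal[OF van A R I J d(1,2)])
      fix b assume *: "b < k" "pick J' b \<notin> J"
      have "d < n" using d(1) J(1) by (auto simp: k_subsets_def)
      then have "((pick J')(b := d)) a < n" if "a < k" for a using pick_k_subset(5)[OF J(2) that] by simp
      then show "minor k A (pick I') ((pick J')(b := d)) \<in> radical \<aa>"
        using w d(3)[of "pick J' b"] pick_k_subset(4)[OF J(2) *(1)] *
        by (intro higher) (auto simp: sum_fun_upd[OF *(1)] weight_pick[OF I(2)] weight_pick[OF J(2)] pick_k_subset(5)[OF I(2)] simp del: fun_upd_apply)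
    qed
    have cross: "?\<mu> I0 J0 * ?\<mu> I J \<in> radical \<aa>"
      if I: "I \<in> k_subsets k m" and J: "J \<in> k_subsets k n" and w: "weight I - weight J = ?w" and ne: "(I, J) \<noteq> (I0, J0)" for I J
    proof (cases "I = I0")
      case False
      define D where "D = (I - I0) \<union> (I0 - I)"
      have D: "finite D" "D \<noteq> {}" using I I0 False finite_subset by (auto simp: D_def k_subsets_def)
      have "Max D \<in> D" using D by simp
      then consider "Max D \<in> I" "Max D \<notin> I0" | "Max D \<in> I0" "Max D \<notin> I"
        by (auto simp: D_def)
      then show ?thesis
      proof cases
        case 1
        then have "x < Max D" if "x \<in> I0 - I" for x
          using Max_ge[OF D(1), of x] that unfolding D_def by (metis DiffD1 DiffD2 UnI2 le_neq_implies_less)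
        then show ?thesis using rows[OF I I0 J J0 w0 1] by blast
      next
        case 2
        then have "x < Max D" if "x \<in> I - I0" for x
          using Max_ge[OF D(1), of x] that unfolding D_def by (metis DiffD1 DiffD2 UnI1 le_neq_implies_less)
        then show ?thesis using rows[OF I0 I J0 J w 2] by (simp add: mult.commute)
      qed
    next
      case True
      then have "J \<noteq> J0" using ne by simp
      define D where "D = (J - J0) \<union> (J0 - J)"
      have D: "finite D" "D \<noteq> {}" using J J0 \<open>J \<noteq> J0\<close> finite_subset
        by (auto simp: D_def k_subsets_def)
      have "Min D \<in> D" using D by simp
      then consider "Min D \<in> J" "Min D \<notin> J0" | "Min D \<in> J0" "Min D \<notin> J"
        by (auto simp: D_def)
      then show ?thesis
      proof cases
        case 1
        then have "Min D < x" if "x \<in> J0 - J" for x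
          using Min_le[OF D(1), of x] that unfolding D_def by (metis DiffD1 DiffD2 UnI2 le_neq_implies_less)
        then show ?thesis using cols[OF I I0 J J0 w0 1] by blast
      next
        case 2
        then have "Min D < x" if "x \<in> J - J0" for x
          using Min_le[OF D(1), of x] that unfolding D_def by (metis DiffD1 DiffD2 UnI1 le_neq_implies_less)
        then show ?thesis using cols[OF I0 I J0 J w 2] by (simp add: mult.commute)
      qed
    qed
    let ?K = "{(I, J) \<in> k_subsets k m \<times> k_subsets k n. weight I - weight J = ?w}"
    have finK: "finite ?K" by (rule finite_subset[of _ "k_subsets k m \<times> k_subsets k n"]) auto
    have inK: "(I0, J0) \<in> ?K" using I0 J0 w0 by simp
    have "?\<mu> I0 J0 * (\<Sum>(I, J)\<in>?K. ?\<mu> I J ^ 2) \<in> radical \<aa>"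
      using sq[of ?w] radical_superset[of \<aa>] by (intro ideal_class_ringD(3)[OF R]) blast
    also have "(\<Sum>(I, J)\<in>?K. ?\<mu> I J ^ 2) = ?\<mu> I0 J0 ^ 2 + (\<Sum>(I, J)\<in>?K - {(I0, J0)}. ?\<mu> I J ^ 2)"
      by (subst sum.remove[OF finK inK]) simp
    finally have 1: "?\<mu> I0 J0 ^ 3 + (\<Sum>(I, J)\<in>?K - {(I0, J0)}. ?\<mu> I J * (?\<mu> I0 J0 * ?\<mu> I J)) \<in> radical \<aa>"
      by (simp add: distrib_left sum_distrib_left case_prod_unfold power2_eq_square power3_eq_cube mult_ac)
    have 2: "(\<Sum>(I, J)\<in>?K - {(I0, J0)}. ?\<mu> I J * (?\<mu> I0 J0 * ?\<mu> I J)) \<in> radical \<aa>"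
    proof (rule ideal_sum[OF R])
      fix x assume "x \<in> ?K - {(I0, J0)}"
      then obtain I J where x: "x = (I, J)" "I \<in> k_subsets k m" "J \<in> k_subsets k n" "weight I - weight J = ?w" "(I, J) \<noteq> (I0, J0)"
        by blast
      show "(case x of (I, J) \<Rightarrow> ?\<mu> I J * (?\<mu> I0 J0 * ?\<mu> I J)) \<in> radical \<aa>"
        unfolding x(1) prod.case by (rule ideal_class_ringD(3)[OF R cross[OF x(2-5)]])
    qed
    have "?\<mu> I0 J0 ^ 3 \<in> radical \<aa>"
      using ideal_class_ringD(2)[OF R 1 ideal_class_ringD(3)[OF R 2, of "-1"]] by simp
    then have "?\<mu> I0 J0 \<in> radical \<aa>" by (rule radical_power)
    then show ?thesis using ex ideal_class_ringD(3)[OF R] by auto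
  qed
qed

section \<open>Idempotent ideals generated by nilpotent elements\<close>

text \<open>
  The generators are removed one at a time: modulo the other generators the ideal is contained in
  \<open>u \<aa>\<close>, hence in \<open>u\<^sup>e \<aa>\<close> for all \<open>e\<close>, and \<open>u\<close> is nilpotent.
\<close>

lemma idempotent_ideal_nilpotent:
  fixes \<aa> :: "'a::comm_ring_1 set"
  assumes \<aa>: "ideal \<aa> class_ring" and "finite T" and "\<And>t. t \<in> T \<Longrightarrow> \<exists>e. t ^ e = 0"
    and "\<aa> \<subseteq> Idl\<^bsub>class_ring\<^esub> {a * t | a t. a \<in> \<aa> \<and> t \<in> T}"
  shows "\<aa> \<subseteq> {0}"
  using assms(2-4)
proof (induction T rule: finite_induct)
  case empty
  have "Idl\<^bsub>class_ring\<^esub> {a * t | a t. a \<in> \<aa> \<and> t \<in> {}} \<subseteq> {0}"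
    by (intro Idl_mono_ideal ideal_zero) auto
  then show ?case using empty.prems(2) by blast
next
  case (insert u T)
  define K where "K = (\<lambda>e. Idl\<^bsub>class_ring\<^esub> ({u ^ e * a | a. a \<in> \<aa>} \<union> {a * t | a t. a \<in> \<aa> \<and> t \<in> T}))"
  have K: "ideal (K e) class_ring" for e unfolding K_def by (rule ideal_genideal)
  have gen: "a * t \<in> K e" if "a \<in> \<aa>" "t \<in> T" for e a t
    unfolding K_def using that by (auto intro!: subsetD[OF genideal_superset])
  have gen': "u ^ e * a \<in> K e" if "a \<in> \<aa>" for e a
    unfolding K_def using that by (auto intro!: subsetD[OF genideal_superset])
  \<comment> \<open>\<open>K e\<close> is the ideal \<open>u\<^sup>e \<aa> + T \<aa>\<close>.\<close>
  have step: "\<aa> \<subseteq> K e" for e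
  proof (induction e)
    case 0
    then show ?case using gen'[of _ 0] by auto
  next
    case (Suc e)
    have "ideal {x. u ^ e * x \<in> K (Suc e)} class_ring"
    proof (rule ideal_class_ringI)
      show "0 \<in> {x. u ^ e * x \<in> K (Suc e)}" using ideal_class_ringD(1)[OF K] by simp
      show "x + y \<in> {x. u ^ e * x \<in> K (Suc e)}"
        if "x \<in> {x. u ^ e * x \<in> K (Suc e)}" "y \<in> {x. u ^ e * x \<in> K (Suc e)}" for x y
        using ideal_class_ringD(2)[OF K] that by (simp add: distrib_left)
      show "r * x \<in> {x. u ^ e * x \<in> K (Suc e)}" if "x \<in> {x. u ^ e * x \<in> K (Suc e)}" for r x
        using ideal_class_ringD(3)[OF K, of "u ^ e * x" _ r] that by (simp add: mult.left_commute)
    qed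
    then have "Idl\<^bsub>class_ring\<^esub> {a * t | a t. a \<in> \<aa> \<and> t \<in> insert u T} \<subseteq> {x. u ^ e * x \<in> K (Suc e)}"
    proof (rule Idl_mono_ideal, safe)
      fix a t assume a: "a \<in> \<aa>"
      show "u ^ e * (a * u) \<in> K (Suc e)" using gen'[OF a, of "Suc e"] by (simp add: mult_ac)
      assume "t \<in> T"
      then have "(u ^ e * a) * t \<in> K (Suc e)" using a ideal_class_ringD(3)[OF \<aa>] by (intro gen) auto
      then show "u ^ e * (a * t) \<in> K (Suc e)" by (simp add: mult.assoc)
    qed
    then have "u ^ e * a \<in> K (Suc e)" if "a \<in> \<aa>" for a using insert.prems(2) that by blast
    then have "K e \<subseteq> K (Suc e)" by (subst K_def, intro Idl_mono_ideal K) (use gen in blast)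
    then show ?case using Suc by blast
  qed
  obtain e where e: "u ^ e = 0" using insert.prems(1) by blast
  have "K e \<subseteq> Idl\<^bsub>class_ring\<^esub> {a * t | a t. a \<in> \<aa> \<and> t \<in> T}"
    unfolding K_def e using ideal_class_ringD(1)[OF ideal_genideal] genideal_superset
    by (intro Idl_mono_ideal ideal_genideal) fastforce
  then have "\<aa> \<subseteq> Idl\<^bsub>class_ring\<^esub> {a * t | a t. a \<in> \<aa> \<and> t \<in> T}"
    using step by blast
  then show ?case using insert.IH insert.prems(1) by blast
qed

text \<open>
  Cauchy--Binet for \<open>A = A (B A)\<close> shows that the ideal of the minors is idempotent.
\<close>

lemma minors_vanish_of_nilpotent:
  fixes A :: "'a::comm_ring_1 mat"
  assumes A: "A \<in> carrier_mat m n" and B: "B \<in> carrier_mat n m" and ABA: "A * B * A = A"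
    and nil: "\<And>I J. I \<in> k_subsets k m \<Longrightarrow> J \<in> k_subsets k n \<Longrightarrow> \<exists>e. minor k A (pick I) (pick J) ^ e = 0"
  shows "minors_vanish k A"
proof -
  let ?T = "{minor k A (pick I) (pick J) | I J. I \<in> k_subsets k m \<and> J \<in> k_subsets k n}"
  let ?G = "{a * t | a t. a \<in> det_ideal k A \<and> t \<in> ?T}"
  have BA: "B * A \<in> carrier_mat n n" using A B by simp
  have ABA': "A * (B * A) = A" using ABA assoc_mult_mat[OF A B A] by simp
  have "det_ideal k A \<subseteq> Idl\<^bsub>class_ring\<^esub> ?G"
    unfolding det_ideal_pick[OF A]
  proof (rule Idl_mono_ideal[OF ideal_genideal], safe)
    fix I J assume I: "I \<in> k_subsets k m" and J: "J \<in> k_subsets k n"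
    have "minor k A (pick I) (pick J) = minor k (A * (B * A)) (pick I) (pick J)" unfolding ABA' ..
    also have "\<dots> = (\<Sum>H\<in>k_subsets k n. minor k A (pick I) (pick H) * (\<Sum>L\<in>k_subsets k m. minor k B (pick H) (pick L) * minor k A (pick L) (pick J)))"
      using minor_mult[OF A BA, of k "pick I" "pick J"] minor_mult[OF B A, of k _ "pick J"] pick_k_subset(5) I J by simp
    also have "\<dots> = (\<Sum>H\<in>k_subsets k n. \<Sum>L\<in>k_subsets k m. (minor k B (pick H) (pick L) * minor k A (pick I) (pick H)) * minor k A (pick L) (pick J))"
      by (simp add: sum_distrib_left mult_ac)
    also have "\<dots> \<in> Idl\<^bsub>class_ring\<^esub> {a * t | a t. a \<in> Idl\<^bsub>class_ring\<^esub> ?T \<and> t \<in> ?T}"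
    proof (intro ideal_sum[OF ideal_genideal])
      fix H L assume H: "H \<in> k_subsets k n" and L: "L \<in> k_subsets k m"
      have "minor k B (pick H) (pick L) * minor k A (pick I) (pick H) \<in> Idl\<^bsub>class_ring\<^esub> ?T"
        by (rule ideal_class_ringD(3)[OF ideal_genideal], rule subsetD[OF genideal_superset]) (use I H in blast)
      moreover have "minor k A (pick L) (pick J) \<in> ?T" using L J by blast
      ultimately show "minor k B (pick H) (pick L) * minor k A (pick I) (pick H) * minor k A (pick L) (pick J)
          \<in> Idl\<^bsub>class_ring\<^esub> {a * t | a t. a \<in> Idl\<^bsub>class_ring\<^esub> ?T \<and> t \<in> ?T}"
        by (intro subsetD[OF genideal_superset]) blast
    qed
    finally show "minor k A (pick I) (pick J) \<in> Idl\<^bsub>class_ring\<^esub> {a * t | a t. a \<in> Idl\<^bsub>class_ring\<^esub> ?T \<and> t \<in> ?T}" .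
  qed
  moreover have "?T = (\<lambda>(I, J). minor k A (pick I) (pick J)) ` (k_subsets k m \<times> k_subsets k n)" by auto
  then have "finite ?T" by simp
  ultimately have "det_ideal k A \<subseteq> {0}"
    using nil by (intro idempotent_ideal_nilpotent[OF ideal_det_ideal, of ?T]) auto
  then show ?thesis
    using ideal_class_ringD(1)[OF ideal_det_ideal, of k A] by (auto simp: det_ideal_zero_iff[symmetric])
qed

section \<open>Direct summands and projective ranges\<close>

lemma vec_unit_induct [consumes 1, case_names zero add]:
  fixes v :: "'a::comm_ring_1 vec"
  assumes v: "v \<in> carrier_vec n" and zero: "P (0\<^sub>v n)"
    and step: "\<And>w c j. w \<in> carrier_vec n \<Longrightarrow> j < n \<Longrightarrow> P w \<Longrightarrow> P (w + c \<cdot>\<^sub>v unit_vec n j)"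
  shows "P v"
proof -
  have "P (vec n (\<lambda>i. if i < s then v $ i else 0))" if "s \<le> n" for s
    using that
  proof (induction s)
    case 0
    have "vec n (\<lambda>i. if i < 0 then v $ i else 0) = 0\<^sub>v n" by (intro eq_vecI) auto
    then show ?case using zero by simp
  next
    case (Suc s)
    have "vec n (\<lambda>i. if i < Suc s then v $ i else 0) = vec n (\<lambda>i. if i < s then v $ i else 0) + (v $ s) \<cdot>\<^sub>v unit_vec n s"
      using Suc.prems by (intro eq_vecI) (auto simp: less_Suc_eq)
    then show ?case using Suc step[of "vec n (\<lambda>i. if i < s then v $ i else 0)" s "v $ s"] by simp
  qed
  from this[of n] have "P (vec n (\<lambda>i. if i < n then v $ i else 0))" by simp
  moreover have "vec n (\<lambda>i. if i < n then v $ i else 0) = v" using v by (intro eq_vecI) auto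
  ultimately show ?thesis by simp
qed

lemma linear_map_matrix:
  fixes h :: "'a::comm_ring_1 vec \<Rightarrow> 'a vec"
  assumes h: "\<And>v. v \<in> carrier_vec n \<Longrightarrow> h v \<in> carrier_vec m"
    and add: "\<And>v w. v \<in> carrier_vec n \<Longrightarrow> w \<in> carrier_vec n \<Longrightarrow> h (v + w) = h v + h w"
    and smult: "\<And>c v. v \<in> carrier_vec n \<Longrightarrow> h (c \<cdot>\<^sub>v v) = c \<cdot>\<^sub>v h v"
  obtains M where "M \<in> carrier_mat m n" "\<And>v. v \<in> carrier_vec n \<Longrightarrow> M *\<^sub>v v = h v"
proof -
  define M where "M = mat m n (\<lambda>(i, j). h (unit_vec n j) $ i)"
  have M: "M \<in> carrier_mat m n" by (simp add: M_def)
  have "M *\<^sub>v v = h v" if "v \<in> carrier_vec n" for v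
    using that
  proof (induction rule: vec_unit_induct)
    case zero
    have "0 \<cdot>\<^sub>v 0\<^sub>v n = (0\<^sub>v n :: 'a vec)" by (intro eq_vecI) auto
    then have "h (0\<^sub>v n) = 0 \<cdot>\<^sub>v h (0\<^sub>v n)" using smult[of "0\<^sub>v n" 0] by simp
    also have "\<dots> = 0\<^sub>v m" using h[of "0\<^sub>v n"] by (intro eq_vecI) auto
    finally show ?case using mult_mat_vec_zero[OF M] by simp
  next
    case (add w c j)
    have "M *\<^sub>v unit_vec n j = h (unit_vec n j)"
      using h[of "unit_vec n j"] add(2) by (intro eq_vecI) (auto simp: M_def scalar_prod_right_unit)
    then show ?case
      using add.hyps add.IH M mult_mat_vec_smult[OF M, of "unit_vec n j" c]
        by (simp add: mult_add_distrib_mat_vec assms(2) smult)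
  qed
  with M show ?thesis using that by blast
qed

lemma mat_eq_by_vec:
  fixes M N :: "'a::comm_ring_1 mat"
  assumes M: "M \<in> carrier_mat m n" and N: "N \<in> carrier_mat m n"
    and eq: "\<And>v. v \<in> carrier_vec n \<Longrightarrow> M *\<^sub>v v = N *\<^sub>v v"
  shows "M = N"
proof (rule eq_matI)
  fix i j assume ij: "i < dim_row N" "j < dim_col N"
  have "(M *\<^sub>v unit_vec n j) $ i = (N *\<^sub>v unit_vec n j) $ i" using eq[of "unit_vec n j"] by simp
  then show "M $$ (i, j) = N $$ (i, j)" using ij M N by (simp add: scalar_prod_right_unit)
qed (use M N in auto)

text \<open>
  Choose for each unit vector a preimage of its component in the range of \<open>A\<close>; these preimages are
  the columns of \<open>B\<close>. Then \<open>A B\<close> is the projection onto the range of \<open>A\<close>.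
\<close>

lemma direct_summand_quasi_inverse:
  fixes A :: "'a::comm_ring_1 mat"
  assumes A: "A \<in> carrier_mat m n" and ds: "is_direct_sum m (mat_range A) N"
  obtains B where "B \<in> carrier_mat n m" "A * B * A = A"
proof -
  have N: "submodule class_ring N (module_vec TYPE('a) m)" using ds by (simp add: is_direct_sum_def)
  note N' = N[unfolded submodule_vec_iff]
  note R' = submodule_mat_range[OF A, unfolded submodule_vec_iff]
  have "\<exists>v\<in>carrier_vec n. unit_vec m i - A *\<^sub>v v \<in> N" if "i < m" for i
  proof -
    have "unit_vec m i \<in> {x + y | x y. x \<in> mat_range A \<and> y \<in> N}" using ds
      by (simp add: is_direct_sum_def)
    then obtain v y where v: "v \<in> carrier_vec n" "y \<in> N" "unit_vec m i = A *\<^sub>v v + y" using A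
      by (auto simp: mat_range_def)
    then have "unit_vec m i - A *\<^sub>v v = y" using A N' by (intro eq_vecI) auto
    then show ?thesis by (intro bexI[OF _ v(1)]) (simp add: v(2))
  qed
  then obtain V where V: "\<And>i. i < m \<Longrightarrow> V i \<in> carrier_vec n" "\<And>i. i < m \<Longrightarrow> unit_vec m i - A *\<^sub>v V i \<in> N" by metis
  define B where "B = mat n m (\<lambda>(r, i). V i $ r)"
  have B: "B \<in> carrier_mat n m" by (simp add: B_def)
  have AB: "A * B \<in> carrier_mat m m" using A B by simp
  have BV: "B *\<^sub>v unit_vec m i = V i" if "i < m" for i
    using V(1)[OF that] that by (intro eq_vecI) (auto simp: B_def scalar_prod_right_unit)
  have in_N: "v - (A * B) *\<^sub>v v \<in> N" if "v \<in> carrier_vec m" for v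
    using that
  proof (induction rule: vec_unit_induct)
    case zero
    then show ?case using N' mult_mat_vec_zero[OF AB] by (simp del: assoc_mult_mat_vec)
  next
    case (add w c j)
    have u: "(A * B) *\<^sub>v unit_vec m j = A *\<^sub>v V j"
      using assoc_mult_mat_vec[OF A B, of "unit_vec m j"] BV[OF add(2)] by simp
    have AV: "A *\<^sub>v V j \<in> carrier_vec m" using A V(1)[OF add(2)] by simp
    have ABw: "(A * B) *\<^sub>v w \<in> carrier_vec m" using AB add(1) by (rule mult_mat_vec_carrier)
    have "(A * B) *\<^sub>v (w + c \<cdot>\<^sub>v unit_vec m j) = (A * B) *\<^sub>v w + c \<cdot>\<^sub>v (A *\<^sub>v V j)"
      using mult_add_distrib_mat_vec[OF AB add(1), of "c \<cdot>\<^sub>v unit_vec m j"] mult_mat_vec_smult[OF AB, of "unit_vec m j" c] u by simp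
    then have "w + c \<cdot>\<^sub>v unit_vec m j - (A * B) *\<^sub>v (w + c \<cdot>\<^sub>v unit_vec m j) =
        (w - (A * B) *\<^sub>v w) + c \<cdot>\<^sub>v (unit_vec m j - A *\<^sub>v V j)"
      using add(1) AV ABw carrier_vecD[OF AV] carrier_vecD[OF ABw]
      by (intro eq_vecI) (auto simp: right_diff_distrib simp del: assoc_mult_mat_vec)
    then show ?case using add(3) V(2)[OF add(2)] N' by metis
  qed
  have "A * B * A = A"
  proof (rule mat_eq_by_vec)
    show "A * B * A \<in> carrier_mat m n" "A \<in> carrier_mat m n" using A B by auto
    fix v :: "'a vec" assume v: "v \<in> carrier_vec n"
    have Av: "A *\<^sub>v v \<in> carrier_vec m" "A *\<^sub>v v \<in> mat_range A" using A v
      by (auto simp: mat_range_def)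
    have ABAv: "(A * B) *\<^sub>v (A *\<^sub>v v) = A *\<^sub>v (B *\<^sub>v (A *\<^sub>v v))"
      by (rule assoc_mult_mat_vec[OF A B Av(1)])
    have c: "(A * B) *\<^sub>v (A *\<^sub>v v) \<in> carrier_vec m" using AB Av(1)
      by (rule mult_mat_vec_carrier)
    have "(A * B) *\<^sub>v (A *\<^sub>v v) \<in> mat_range A" unfolding ABAv using A B v
      by (auto simp: mat_range_def)
    then have "A *\<^sub>v v + (-1) \<cdot>\<^sub>v ((A * B) *\<^sub>v (A *\<^sub>v v)) \<in> mat_range A"
      using R' Av(2) by blast
    moreover have "A *\<^sub>v v + (-1) \<cdot>\<^sub>v ((A * B) *\<^sub>v (A *\<^sub>v v)) = A *\<^sub>v v - (A * B) *\<^sub>v (A *\<^sub>v v)"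
      using Av(1) c by (intro eq_vecI) (auto simp del: assoc_mult_mat_vec)
    ultimately have "A *\<^sub>v v - (A * B) *\<^sub>v (A *\<^sub>v v) \<in> mat_range A \<inter> N"
      using in_N[OF Av(1)] by simp
    then have z: "A *\<^sub>v v - (A * B) *\<^sub>v (A *\<^sub>v v) = 0\<^sub>v m"
      using ds unfolding is_direct_sum_def by blast
    have "(A * B) *\<^sub>v (A *\<^sub>v v) = A *\<^sub>v v"
    proof (rule eq_vecI)
      fix i assume i: "i < dim_vec (A *\<^sub>v v)"
      then have "(A *\<^sub>v v - (A * B) *\<^sub>v (A *\<^sub>v v)) $ i = 0" using z A by simp
      then show "((A * B) *\<^sub>v (A *\<^sub>v v)) $ i = (A *\<^sub>v v) $ i" using i Av(1) c A
        by (simp del: index_mult_mat_vec assoc_mult_mat_vec)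
    qed (use c Av in auto)
    then show "A * B * A *\<^sub>v v = A *\<^sub>v v" using assoc_mult_mat_vec[OF AB A v] by simp
  qed
  with B show ?thesis using that by blast
qed

lemma quasi_inverse_mult_vec:
  fixes A :: "'a::comm_ring_1 mat"
  assumes A: "A \<in> carrier_mat m n" and B: "B \<in> carrier_mat n m" and ABA: "A * B * A = A" and x: "x \<in> mat_range A"
  shows "(A * B) *\<^sub>v x = x"
proof -
  obtain v where v: "v \<in> carrier_vec n" "x = A *\<^sub>v v" using x A by (auto simp: mat_range_def)
  then show ?thesis using assoc_mult_mat_vec[OF mult_carrier_mat[OF A B] A v(1)] ABA by simp
qed

lemma mat_range_mult_subset:
  fixes A :: "'a::comm_ring_1 mat"
  assumes A: "A \<in> carrier_mat m n" and B: "B \<in> carrier_mat n q" and v: "v \<in> carrier_vec q"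
  shows "(A * B) *\<^sub>v v \<in> mat_range A"
  using assoc_mult_mat_vec[OF A B v] A B v by (auto simp: mat_range_def)

lemma quasi_inverse_locally_simple:
  fixes A :: "'a::comm_ring_1 mat"
  assumes A: "A \<in> carrier_mat m n" and B: "B \<in> carrier_mat n m" and ABA: "A * B * A = A"
  shows "locally_simple A"
proof -
  have AB: "A * B \<in> carrier_mat m m" using A B by simp
  have "is_projection m (A * B) (mat_range A) (mat_kernel (A * B))"
  proof (rule is_projection_range_kernel[OF A AB AB])
    show "A * B *\<^sub>v (A *\<^sub>v v) = A *\<^sub>v v" if "v \<in> carrier_vec n" for v
      by (rule quasi_inverse_mult_vec[OF A B ABA]) (use A that in \<open>auto simp: mat_range_def\<close>)
  qed (use mat_range_mult_subset[OF A B] in auto)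
  then show ?thesis unfolding locally_simple_def is_projection_def using A by auto
qed

lemma det_ideal_quasi_inverse:
  fixes A :: "'a::comm_ring_1 mat"
  assumes A: "A \<in> carrier_mat m n" and B: "B \<in> carrier_mat n m" and ABA: "A * B * A = A"
  shows "det_ideal j (A * B) = det_ideal j A"
  using det_ideal_mult_right[OF A B, of j] det_ideal_mult_right[OF mult_carrier_mat[OF A B] A, of j] ABA by simp

lemma locally_simple_of_rank_iff:
  "locally_simple_of_rank k A \<longleftrightarrow> det_ideal k A = UNIV \<and> minors_vanish (Suc k) A"
proof
  assume *: "det_ideal k A = UNIV \<and> minors_vanish (Suc k) A"
  then obtain B where "B \<in> carrier_mat (dim_col A) (dim_row A)" "A * B * A = A"
    using quasi_inverse_exists[of k A "dim_row A" "dim_col A"] by auto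
  then have "locally_simple A" by (intro quasi_inverse_locally_simple[of A]) auto
  with * show "locally_simple_of_rank k A" by (simp add: locally_simple_of_rank_def det_ideal_zero_iff)
qed (auto simp: locally_simple_of_rank_def det_ideal_zero_iff)

text \<open>
  The range of \<open>A\<close> is the range of the idempotent matrix \<open>A B\<close>. A linear isomorphism between the
  ranges of two idempotent matrices \<open>P\<close> and \<open>F\<close> gives matrices with \<open>S T = P\<close> and \<open>T S = F\<close>, and
  then \<open>P = S F T\<close> and \<open>F = T P S\<close> have the same determinantal ideals. So the rank of the range
  does not depend on the idempotent matrix that presents it.
\<close>

theorem projective_range_iff:
  fixes A :: "'a::comm_ring_1 mat"
  assumes A: "A \<in> carrier_mat m n" and B: "B \<in> carrier_mat n m" and ABA: "A * B * A = A"
  shows "projective_of_rank k (mat_range A) \<longleftrightarrow> det_ideal k A = UNIV \<and> minors_vanish (Suc k) A"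
proof
  let ?P = "A * B"
  have P: "?P \<in> carrier_mat m m" using A B by simp
  have PP: "?P * ?P = ?P" using assoc_mult_mat[OF P A B] ABA by simp
  have range: "mat_range ?P = mat_range A"
  proof (intro subset_antisym subsetI)
    fix x assume "x \<in> mat_range ?P"
    then show "x \<in> mat_range A" using mat_range_mult_subset[OF A B] P by (auto simp: mat_range_def[of ?P])
  next
    fix x assume x: "x \<in> mat_range A"
    then have "x \<in> carrier_vec m" using A by (auto simp: mat_range_def)
    then show "x \<in> mat_range ?P"
      using quasi_inverse_mult_vec[OF A B ABA x] P by (auto simp: mat_range_def intro!: image_eqI[of _ _ x])
  qed
  note dP = det_ideal_quasi_inverse[OF A B ABA]
  show "projective_of_rank k (mat_range A)" if "det_ideal k A = UNIV \<and> minors_vanish (Suc k) A"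
    unfolding projective_of_rank_def
  proof (intro exI conjI)
    show "?P \<in> carrier_mat m m" "?P * ?P = ?P" by fact+
    show "det_ideal k ?P = UNIV" "det_ideal (Suc k) ?P = {0}" using that
      by (simp_all add: dP det_ideal_zero_iff)
    show "bij_betw (\<lambda>x. x) (mat_range A) (mat_range ?P)" unfolding range by (simp add: bij_betw_def)
  qed auto
  assume "projective_of_rank k (mat_range A)"
  then obtain r F \<theta> where F: "F \<in> carrier_mat r r" "F * F = F" "det_ideal k F = UNIV" "det_ideal (Suc k) F = {0}"
    and bij: "bij_betw \<theta> (mat_range A) (mat_range F)"
    and add: "\<And>x y. x \<in> mat_range A \<Longrightarrow> y \<in> mat_range A \<Longrightarrow> \<theta> (x + y) = \<theta> x + \<theta> y"
    and smult: "\<And>c x. x \<in> mat_range A \<Longrightarrow> \<theta> (c \<cdot>\<^sub>v x) = c \<cdot>\<^sub>v \<theta> x"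
    unfolding projective_of_rank_def by blast
  note RA = submodule_mat_range[OF A, unfolded submodule_vec_iff]
  note RF = submodule_mat_range[OF F(1), unfolded submodule_vec_iff]
  define \<eta> where "\<eta> = inv_into (mat_range A) \<theta>"
  have \<theta>: "\<theta> x \<in> mat_range F" if "x \<in> mat_range A" for x using bij that
    by (auto simp: bij_betw_def)
  have \<eta>: "\<eta> y \<in> mat_range A" "\<theta> (\<eta> y) = y" if "y \<in> mat_range F" for y
    using bij_betw_inv_into_right[OF bij that] bij_betwE[OF bij_betw_inv_into[OF bij]] that
      by (auto simp: \<eta>_def)
  have \<eta>\<theta>: "\<eta> (\<theta> x) = x" if "x \<in> mat_range A" for x
    unfolding \<eta>_def by (rule bij_betw_inv_into_left[OF bij that])
  have \<eta>_add: "\<eta> (x + y) = \<eta> x + \<eta> y"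
    if "x \<in> mat_range F" "y \<in> mat_range F" for x y
    using \<eta>\<theta>[of "\<eta> x + \<eta> y"] \<eta>[OF that(1)] \<eta>[OF that(2)] add RA by metis
  have \<eta>_smult: "\<eta> (c \<cdot>\<^sub>v x) = c \<cdot>\<^sub>v \<eta> x"
    if "x \<in> mat_range F" for c x
    using \<eta>\<theta>[of "c \<cdot>\<^sub>v \<eta> x"] \<eta>[OF that(1)] smult RA by metis
  have Pin: "?P *\<^sub>v v \<in> mat_range A"
    if "v \<in> carrier_vec m" for v using mat_range_mult_subset[OF A B that] .
  have Fin: "F *\<^sub>v v \<in> mat_range F" if "v \<in> carrier_vec r" for v using F(1) that
    by (auto simp: mat_range_def)
  have Ffix: "F *\<^sub>v x = x" if "x \<in> mat_range F" for x
  proof -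
    obtain v where "v \<in> carrier_vec r" "x = F *\<^sub>v v" using \<open>x \<in> mat_range F\<close> F(1)
      by (auto simp: mat_range_def)
    then show ?thesis using assoc_mult_mat_vec[OF F(1) F(1), of v] F(2) by simp
  qed
  obtain T where T: "T \<in> carrier_mat r m" "\<And>v. v \<in> carrier_vec m \<Longrightarrow> T *\<^sub>v v = \<theta> (?P *\<^sub>v v)"
  proof (rule linear_map_matrix[of m "\<lambda>v. \<theta> (?P *\<^sub>v v)" r])
    show "\<theta> (?P *\<^sub>v v) \<in> carrier_vec r"
      if "v \<in> carrier_vec m" for v using \<theta>[OF Pin[OF that]] RF by blast
    show "\<theta> (?P *\<^sub>v (v + w)) = \<theta> (?P *\<^sub>v v) + \<theta> (?P *\<^sub>v w)"
      if "v \<in> carrier_vec m" "w \<in> carrier_vec m" for v w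
      unfolding mult_add_distrib_mat_vec[OF P that] by (rule add[OF Pin[OF that(1)] Pin[OF that(2)]])
    show "\<theta> (?P *\<^sub>v (c \<cdot>\<^sub>v v)) = c \<cdot>\<^sub>v \<theta> (?P *\<^sub>v v)"
      if "v \<in> carrier_vec m" for c v
      unfolding mult_mat_vec_smult[OF P that] by (rule smult[OF Pin[OF that]])
  qed blast
  obtain S where S: "S \<in> carrier_mat m r" "\<And>v. v \<in> carrier_vec r \<Longrightarrow> S *\<^sub>v v = \<eta> (F *\<^sub>v v)"
  proof (rule linear_map_matrix[of r "\<lambda>v. \<eta> (F *\<^sub>v v)" m])
    show "\<eta> (F *\<^sub>v v) \<in> carrier_vec m"
      if "v \<in> carrier_vec r" for v using \<eta>(1)[OF Fin[OF that]] RA by blast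
    show "\<eta> (F *\<^sub>v (v + w)) = \<eta> (F *\<^sub>v v) + \<eta> (F *\<^sub>v w)"
      if "v \<in> carrier_vec r" "w \<in> carrier_vec r" for v w
      unfolding mult_add_distrib_mat_vec[OF F(1) that]
        by (rule \<eta>_add[OF Fin[OF that(1)] Fin[OF that(2)]])
    show "\<eta> (F *\<^sub>v (c \<cdot>\<^sub>v v)) = c \<cdot>\<^sub>v \<eta> (F *\<^sub>v v)"
      if "v \<in> carrier_vec r" for c v
      unfolding mult_mat_vec_smult[OF F(1) that] by (rule \<eta>_smult[OF Fin[OF that]])
  qed blast
  have ST: "S * T = ?P"
  proof (rule mat_eq_by_vec[OF mult_carrier_mat[OF S(1) T(1)] P])
    fix v :: "'a vec" assume v: "v \<in> carrier_vec m"
    have "T *\<^sub>v v \<in> carrier_vec r" using T(1) v by simp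
    then show "S * T *\<^sub>v v = ?P *\<^sub>v v"
      using assoc_mult_mat_vec[OF S(1) T(1) v] S(2) T(2)[OF v] Ffix[OF \<theta>[OF Pin[OF v]]] \<eta>\<theta>[OF Pin[OF v]] by simp
  qed
  have TS: "T * S = F"
  proof (rule mat_eq_by_vec[OF mult_carrier_mat[OF T(1) S(1)] F(1)])
    fix v :: "'a vec" assume v: "v \<in> carrier_vec r"
    have "S *\<^sub>v v \<in> carrier_vec m" using S(1) v by simp
    then show "T * S *\<^sub>v v = F *\<^sub>v v"
      using assoc_mult_mat_vec[OF T(1) S(1) v] T(2) S(2)[OF v] quasi_inverse_mult_vec[OF A B ABA \<eta>(1)[OF Fin[OF v]]] \<eta>(2)[OF Fin[OF v]] by simp
  qed
  \<comment> \<open>For an idempotent product, \<open>X Y = X (Y X) Y\<close>.\<close>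
  have conj: "det_ideal j (X * Y) \<subseteq> det_ideal j (Y * X)"
    if X: "X \<in> carrier_mat p q" and Y: "Y \<in> carrier_mat q p" and idem: "X * Y * (X * Y) = X * Y" for X Y :: "'a mat" and p q j
  proof -
    have "X * Y * (X * Y) = X * (Y * X) * Y"
      using assoc_mult_mat[of X p q Y p X q] assoc_mult_mat[of "X * Y" p p X q Y p] X Y by simp
    then have "det_ideal j (X * Y) = det_ideal j (X * (Y * X) * Y)" using idem by simp
    also have "\<dots> \<subseteq> det_ideal j (X * (Y * X))" using X Y
      by (intro det_ideal_mult_right[of _ p q]) auto
    also have "\<dots> \<subseteq> det_ideal j (Y * X)" using X Y
      by (intro det_ideal_mult_left[of _ p q]) auto
    finally show ?thesis .
  qed
  have "det_ideal j A = det_ideal j F" for j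
    using conj[OF S(1) T(1), of j] conj[OF T(1) S(1), of j] PP F(2) unfolding ST TS dP by blast
  then show "det_ideal k A = UNIV \<and> minors_vanish (Suc k) A" using F(3,4)
    by (simp add: det_ideal_zero_iff[symmetric])
qed

section \<open>Reduction to block form\<close>

text \<open>
  These matrices and their transposes provide all row and column operations of the reduction.
\<close>

definition identity_with_row :: "nat \<Rightarrow> nat \<Rightarrow> (nat \<Rightarrow> 'a::comm_ring_1) \<Rightarrow> 'a mat" where
  "identity_with_row n j r = mat n n (\<lambda>(a, b). if a = j then r b else if a = b then 1 else 0)"

text \<open>
  Invertibility in terms of the determinant, which is easier to establish for products and for the
  elementary matrices than an explicit inverse.
\<close>

definition unimodular :: "nat \<Rightarrow> 'a::comm_ring_1 mat \<Rightarrow> bool" where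
  "unimodular n U \<longleftrightarrow> U \<in> carrier_mat n n \<and> (\<exists>c. c * det U = 1)"

lemma unimodularD: "unimodular n U \<Longrightarrow> U \<in> carrier_mat n n"
  by (simp add: unimodular_def)

lemma unimodular_one: "unimodular n (1\<^sub>m n)"
  unfolding unimodular_def by (auto intro: exI[of _ 1])

lemma unimodular_mult:
  assumes "unimodular n U" "unimodular n V"
  shows "unimodular n (U * V)"
proof -
  obtain c d where "c * det U = 1" "d * det V = 1" using assms by (auto simp: unimodular_def)
  then have "(c * d) * (det U * det V) = 1" by (metis mult.assoc mult.left_commute mult_1_right)
  then show ?thesis using assms det_mult[of U n V] by (auto simp: unimodular_def)
qed

lemma unimodular_transpose: "unimodular n U \<Longrightarrow> unimodular n (transpose_mat U)"
  unfolding unimodular_def by (auto simp: det_transpose[of U n])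

lemma unimodular_inverse:
  assumes "unimodular n U"
  obtains V where "V \<in> carrier_mat n n" "U * V = 1\<^sub>m n" "V * U = 1\<^sub>m n" "unimodular n V"
proof -
  obtain c where c: "c * det U = 1" and U: "U \<in> carrier_mat n n" using assms
    by (auto simp: unimodular_def)
  let ?V = "c \<cdot>\<^sub>m adj_mat U"
  note a = adj_mat[OF U]
  have s: "c \<cdot>\<^sub>m (det U \<cdot>\<^sub>m 1\<^sub>m n) = 1\<^sub>m n" using c
    by (intro eq_matI) auto
  have V: "?V \<in> carrier_mat n n" using a by simp
  have UV: "U * ?V = 1\<^sub>m n" "?V * U = 1\<^sub>m n"
    using mult_smult_distrib[OF U a(1)] mult_smult_assoc_mat[OF a(1) U] a s by simp_all
  have "det U * det ?V = 1" using det_mult[OF U V] UV by simp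
  then have "unimodular n ?V" using V by (auto simp: unimodular_def)
  then show ?thesis using that V UV by blast
qed

lemma unimodular_imp_invertible:
  assumes "unimodular n U"
  shows "invertible_mat U"
proof -
  obtain V where "V \<in> carrier_mat n n" "U * V = 1\<^sub>m n" "V * U = 1\<^sub>m n"
    using unimodular_inverse[OF assms] by blast
  then show ?thesis
    unfolding invertible_mat_def inverts_mat_def using unimodularD[OF assms] by (auto intro: exI[of _ V])
qed

lemma identity_with_row_carrier [simp]: "identity_with_row n j r \<in> carrier_mat n n"
  by (simp add: identity_with_row_def)

lemma det_identity_with_row:
  assumes j: "j < n"
  shows "det (identity_with_row n j r) = r j"
proof -
  have "det (identity_with_row n j r) = (\<Sum>p | p permutes {0..<n}. signof p * (\<Prod>i = 0..<n. identity_with_row n j r $$ (i, p i)))"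
    by (rule det_def') simp
  also have "\<dots> = (\<Sum>p\<in>{id}. signof p * (\<Prod>i = 0..<n. identity_with_row n j r $$ (i, p i)))"
  proof (rule sum.mono_neutral_right)
    show "\<forall>p\<in>{p. p permutes {0..<n}} - {id}. signof p * (\<Prod>i = 0..<n. identity_with_row n j r $$ (i, p i)) = 0"
    proof
      fix p assume p: "p \<in> {p. p permutes {0..<n}} - {id}"
      have "\<exists>i<n. i \<noteq> j \<and> p i \<noteq> i"
      proof (rule ccontr)
        assume "\<not> ?thesis"
        then have "p i = i" if "i \<in> {0..<n} - {j}" for i using that by auto
        moreover have "p permutes {0..<n}" using p by blast
        ultimately have "p permutes {j}" by (metis permutes_superset)
        then show False using p by (simp add: permutes_sing)
      qed
      then obtain i where i: "i < n" "i \<noteq> j" "p i \<noteq> i" by blast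
      then have "p i < n" using p permutes_in_image[of p "{0..<n}" i] by auto
      then have "identity_with_row n j r $$ (i, p i) = 0" using i by (simp add: identity_with_row_def)
      then have "(\<Prod>i = 0..<n. identity_with_row n j r $$ (i, p i)) = 0" using i
        by (intro prod_zero bexI[of _ i]) auto
      then show "signof p * (\<Prod>i = 0..<n. identity_with_row n j r $$ (i, p i)) = 0" by simp
    qed
  qed (auto intro: finite_permutations permutes_id)
  also have "\<dots> = (\<Prod>i = 0..<n. if i = j then r j else 1)"
    by (simp add: identity_with_row_def cong: if_cong)
  also have "\<dots> = r j" using j by simp
  finally show ?thesis .
qed

lemma unimodular_identity_with_row:
  assumes "j < n" "c * r j = 1"
  shows "unimodular n (identity_with_row n j r)" "unimodular n (transpose_mat (identity_with_row n j r))"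
proof -
  show "unimodular n (identity_with_row n j r)" using assms
    by (auto simp: unimodular_def det_identity_with_row)
  then show "unimodular n (transpose_mat (identity_with_row n j r))" by (rule unimodular_transpose)
qed

lemma identity_with_row_mult:
  assumes B: "B \<in> carrier_mat m n" and "i < m" "c < n"
  shows "(identity_with_row m j r * B) $$ (i, c) = (if i = j then \<Sum>b<m. r b * B $$ (b, c) else B $$ (i, c))"
proof -
  have "(identity_with_row m j r * B) $$ (i, c) = (\<Sum>b<m. if i = j then r b * B $$ (b, c) else if i = b then B $$ (i, c) else 0)"
    unfolding index_mult_mat_sum[OF identity_with_row_carrier B assms(2,3)]
    using assms by (intro sum.cong) (auto simp: identity_with_row_def)
  then show ?thesis using assms by auto
qed

lemma mult_identity_with_row:
  assumes B: "B \<in> carrier_mat m n" and "i < m" "c < n" "j < n"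
  shows "(B * identity_with_row n j r) $$ (i, c) = (if c = j then 0 else B $$ (i, c)) + B $$ (i, j) * r c"
proof -
  have "(B * identity_with_row n j r) $$ (i, c) = (\<Sum>b<n. (if b = j then B $$ (i, j) * r c else 0) + (if b = c then if c = j then 0 else B $$ (i, c) else 0))"
    unfolding index_mult_mat_sum[OF B identity_with_row_carrier assms(2,3)]
    using assms by (intro sum.cong) (auto simp: identity_with_row_def)
  then show ?thesis using assms by (simp add: sum.distrib add.commute)
qed

lemma col_repl_mult:
  assumes B: "B \<in> carrier_mat m n" and "i < m" "c < n" "j < m"
  shows "(transpose_mat (identity_with_row m j l) * B) $$ (i, c) = (if i = j then 0 else B $$ (i, c)) + l i * B $$ (j, c)"
proof -
  have "transpose_mat (identity_with_row m j l) * B = transpose_mat (transpose_mat B * identity_with_row m j l)"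
    using B by (simp add: transpose_mult[of _ n m _ m])
  then show ?thesis using mult_identity_with_row[of "transpose_mat B" n m c i j l] assms carrier_matD[OF identity_with_row_carrier[of m j l]] by (simp add: mult.commute del: index_mult_mat(1))
qed

lemma mult_col_repl:
  assumes B: "B \<in> carrier_mat m n" and "i < m" "c < n"
  shows "(B * transpose_mat (identity_with_row n j y)) $$ (i, c) = (if c = j then \<Sum>b<n. B $$ (i, b) * y b else B $$ (i, c))"
proof -
  have "B * transpose_mat (identity_with_row n j y) = transpose_mat (identity_with_row n j y * transpose_mat B)"
    using B by (simp add: transpose_mult[of _ n n _ m])
  then show ?thesis using identity_with_row_mult[of "transpose_mat B" n m c i j y] assms carrier_matD[OF identity_with_row_carrier[of n j y]] by (simp add: mult.commute del: index_mult_mat(1))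
qed

text \<open>
  The shape \<open>diag (I\<^sub>j, A')\<close> after \<open>j\<close> pivots; the size of the matrix is kept during the reduction.
\<close>

definition block_form :: "nat \<Rightarrow> 'a::comm_ring_1 mat \<Rightarrow> bool" where
  "block_form j B \<longleftrightarrow> (\<forall>i<dim_row B. \<forall>c<dim_col B. i < j \<or> c < j \<longrightarrow> B $$ (i, c) = (if i = c then 1 else 0))"

text \<open>
  The operations \<open>P\<close> and \<open>Q\<close> put the given bilinear combination of the remaining entries, which is a unit,
  at position \<open>(j, j)\<close>. Then \<open>L\<close> normalizes this pivot and clears its column, and \<open>R\<close> clears its
  row. The first \<open>j\<close> rows and columns are not affected, since they are zero where the operations act.
\<close>

lemma block_form_step:
  fixes B :: "'a::comm_ring_1 mat"
  assumes B: "B \<in> carrier_mat m n" and jm: "j < m" and jn: "j < n" and form: "block_form j B"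
    and x: "x j = 1" and y: "y j = 1" and u: "u * (\<Sum>i\<in>{j..<m}. \<Sum>c\<in>{j..<n}. x i * B $$ (i, c) * y c) = 1"
  shows "\<exists>U V. unimodular m U \<and> unimodular n V \<and> block_form (Suc j) (U * B * V)"
proof -
  define P where "P = identity_with_row m j (\<lambda>b. if b < j then 0 else x b)"
  define Q where "Q = transpose_mat (identity_with_row n j (\<lambda>b. if b < j then 0 else y b))"
  have P: "unimodular m P" unfolding P_def using jm x
    by (intro unimodular_identity_with_row(1)[of _ _ 1]) auto
  have Q: "unimodular n Q" unfolding Q_def using jn y
    by (intro unimodular_identity_with_row(2)[of _ _ 1]) auto
  note Pc = unimodularD[OF P] and Qc = unimodularD[OF Q]
  have F: "B $$ (i, c) = (if i = c then 1 else 0)" if "i < m" "c < n" "i < j \<or> c < j" for i c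
    using form B that by (auto simp: block_form_def)
  have PB: "P * B \<in> carrier_mat m n" using Pc B by simp
  have PBi: "(P * B) $$ (i, c) = (if i = j then \<Sum>b\<in>{j..<m}. x b * B $$ (b, c) else B $$ (i, c))"
    if "i < m" "c < n" for i c
  proof -
    have "(\<Sum>b<m. (if b < j then 0 else x b) * B $$ (b, c)) = (\<Sum>b\<in>{j..<m}. x b * B $$ (b, c))"
      by (rule sum.mono_neutral_cong_right) auto
    then show ?thesis unfolding P_def identity_with_row_mult[OF B that] by simp
  qed
  define D where "D = P * B * Q"
  have D: "D \<in> carrier_mat m n" unfolding D_def using PB Qc by simp
  have Di: "D $$ (i, c) = (if c = j then \<Sum>b\<in>{j..<n}. (P * B) $$ (i, b) * y b else (P * B) $$ (i, c))" if "i < m" "c < n" for i c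
  proof -
    have "(\<Sum>b<n. (P * B) $$ (i, b) * (if b < j then 0 else y b)) = (\<Sum>b\<in>{j..<n}. (P * B) $$ (i, b) * y b)"
      by (rule sum.mono_neutral_cong_right) auto
    then show ?thesis unfolding D_def Q_def mult_col_repl[OF PB that] by simp
  qed
  have PBF: "(P * B) $$ (i, c) = (if i = c then 1 else 0)" if "i < m" "c < n" "i < j \<or> c < j" for i c
  proof (cases "i = j")
    case True
    then have "c < j" using that by auto
    then have "(\<Sum>b\<in>{j..<m}. x b * B $$ (b, c)) = 0" using F that by (intro sum.neutral) auto
    then show ?thesis using PBi[OF that(1,2)] True \<open>c < j\<close> by simp
  qed (use PBi[OF that(1,2)] F[OF that] in simp)
  have DF: "D $$ (i, c) = (if i = c then 1 else 0)" if "i < m" "c < n" "i < j \<or> c < j" for i c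
  proof (cases "c = j")
    case True
    then have "i < j" using that by auto
    then have "(\<Sum>b\<in>{j..<n}. (P * B) $$ (i, b) * y b) = 0" using PBF that by (intro sum.neutral) auto
    then show ?thesis using Di[OF that(1,2)] True \<open>i < j\<close> by simp
  qed (use Di[OF that(1,2)] PBF[OF that] in simp)
  have Djj: "u * D $$ (j, j) = 1"
  proof -
    have "D $$ (j, j) = (\<Sum>c\<in>{j..<n}. \<Sum>i\<in>{j..<m}. x i * B $$ (i, c) * y c)"
      unfolding Di[OF jm jn] using PBi[OF jm] by (simp add: sum_distrib_right)
    then show ?thesis using u by (subst (asm) sum.swap) simp
  qed
  define L where "L = transpose_mat (identity_with_row m j (\<lambda>a. if a = j then u else if a < j then 0 else - (D $$ (a, j) * u)))"
  define R where "R = identity_with_row n j (\<lambda>c. if c = j then 1 else if c < j then 0 else - (u * D $$ (j, c)))"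
  have L: "unimodular m L" unfolding L_def using jm Djj
    by (intro unimodular_identity_with_row(2)[of _ _ "D $$ (j, j)"]) (auto simp: mult.commute)
  have R: "unimodular n R" unfolding R_def using jn by (intro unimodular_identity_with_row(1)[of _ _ 1]) auto
  note Lc = unimodularD[OF L] and Rc = unimodularD[OF R]
  have LD: "L * D \<in> carrier_mat m n" using Lc D by simp
  have LDi: "(L * D) $$ (i, c) = (if i = j then u * D $$ (j, c) else if i < j then D $$ (i, c) else D $$ (i, c) - D $$ (i, j) * u * D $$ (j, c))"
    if "i < m" "c < n" for i c
    unfolding L_def col_repl_mult[OF D that jm] by auto
  have LDj: "(L * D) $$ (i, j) = (if i = j then 1 else 0)" if "i < m" for i
    unfolding LDi[OF that jn] using DF[OF that jn] Djj by (auto simp: mult.assoc)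
  have E: "(L * D * R) $$ (i, c) = (if i = c then 1 else 0)" if ic: "i < m" "c < n" "i < Suc j \<or> c < Suc j" for i c
  proof -
    have R1: "(L * D * R) $$ (i, c) = (if c = j then 0 else (L * D) $$ (i, c)) +
        (if i = j then 1 else 0) * (if c = j then 1 else if c < j then 0 else - (u * D $$ (j, c)))"
      unfolding R_def mult_identity_with_row[OF LD ic(1,2) jn] LDj[OF ic(1)] by simp
    consider "c = j" | "i = j" "c \<noteq> j" | "i < j" "c \<noteq> j" | "c < j" "i > j" using ic by linarith
    then show ?thesis
    proof cases
      case 1
      then show ?thesis using R1 by simp
    next
      case 2
      then show ?thesis using R1 LDi[OF ic(1,2)] DF[OF jm ic(2)] by (cases "c < j") auto
    next
      case 3
      then show ?thesis using R1 LDi[OF ic(1,2)] DF[OF ic(1,2)] by simp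
    next
      case 4
      then show ?thesis using R1 LDi[OF ic(1,2)] DF[OF ic(1,2)] DF[OF jm ic(2)] by simp
    qed
  qed
  have "(L * P) * B * (Q * R) = L * D * R"
    unfolding D_def using Lc Pc B Qc Rc
    by (simp add: assoc_mult_mat[of _ m m _ m _ n] assoc_mult_mat[of _ m n _ n _ n] assoc_mult_mat[of _ m m _ n _ n])
  then have "block_form (Suc j) ((L * P) * B * (Q * R))"
    using E D Lc Rc by (auto simp: block_form_def)
  then show ?thesis using unimodular_mult[OF L P] unimodular_mult[OF Q R] by blast
qed

lemma det_ideal_unimodular:
  assumes U: "unimodular m U" and V: "unimodular n V" and A: "A \<in> carrier_mat m n"
  shows "det_ideal k (U * A * V) = det_ideal k A"
proof -
  have le: "det_ideal k (U * A * V) \<subseteq> det_ideal k A"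
    if "U \<in> carrier_mat m m" "V \<in> carrier_mat n n" "A \<in> carrier_mat m n" for U V A :: "'a mat"
    using det_ideal_mult_right[of "U * A" m n V n k] det_ideal_mult_left[of U m m A n k] that by auto
  obtain U' where U': "U' \<in> carrier_mat m m" "U' * U = 1\<^sub>m m"
    using unimodular_inverse[OF U] by blast
  obtain V' where V': "V' \<in> carrier_mat n n" "V * V' = 1\<^sub>m n"
    using unimodular_inverse[OF V] by blast
  note Uc = unimodularD[OF U] and Vc = unimodularD[OF V]
  have "U' * (U * A * V) * V' = (U' * U) * A * (V * V')"
    using Uc Vc U'(1) V'(1) A
    by (simp add: assoc_mult_mat[of _ m m _ m _ n] assoc_mult_mat[of _ m n _ n _ n] assoc_mult_mat[of _ m m _ n _ n])
  then have "A = U' * (U * A * V) * V'" using U' V' A by simp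
  then have "det_ideal k A \<subseteq> det_ideal k (U * A * V)"
    using le[OF U'(1) V'(1), of "U * A * V"] A Uc Vc by simp
  then show ?thesis using le[OF Uc Vc A] by blast
qed

lemma minors_vanish_large_cols:
  assumes "A \<in> carrier_mat m n" "k > n"
  shows "minors_vanish k A"
  using minors_vanish_transpose[OF minors_vanish_large[of "transpose_mat A" n m k]] assms by simp

lemma det_ideal_UNIV_le:
  assumes "det_ideal k A = UNIV" "A \<in> carrier_mat m n"
  shows "k \<le> m" "k \<le> n"
proof -
  have "\<not> minors_vanish k A" using assms(1)
    by (simp add: det_ideal_zero_iff[symmetric]) (metis UNIV_I singletonD zero_neq_one)
  then show "k \<le> m" "k \<le> n"
    using minors_vanish_large[OF assms(2)] minors_vanish_large_cols[OF assms(2)] by (meson not_le)+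
qed

text \<open>
  A minor of order \<open>k > j\<close> that is not zero uses a row outside the identity block; expand along it.
\<close>

lemma block_form_remaining_entries:
  fixes B :: "'a::comm_ring_1 mat"
  assumes B: "B \<in> carrier_mat m n" and form: "block_form j B" and jk: "j < k"
  shows "det_ideal k B \<subseteq> Idl\<^bsub>class_ring\<^esub> {B $$ (i, c) | i c. i \<in> {j..<m} \<and> c \<in> {j..<n}}"
proof (rule det_ideal_subset[OF B ideal_genideal])
  let ?E = "Idl\<^bsub>class_ring\<^esub> {B $$ (i, c) | i c. i \<in> {j..<m} \<and> c \<in> {j..<n}}"
  fix f g assume f: "\<And>a. a < k \<Longrightarrow> f a < m" and g: "\<And>a. a < k \<Longrightarrow> g a < n"
  show "minor k B f g \<in> ?E"
  proof (cases "\<exists>a<k. f a \<ge> j")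
    case True
    then obtain a where a: "a < k" "f a \<ge> j" by blast
    have "B $$ (f a, g b) \<in> ?E" if "b < k" for b
    proof (cases "g b < j")
      case True
      then have "B $$ (f a, g b) = 0" using form B a f[of a] g[OF that] by (auto simp: block_form_def)
      then show ?thesis using ideal_class_ringD(1)[OF ideal_genideal] by simp
    next
      case False
      then show ?thesis using a f[of a] g[OF that]
        by (intro subsetD[OF genideal_superset] CollectI exI[of _ "f a"] exI[of _ "g b"]) auto
    qed
    then have "(\<Sum>b<k. B $$ (f a, g b) * cofactor (mat k k (\<lambda>(a, b). B $$ (f a, g b))) a b) \<in> ?E"
      by (intro ideal_sum[OF ideal_genideal], subst mult.commute) (simp add: ideal_class_ringD(3)[OF ideal_genideal] del: atLeastLessThan_iff)
    then show ?thesis using minor_row_expand[OF a(1), of B f "f a" g] by simp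
  next
    case False
    have "minor k B f g = 0"
    proof (rule ccontr)
      assume nz: "minor k B f g \<noteq> 0"
      have "inj_on f {..<k}" by (rule minor_sorted(1)[OF f g nz])
      moreover have "f ` {..<k} \<subseteq> {..<j}" using False by force
      ultimately have "card {..<k} \<le> card {..<j}" by (intro card_inj_on_le) auto
      then show False using jk by simp
    qed
    then show ?thesis using ideal_class_ringD(1)[OF ideal_genideal] by simp
  qed
qed

lemma block_form_full:
  fixes B :: "'a::comm_ring_1 mat"
  assumes B: "B \<in> carrier_mat m n" and form: "block_form k B" and van: "minors_vanish (Suc k) B" and k: "k \<le> m" "k \<le> n"
  shows "B = I_block k m n"
proof (rule eq_matI)
  fix i c assume "i < dim_row (I_block k m n)" "c < dim_col (I_block k m n)"
  then have ic: "i < m" "c < n" by (auto simp: I_block_def)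
  show "B $$ (i, c) = I_block k m n $$ (i, c)"
  proof (cases "i < k \<or> c < k")
    case True
    then show ?thesis using form ic B by (auto simp: block_form_def I_block_def)
  next
    case False
    let ?f = "id(k := i)" and ?g = "id(k := c)"
    have "mat (Suc k) (Suc k) (\<lambda>(a, b). B $$ (?f a, ?g b)) = identity_with_row (Suc k) k (\<lambda>b. if b = k then B $$ (i, c) else 0)"
      using form B ic k False by (intro eq_matI) (auto simp: identity_with_row_def block_form_def less_Suc_eq)
    then have "minor (Suc k) B ?f ?g = B $$ (i, c)" unfolding minor_def by (simp add: det_identity_with_row)
    moreover have "minor (Suc k) B ?f ?g = 0"
      using ic k by (intro minors_vanishD[OF van B]) auto
    ultimately show ?thesis using False ic by (simp add: I_block_def)
  qed
qed (use B in \<open>auto simp: I_block_def\<close>)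

text \<open>
  The last hypothesis is the only property of the ring that enters: a matrix whose entries
  generate the unit ideal represents a unit as a bilinear form, at vectors with first entry \<open>1\<close>.
\<close>

theorem simple_of_rankI:
  fixes A :: "'a::comm_ring_1 mat"
  assumes A: "A \<in> carrier_mat m n" and unit: "det_ideal k A = UNIV" and van: "minors_vanish (Suc k) A"
    and ur: "\<And>(B :: 'a mat) j. j < m \<Longrightarrow> j < n \<Longrightarrow> 1 \<in> Idl\<^bsub>class_ring\<^esub> {B $$ (i, c) | i c. i \<in> {j..<m} \<and> c \<in> {j..<n}} \<Longrightarrow>
      \<exists>x y u. x j = 1 \<and> y j = 1 \<and> u * (\<Sum>i\<in>{j..<m}. \<Sum>c\<in>{j..<n}. x i * B $$ (i, c) * y c) = 1"
  shows "simple_of_rank k A"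
proof -
  note k = det_ideal_UNIV_le[OF unit A]
  have "\<exists>U V. unimodular m U \<and> unimodular n V \<and> block_form j (U * A * V)"
    if "j \<le> k" for j
    using that
  proof (induction j)
    case 0
    then show ?case using unimodular_one
      by (intro exI[of _ "1\<^sub>m m"] exI[of _ "1\<^sub>m n"]) (auto simp: block_form_def)
  next
    case (Suc j)
    then obtain U V where UV: "unimodular m U" "unimodular n V" "block_form j (U * A * V)" by auto
    let ?B = "U * A * V"
    note Uc = unimodularD[OF UV(1)] and Vc = unimodularD[OF UV(2)]
    have B: "?B \<in> carrier_mat m n" using A Uc Vc by simp
    have j: "j < m" "j < n" "j < k" using Suc.prems k by auto
    have "det_ideal k ?B = UNIV" using det_ideal_unimodular[OF UV(1,2) A] unit by simp
    then have "1 \<in> Idl\<^bsub>class_ring\<^esub> {?B $$ (i, c) | i c. i \<in> {j..<m} \<and> c \<in> {j..<n}}"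
      using block_form_remaining_entries[OF B UV(3) j(3)] by blast
    then obtain x y u where "x j = 1" "y j = 1" "u * (\<Sum>i\<in>{j..<m}. \<Sum>c\<in>{j..<n}. x i * ?B $$ (i, c) * y c) = 1"
      using ur[OF j(1,2)] by blast
    then obtain U' V' where UV': "unimodular m U'" "unimodular n V'" "block_form (Suc j) (U' * ?B * V')"
      using block_form_step[OF B j(1,2) UV(3)] by blast
    note Uc' = unimodularD[OF UV'(1)] and Vc' = unimodularD[OF UV'(2)]
    have "U' * ?B * V' = (U' * U) * A * (V * V')"
      using Uc Vc Uc' Vc' A
      by (simp add: assoc_mult_mat[of _ m m _ m _ n] assoc_mult_mat[of _ m n _ n _ n] assoc_mult_mat[of _ m m _ n _ n])
    then show ?case using UV' unimodular_mult[OF UV'(1) UV(1)] unimodular_mult[OF UV(2) UV'(2)] by metis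
  qed
  then obtain U V where UV: "unimodular m U" "unimodular n V" "block_form k (U * A * V)" by blast
  note Uc = unimodularD[OF UV(1)] and Vc = unimodularD[OF UV(2)]
  have B: "U * A * V \<in> carrier_mat m n" using A Uc Vc by simp
  have "minors_vanish (Suc k) (U * A * V)"
    using det_ideal_unimodular[OF UV(1,2) A, of "Suc k"] van by (simp add: det_ideal_zero_iff[symmetric])
  then have eq: "U * A * V = I_block k m n" by (rule block_form_full[OF B UV(3) _ k])
  obtain U' where U': "U' \<in> carrier_mat m m" "U' * U = 1\<^sub>m m" "unimodular m U'"
    using unimodular_inverse[OF UV(1)] by blast
  obtain V' where V': "V' \<in> carrier_mat n n" "V * V' = 1\<^sub>m n" "unimodular n V'"
    using unimodular_inverse[OF UV(2)] by blast
  have "U' * (U * A * V) * V' = (U' * U) * A * (V * V')"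
    using Uc Vc U'(1) V'(1) A
    by (simp add: assoc_mult_mat[of _ m m _ m _ n] assoc_mult_mat[of _ m n _ n _ n] assoc_mult_mat[of _ m m _ n _ n])
  then have "A = U' * I_block k m n * V'" using U' V' A eq by simp
  then show ?thesis
    unfolding simple_of_rank_def using A k U' V' unimodular_imp_invertible[OF U'(3)] unimodular_imp_invertible[OF V'(3)] by auto
qed

lemma I_block_factor:
  assumes "k \<le> m" "k \<le> n"
  shows "(I_block k m n :: 'a::comm_ring_1 mat) = I_block k m k * I_block k k n"
proof (rule eq_matI)
  have c: "I_block k m k \<in> carrier_mat m k" "(I_block k k n :: 'a mat) \<in> carrier_mat k n"
    by (auto simp: I_block_def)
  fix i c assume "i < dim_row (I_block k m k * (I_block k k n :: 'a mat))" "c < dim_col (I_block k m k * (I_block k k n :: 'a mat))"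
  then have ic: "i < m" "c < n" by (auto simp: I_block_def)
  have "(I_block k m k * (I_block k k n :: 'a mat)) $$ (i, c) = (\<Sum>b<k. if b = i then (if i = c then 1 else 0) else 0)"
    unfolding index_mult_mat_sum[OF c ic] using ic by (intro sum.cong) (auto simp: I_block_def)
  then show "I_block k m n $$ (i, c) = (I_block k m k * (I_block k k n :: 'a mat)) $$ (i, c)"
    using ic by (auto simp: I_block_def)
qed (auto simp: I_block_def)

theorem simple_of_rankD:
  fixes A :: "'a::comm_ring_1 mat"
  assumes "simple_of_rank k A"
  shows "det_ideal k A = UNIV" "minors_vanish (Suc k) A"
proof -
  let ?m = "dim_row A" and ?n = "dim_col A"
  let ?I = "I_block k ?m ?n :: 'a mat"
  have A: "A \<in> carrier_mat ?m ?n" and I: "?I \<in> carrier_mat ?m ?n" by (auto simp: I_block_def)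
  obtain U V where k: "k \<le> ?m" "k \<le> ?n" and U: "U \<in> carrier_mat ?m ?m" and V: "V \<in> carrier_mat ?n ?n"
    and inv: "invertible_mat U" "invertible_mat V" and eq: "A = U * ?I * V"
    using assms by (auto simp: simple_of_rank_def)
  have uni: "unimodular r W" if W: "W \<in> carrier_mat r r" and "invertible_mat W" for r and W :: "'a mat"
  proof -
    obtain W' where W': "W * W' = 1\<^sub>m r" "W' * W = 1\<^sub>m (dim_row W')"
      using \<open>invertible_mat W\<close> W by (auto simp: invertible_mat_def inverts_mat_def)
    have "dim_col W' = r" using arg_cong[OF W'(1), of dim_col] by simp
    moreover have "dim_row W' = r" using arg_cong[OF W'(2), of dim_col] W by simp
    ultimately have "W' \<in> carrier_mat r r" by auto
    then have "det W * det W' = 1" using det_mult[OF W, of W'] W'(1) by simp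
    then show ?thesis using W by (auto simp: unimodular_def mult.commute)
  qed
  have d: "det_ideal j A = det_ideal j ?I" for j
    using det_ideal_unimodular[OF uni[OF U inv(1)] uni[OF V inv(2)] I, of j] eq by simp
  have "mat k k (\<lambda>(a, b). ?I $$ (id a, id b)) = 1\<^sub>m k"
    using k by (intro eq_matI) (auto simp: I_block_def)
  then have "minor k ?I id id = 1" by (simp add: minor_def)
  then have "1 \<in> det_ideal k ?I" using minor_in_det_ideal[OF I, of k id id] k by simp
  then show "det_ideal k A = UNIV" unfolding d ideal_eq_UNIV_iff[OF ideal_det_ideal] .
  have c: "I_block k ?m k \<in> carrier_mat ?m k" "(I_block k k ?n :: 'a mat) \<in> carrier_mat k ?n"
    by (auto simp: I_block_def)
  have "minors_vanish (Suc k) (I_block k k ?n :: 'a mat)" using minors_vanish_large[OF c(2)] by simp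
  then have "det_ideal (Suc k) ?I \<subseteq> {0}"
    using det_ideal_mult_left[OF c, of "Suc k"] unfolding I_block_factor[OF k, symmetric]
      by (simp add: det_ideal_zero_iff[symmetric])
  then show "minors_vanish (Suc k) A"
    using ideal_class_ringD(1)[OF ideal_det_ideal, of "Suc k" ?I] d[of "Suc k"]
      by (auto simp: det_ideal_zero_iff[symmetric])
qed

section \<open>Minors over the Nagata ring\<close>

interpretation nagata_of_poly: comm_ring_hom "nagata_of_poly :: 'a::comm_ring_1 poly \<Rightarrow> 'a nagata"
  by unfold_locales (simp_all add: nagata_of_poly_hom)

interpretation nagata_const: comm_ring_hom "nagata_const :: 'a::comm_ring_1 \<Rightarrow> 'a nagata"
proof
  fix x y :: 'a
  show "nagata_const (0::'a) = 0" by (simp add: nagata_const_def nagata_of_poly_hom)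
  show "nagata_const (1::'a) = 1" by (simp add: nagata_const_def nagata_of_poly_hom flip: one_pCons)
  show "nagata_const (x + y) = nagata_const x + nagata_const y"
    by (simp add: nagata_const_def flip: nagata_of_poly_hom)
  show "nagata_const (x * y) = nagata_const x * nagata_const y"
    by (simp add: nagata_const_def mult.commute flip: nagata_of_poly_hom)
qed

lemma nagata_const_eq_0_iff: "nagata_const x = 0 \<longleftrightarrow> x = 0"
  using nagata_of_poly_eq_iff[of "[:x:]" 0] by (simp add: nagata_const_def nagata_of_poly_hom)

lemma nagata_tpow_sum: "nagata_tpow (\<Sum>a\<in>S. e a) = (\<Prod>a\<in>S. nagata_tpow (e a))"
  by (induction S rule: infinite_finite_induct) (simp_all add: nagata_tpow_0 nagata_tpow_add)

lemma nagata_tpow_monom: "e \<ge> 0 \<Longrightarrow> nagata_tpow e * nagata_const c = nagata_of_poly (monom c (nat e))"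
  by (simp add: nagata_tpow_def nagata_const_def nagata_of_poly_def mult_nagata smult_monom monom_0
    flip: one_pCons)

lemma nagata_Fract_eq: "primitive q \<Longrightarrow> nagata_Fract p q = nagata_of_poly p * nagata_Fract 1 q"
  by (simp add: nagata_of_poly_def mult_nagata)

lemma over_nagata_carrier [simp]: "A \<in> carrier_mat m n \<Longrightarrow> over_nagata A \<in> carrier_mat m n"
  by (simp add: over_nagata_def)

lemma circ_mat_carrier [simp]: "A \<in> carrier_mat m n \<Longrightarrow> circ_mat A \<in> carrier_mat n m"
  by (simp add: circ_mat_index)

lemma minor_over_nagata:
  assumes A: "A \<in> carrier_mat m n" and f: "\<And>a. a < k \<Longrightarrow> f a < m" and g: "\<And>a. a < k \<Longrightarrow> g a < n"
  shows "minor k (over_nagata A) f g = nagata_const (minor k A f g)"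
proof -
  have "mat k k (\<lambda>(a, b). over_nagata A $$ (f a, g b)) = map_mat nagata_const (mat k k (\<lambda>(a, b). A $$ (f a, g b)))"
    using A f g by (intro eq_matI) (auto simp: over_nagata_def)
  then show ?thesis by (simp add: minor_def)
qed

text \<open>
  Row and column scalings contribute one monomial, which is the same for all terms of the Leibniz formula.
\<close>

lemma minor_circ_mat:
  assumes A: "A \<in> carrier_mat m n" and f: "\<And>a. a < k \<Longrightarrow> f a < m" and g: "\<And>a. a < k \<Longrightarrow> g a < n"
  shows "minor k (circ_mat A) g f = nagata_tpow ((\<Sum>a<k. int (f a)) - (\<Sum>a<k. int (g a))) * nagata_const (minor k A f g)"
proof -
  let ?w = "(\<Sum>a<k. int (f a)) - (\<Sum>a<k. int (g a))"
  have At: "transpose_mat A \<in> carrier_mat n m" using A by simp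
  have "minor k (circ_mat A) g f = (\<Sum>p | p permutes {..<k}. nagata_tpow ?w * nagata_const (signof p * (\<Prod>a<k. transpose_mat A $$ (g a, f (p a)))))"
    unfolding minor_leibniz
  proof (intro sum.cong refl)
    fix p assume "p \<in> {p. p permutes {..<k}}"
    then have p: "p permutes {..<k}" by simp
    have pk: "p a < k" if "a < k" for a using permutes_in_image[OF p, of a] that by simp
    have "(\<Prod>a<k. circ_mat A $$ (g a, f (p a))) =
        (\<Prod>a<k. nagata_tpow (int (f (p a)) - int (g a)) * nagata_const (transpose_mat A $$ (g a, f (p a))))"
      using A f g pk by (intro prod.cong) (auto simp: circ_mat_index[OF A])
    also have "\<dots> = nagata_tpow (\<Sum>a<k. int (f (p a)) - int (g a)) * nagata_const (\<Prod>a<k. transpose_mat A $$ (g a, f (p a)))"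
      by (simp add: prod.distrib nagata_tpow_sum nagata_const.hom_prod)
    also have "(\<Sum>a<k. int (f (p a)) - int (g a)) = ?w"
      using sum.permute[OF p, of "\<lambda>a. int (f a)"] by (simp add: sum_subtractf o_def)
    finally show "signof p * (\<Prod>a<k. circ_mat A $$ (g a, f (p a))) =
        nagata_tpow ?w * nagata_const (signof p * (\<Prod>a<k. transpose_mat A $$ (g a, f (p a))))"
      by (simp add: nagata_const.hom_mult mult_ac)
  qed
  also have "\<dots> = nagata_tpow ?w * nagata_const (minor k (transpose_mat A) g f)"
    by (simp add: minor_leibniz nagata_const.hom_sum sum_distrib_left)
  also have "minor k (transpose_mat A) g f = minor k A f g" by (rule minor_transpose[OF A f g])
  finally show ?thesis .
qed

lemma minors_vanish_over_nagata:
  assumes A: "A \<in> carrier_mat m n"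
  shows "minors_vanish k (over_nagata A) \<longleftrightarrow> minors_vanish k A"
proof -
  have d: "dim_row (over_nagata A) = m" "dim_col (over_nagata A) = n" "dim_row A = m" "dim_col A = n"
    using A carrier_matD[OF over_nagata_carrier[OF A]] by auto
  show ?thesis
    unfolding minors_vanish_def d using minor_over_nagata[OF A] nagata_const_eq_0_iff by metis
qed

lemma minors_vanish_circ_mat:
  assumes A: "A \<in> carrier_mat m n" and van: "minors_vanish k A"
  shows "minors_vanish k (circ_mat A)"
  unfolding minors_vanish_def
  using minor_circ_mat[OF A] minors_vanishD[OF van A] carrier_matD[OF circ_mat_carrier[OF A]]
  by (simp add: nagata_const_eq_0_iff)

text \<open>
  The extension of the ideal \<open>J\<close> to the Nagata ring, in the form of fractions with numerator in \<open>J[t]\<close>.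
\<close>

definition nagata_ext :: "'a::comm_ring_1 set \<Rightarrow> 'a nagata set" where
  "nagata_ext J = {nagata_Fract p q | p q. primitive q \<and> (\<forall>i. coeff p i \<in> J)}"

lemma coeff_mult_in_ideal:
  fixes J :: "'a::comm_ring_1 set"
  assumes J: "ideal J class_ring" and "\<And>i. coeff p i \<in> J"
  shows "coeff (r * p) i \<in> J"
  unfolding coeff_mult by (intro ideal_sum[OF J] ideal_class_ringD(3)[OF J] assms(2))

lemma ideal_nagata_ext:
  fixes J :: "'a::comm_ring_1 set"
  assumes J: "ideal J class_ring"
  shows "ideal (nagata_ext J) class_ring"
proof (rule ideal_class_ringI)
  show "0 \<in> nagata_ext J"
    unfolding nagata_ext_def Zero_nagata_def using ideal_class_ringD(1)[OF J]
    by (intro CollectI) (rule exI[of _ 0], rule exI[of _ 1], simp)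
next
  fix x y assume "x \<in> nagata_ext J" "y \<in> nagata_ext J"
  then obtain p q p' q' where x: "x = nagata_Fract p q" "primitive q" "\<And>i. coeff p i \<in> J"
    and y: "y = nagata_Fract p' q'" "primitive q'" "\<And>i. coeff p' i \<in> J"
    unfolding nagata_ext_def by blast
  have "coeff (p * q' + p' * q) i \<in> J" for i
    using coeff_mult_in_ideal[OF J x(3), of q' i] coeff_mult_in_ideal[OF J y(3), of q i] ideal_class_ringD(2)[OF J]
    by (simp add: mult.commute)
  then show "x + y \<in> nagata_ext J"
    unfolding x y add_nagata[OF x(2) y(2)] nagata_ext_def using primitive_mult[OF x(2) y(2)] by blast
next
  fix r x :: "'a nagata" assume "x \<in> nagata_ext J"
  then obtain p q where x: "x = nagata_Fract p q" "primitive q" "\<And>i. coeff p i \<in> J"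
    unfolding nagata_ext_def by blast
  obtain p' q' where r: "r = nagata_Fract p' q'" "primitive q'" by (rule nagata_cases)
  show "r * x \<in> nagata_ext J"
    unfolding x r mult_nagata[OF r(2) x(2)] nagata_ext_def
    using primitive_mult[OF r(2) x(2)] coeff_mult_in_ideal[OF J x(3), of p'] by blast
qed

text \<open>
  If \<open>1 = p / q\<close>, then \<open>p = q\<close> is primitive and has its coefficients in \<open>J\<close>.
\<close>

lemma one_in_nagata_ext:
  fixes J :: "'a::comm_ring_1 set"
  assumes J: "ideal J class_ring" and one: "1 \<in> nagata_ext J"
  shows "J = UNIV"
proof -
  obtain p q where pq: "1 = nagata_Fract p q" "primitive q" "\<And>i. coeff p i \<in> J"
    using one unfolding nagata_ext_def by blast
  then have "p = q" by (simp add: One_nagata_def eq_nagata)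
  then have "Idl\<^bsub>class_ring\<^esub> (range (coeff q)) \<subseteq> J" using pq(3)
    by (intro Idl_mono_ideal[OF J]) auto
  then show ?thesis using pq(2) by (auto simp: primitive_def)
qed

lemma det_ideal_over_nagata:
  fixes A :: "'a::comm_ring_1 mat"
  assumes A: "A \<in> carrier_mat m n"
  shows "det_ideal k (over_nagata A) = UNIV \<longleftrightarrow> det_ideal k A = UNIV"
proof
  assume *: "det_ideal k A = UNIV"
  note D = ideal_class_ringD[OF ideal_det_ideal[of k "over_nagata A"]]
  have "ideal {x. nagata_const x \<in> det_ideal k (over_nagata A)} class_ring"
    by (rule ideal_class_ringI) (auto simp: nagata_const.hom_add nagata_const.hom_mult intro: D)
  then have "det_ideal k A \<subseteq> {x. nagata_const x \<in> det_ideal k (over_nagata A)}"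
    by (rule det_ideal_subset[OF A])
      (use minor_over_nagata[OF A] minor_in_det_ideal[OF over_nagata_carrier[OF A]] in \<open>simp flip: minor_over_nagata[OF A]\<close>)
  then have "nagata_const (1::'a) \<in> det_ideal k (over_nagata A)" using * by blast
  then show "det_ideal k (over_nagata A) = UNIV" by (simp add: ideal_eq_UNIV_iff[OF ideal_det_ideal])
next
  assume *: "det_ideal k (over_nagata A) = UNIV"
  have "det_ideal k (over_nagata A) \<subseteq> nagata_ext (det_ideal k A)"
  proof (rule det_ideal_subset[OF over_nagata_carrier[OF A] ideal_nagata_ext[OF ideal_det_ideal]])
    fix f g assume f: "\<And>a. a < k \<Longrightarrow> f a < m" and g: "\<And>a. a < k \<Longrightarrow> g a < n"
    have "coeff [:minor k A f g:] i \<in> det_ideal k A" for i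
      using minor_in_det_ideal[OF A f g] ideal_class_ringD(1)[OF ideal_det_ideal] by (cases i) auto
    moreover have eq: "minor k (over_nagata A) f g = nagata_const (minor k A f g)"
      using minor_over_nagata[OF A, of k f g] f g by blast
    ultimately show "minor k (over_nagata A) f g \<in> nagata_ext (det_ideal k A)"
      unfolding eq nagata_const_def nagata_of_poly_def nagata_ext_def
      by (intro CollectI) (rule exI[of _ "[:minor k A f g:]"], rule exI[of _ 1], simp)
  qed
  then show "det_ideal k A = UNIV" using * by (intro one_in_nagata_ext[OF ideal_det_ideal]) auto
qed

section \<open>Units represented by matrices over the Nagata ring\<close>

lemma nagata_common_denominator:
  assumes "finite S"
  shows "\<exists>p q. primitive q \<and> (\<forall>s\<in>S. b s = nagata_Fract (p s) q)"
  using assms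
proof (induction S rule: finite_induct)
  case empty
  then show ?case by (auto intro: exI[of _ 1])
next
  case (insert s S)
  then obtain p q where pq: "primitive q" "\<And>t. t \<in> S \<Longrightarrow> b t = nagata_Fract (p t) q" by blast
  obtain a d where ad: "b s = nagata_Fract a d" "primitive d" by (rule nagata_cases)
  have "b t = nagata_Fract ((if t = s then a * q else p t * d)) (q * d)" if "t \<in> insert s S" for t
    using that pq ad by (cases "t = s") (auto simp: eq_nagata primitive_mult mult_ac)
  then show ?case
    using pq(1) ad(2)
      by (intro exI[of _ "\<lambda>t. if t = s then a * q else p t * d"] exI[of _ "q * d"]) (auto simp: primitive_mult)
qed

text \<open>
  Multiplication by the powers of \<open>t\<^sup>N\<close> moves the polynomials into disjoint ranges of exponents, so
  that the sum has exactly their coefficients.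
\<close>

lemma primitive_spread_sum:
  fixes p :: "'i \<Rightarrow> 'a::comm_ring_1 poly"
  assumes S: "finite S" and e: "inj_on e S" and N: "\<And>s. s \<in> S \<Longrightarrow> degree (p s) < N"
    and one: "Idl\<^bsub>class_ring\<^esub> (\<Union>s\<in>S. range (coeff (p s))) = UNIV"
  shows "primitive (\<Sum>s\<in>S. monom 1 (N * e s) * p s)"
proof -
  let ?F = "\<Sum>s\<in>S. monom 1 (N * e s) * p s"
  let ?J = "Idl\<^bsub>class_ring\<^esub> (range (coeff ?F))"
  have J: "ideal ?J class_ring" by (rule ideal_genideal)
  have "coeff (p s) d \<in> ?J" if s: "s \<in> S" for s d
  proof (cases "d < N")
    case True
    have "coeff ?F (N * e s + d) = (\<Sum>s'\<in>S. if s' = s then coeff (p s) d else 0)"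
      unfolding coeff_sum
    proof (intro sum.cong refl)
      fix s' assume s': "s' \<in> S"
      show "coeff (monom 1 (N * e s') * p s') (N * e s + d) = (if s' = s then coeff (p s) d else 0)"
      proof (cases "s' = s")
        case True
        then show ?thesis by (simp add: coeff_monom_mult)
      next
        case False
        then have "e s' \<noteq> e s" using e s s' by (auto simp: inj_on_def)
        then consider "e s' \<ge> Suc (e s)" | "e s \<ge> Suc (e s')" by linarith
        then show ?thesis
        proof cases
          case 1
          then have "N * Suc (e s) \<le> N * e s'" by (rule mult_le_mono2)
          then show ?thesis using \<open>d < N\<close> False by (simp add: coeff_monom_mult)
        next
          case 2
          then have "N * Suc (e s') \<le> N * e s" by (rule mult_le_mono2)
          then have "degree (p s') < N * e s + d - N * e s'" using N[OF s'] by simp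
          then show ?thesis using False by (simp add: coeff_monom_mult coeff_eq_0)
        qed
      qed
    qed
    also have "\<dots> = coeff (p s) d" using S s by simp
    finally have "coeff ?F (N * e s + d) = coeff (p s) d" .
    moreover have "coeff ?F (N * e s + d) \<in> ?J" by (rule subsetD[OF genideal_superset]) (rule rangeI)
    ultimately show ?thesis by (simp only:)
  next
    case False
    then have "coeff (p s) d = 0" using N[OF s] by (intro coeff_eq_0) simp
    then show ?thesis using ideal_class_ringD(1)[OF J] by simp
  qed
  then have "Idl\<^bsub>class_ring\<^esub> (\<Union>s\<in>S. range (coeff (p s))) \<subseteq> ?J"
    by (intro Idl_mono_ideal[OF J]) auto
  then show ?thesis using one by (auto simp: primitive_def)
qed

text \<open>
  After clearing denominators the entries are polynomials whose coefficients together generate the unit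
  ideal. Powers of \<open>t\<^sup>N\<close> with exponents \<open>(i - j) n\<close> for the rows and \<open>c - j\<close> for the columns
  number the entries injectively, as digits to the base \<open>n\<close>, so that the bilinear combination is a
  primitive polynomial over the common denominator.
\<close>

theorem nagata_bilinear_unit:
  fixes B :: "'a::comm_ring_1 nagata mat"
  assumes one: "1 \<in> Idl\<^bsub>class_ring\<^esub> {B $$ (i, c) | i c. i \<in> {j..<m} \<and> c \<in> {j..<n}}"
  shows "\<exists>x y u. x j = 1 \<and> y j = 1 \<and> u * (\<Sum>i\<in>{j..<m}. \<Sum>c\<in>{j..<n}. x i * B $$ (i, c) * y c) = 1"
proof -
  define S where "S = {j..<m} \<times> {j..<n}"
  have S: "finite S" by (simp add: S_def)
  obtain p q where q: "primitive q" and p: "\<And>s. s \<in> S \<Longrightarrow> B $$ s = nagata_Fract (p s) q"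
    using nagata_common_denominator[OF S, of "\<lambda>s. B $$ s"] by blast
  define J where "J = Idl\<^bsub>class_ring\<^esub> (\<Union>s\<in>S. range (coeff (p s)))"
  have J: "ideal J class_ring" unfolding J_def by (rule ideal_genideal)
  have "coeff (p s) d \<in> J" if "s \<in> S" for s d
    unfolding J_def using that by (intro subsetD[OF genideal_superset]) blast
  then have "B $$ s \<in> nagata_ext J" if "s \<in> S" for s
    unfolding nagata_ext_def p[OF that] using q that by blast
  then have "Idl\<^bsub>class_ring\<^esub> {B $$ (i, c) | i c. i \<in> {j..<m} \<and> c \<in> {j..<n}} \<subseteq> nagata_ext J"
    by (intro Idl_mono_ideal ideal_nagata_ext[OF J]) (auto simp: S_def)
  then have JU: "J = UNIV" using one by (intro one_in_nagata_ext[OF J]) auto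
  define N where "N = Suc (\<Sum>s\<in>S. degree (p s))"
  have N: "degree (p s) < N" if "s \<in> S" for s
    unfolding N_def using member_le_sum[OF that, of "\<lambda>s. degree (p s)"] S
      by (simp add: less_Suc_eq_le)
  define e where "e = (\<lambda>(i, c). (i - j) * n + (c - j))"
  have e: "inj_on e S"
  proof (rule inj_onI)
    fix s t assume st: "s \<in> S" "t \<in> S" "e s = e t"
    obtain i c i' c' where ic: "s = (i, c)" "t = (i', c')" by fastforce
    have lt: "c - j < n" "c' - j < n" using st ic by (auto simp: S_def)
    have eq: "(i - j) * n + (c - j) = (i' - j) * n + (c' - j)" using st(3) by (simp add: e_def ic)
    have "i - j = ((i - j) * n + (c - j)) div n" "i' - j = ((i' - j) * n + (c' - j)) div n"
      using lt by simp_all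
    then have 1: "i - j = i' - j" using eq by simp
    then have "c - j = c' - j" using eq by simp
    with 1 show "s = t" using st(1,2) by (auto simp: ic S_def)
  qed
  define F where "F = (\<Sum>s\<in>S. monom 1 (N * e s) * p s)"
  have F: "primitive F" unfolding F_def by (rule primitive_spread_sum[OF S e N]) (use JU J_def in auto)
  define x where "x = (\<lambda>i. nagata_of_poly (monom 1 (N * ((i - j) * n))) :: 'a nagata)"
  define y where "y = (\<lambda>c. nagata_of_poly (monom 1 (N * (c - j))) :: 'a nagata)"
  have "(\<Sum>i\<in>{j..<m}. \<Sum>c\<in>{j..<n}. x i * B $$ (i, c) * y c) = (\<Sum>(i, c)\<in>S. x i * B $$ (i, c) * y c)"
    unfolding S_def by (rule sum.cartesian_product)
  also have "\<dots> = (\<Sum>s\<in>S. nagata_of_poly (monom 1 (N * e s) * p s) * nagata_Fract 1 q)"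
  proof (intro sum.cong refl)
    fix s assume s: "s \<in> S"
    obtain i c where ic: "s = (i, c)" by (cases s)
    have "B $$ (i, c) = nagata_of_poly (p s) * nagata_Fract 1 q"
      using p[OF s] nagata_Fract_eq[OF q, of "p s"] ic by simp
    then have "x i * B $$ (i, c) * y c = nagata_of_poly (monom 1 (N * ((i - j) * n)) * monom 1 (N * (c - j)) * p s) * nagata_Fract 1 q"
      by (simp add: x_def y_def nagata_of_poly_hom mult_ac)
    also have "monom 1 (N * ((i - j) * n)) * monom (1::'a) (N * (c - j)) = monom 1 (N * e s)"
      by (simp add: mult_monom e_def ic distrib_left)
    finally show "(case s of (i, c) \<Rightarrow> x i * B $$ (i, c) * y c) = nagata_of_poly (monom 1 (N * e s) * p s) * nagata_Fract 1 q"
      by (simp add: ic)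
  qed
  also have "\<dots> = nagata_of_poly F * nagata_Fract 1 q"
    unfolding F_def nagata_of_poly.hom_sum by (simp add: sum_distrib_right)
  finally have "nagata_Fract q F * (\<Sum>i\<in>{j..<m}. \<Sum>c\<in>{j..<n}. x i * B $$ (i, c) * y c) = 1"
    using q F by (simp add: nagata_of_poly_def mult_nagata One_nagata_def eq_nagata primitive_mult mult_ac)
  moreover have "x j = 1" "y j = 1" by (simp_all add: x_def y_def monom_0 nagata_of_poly_hom flip: one_pCons)
  ultimately show ?thesis by blast
qed

section \<open>The Gram polynomial of a matrix and its twisted transpose\<close>

text \<open>
  The polynomial \<open>t\<^bsup>k(n-k)\<^esup> g\<^sub>k\<close>. The exponents are nonnegative by \<open>weight_diff_bound\<close>, so that
  truncation by \<open>nat\<close> does not identify different weights.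
\<close>

definition gram_numerator :: "nat \<Rightarrow> 'a::comm_ring_1 mat \<Rightarrow> 'a poly" where
  "gram_numerator k A = (\<Sum>(I, J)\<in>k_subsets k (dim_row A) \<times> k_subsets k (dim_col A).
     monom (minor k A (pick I) (pick J) ^ 2) (nat (int k * (int (dim_col A) - int k) + (weight I - weight J))))"

text \<open>
  The element of \<open>I\<close> at position \<open>a\<close> is at least \<open>a\<close>, and the element of \<open>J\<close> at position \<open>a\<close> is at most
  \<open>n - k + a\<close>.
\<close>

lemma weight_diff_bound:
  assumes I: "I \<in> k_subsets k m" and J: "J \<in> k_subsets k n"
  shows "int k * (int n - int k) + (weight I - weight J) \<ge> 0"
proof -
  have "int (pick J a) \<le> (int n - int k) + int (pick I a)" if a: "a < k" for a
  proof -
    have cI: "card I = k" and cJ: "card J = k" and Jn: "J \<subseteq> {..<n}" using I J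
      by (auto simp: k_subsets_def)
    have "card {x \<in> I. x < pick I a} = a" using a cI by (intro card_pick_le) simp
    moreover have "card {x \<in> I. x < pick I a} \<le> card {..<pick I a}" by (rule card_mono) auto
    ultimately have 1: "a \<le> pick I a" by simp
    have 2: "card {x \<in> J. x < pick J a} = a" using a cJ by (intro card_pick_le) simp
    have finJ: "finite J" using Jn finite_subset by blast
    have "J = {x \<in> J. x < pick J a} \<union> {x \<in> J. pick J a \<le> x}" by auto
    then have "k = card {x \<in> J. x < pick J a} + card {x \<in> J. pick J a \<le> x}"
      using cJ finJ by (metis (no_types, lifting) card_Un_disjoint disjoint_iff finite_Un leD mem_Collect_eq)
    moreover have "card {x \<in> J. pick J a \<le> x} \<le> card {pick J a..<n}" using Jn
      by (intro card_mono) auto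
    ultimately have "k \<le> a + (n - pick J a)" using 2 by simp
    moreover have "pick J a < n" using pick_k_subset(5)[OF J a] .
    ultimately show ?thesis using 1 by linarith
  qed
  then have "(\<Sum>a<k. int (pick J a)) \<le> (\<Sum>a<k. (int n - int k) + int (pick I a))"
    by (intro sum_mono) auto
  then show ?thesis unfolding weight_pick[OF I] weight_pick[OF J] by (simp add: sum.distrib)
qed

theorem gram_coeff_circ:
  fixes A :: "'a::comm_ring_1 mat"
  assumes A: "A \<in> carrier_mat m n"
  shows "nagata_tpow (int k * (int n - int k)) * gram_coeff (over_nagata A) (circ_mat A) k = nagata_of_poly (gram_numerator k A)"
proof -
  let ?e = "int k * (int n - int k)"
  have d: "dim_row A = m" "dim_col A = n" using A by auto
  have "nagata_tpow ?e * (minor k (over_nagata A) (pick I) (pick J) * minor k (circ_mat A) (pick J) (pick I)) =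
      nagata_of_poly (monom (minor k A (pick I) (pick J) ^ 2) (nat (?e + (weight I - weight J))))"
    if I: "I \<in> k_subsets k m" and J: "J \<in> k_subsets k n" for I J
  proof -
    let ?\<mu> = "minor k A (pick I) (pick J)"
    have "minor k (over_nagata A) (pick I) (pick J) = nagata_const ?\<mu>"
      using pick_k_subset(5)[OF I] pick_k_subset(5)[OF J] by (intro minor_over_nagata[OF A]) auto
    moreover have "minor k (circ_mat A) (pick J) (pick I) = nagata_tpow (weight I - weight J) * nagata_const ?\<mu>"
      unfolding weight_pick[OF I] weight_pick[OF J]
      using pick_k_subset(5)[OF I] pick_k_subset(5)[OF J] by (intro minor_circ_mat[OF A]) auto
    ultimately have "nagata_tpow ?e * (minor k (over_nagata A) (pick I) (pick J) * minor k (circ_mat A) (pick J) (pick I)) =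
        nagata_tpow (?e + (weight I - weight J)) * nagata_const (?\<mu> ^ 2)"
      by (simp add: nagata_tpow_add[of ?e] nagata_const.hom_mult power2_eq_square mult_ac)
    then show ?thesis using nagata_tpow_monom[OF weight_diff_bound[OF I J]] by simp
  qed
  then show ?thesis
    unfolding gram_coeff_minors[OF over_nagata_carrier[OF A] circ_mat_carrier[OF A]] gram_numerator_def d
    by (auto simp: sum_distrib_left nagata_of_poly.hom_sum sum.cartesian_product intro!: sum.cong)
qed

text \<open>
  The sum over one weight is a coefficient of the numerator, or it is empty.
\<close>

lemma gram_numerator_sums_of_squares:
  assumes A: "A \<in> carrier_mat m n" and J: "ideal \<aa> class_ring" and c: "\<And>e. coeff (gram_numerator k A) e \<in> \<aa>"
  shows "(\<Sum>(I, J)\<in>{(I, J) \<in> k_subsets k m \<times> k_subsets k n. weight I - weight J = w}. minor k A (pick I) (pick J) ^ 2) \<in> \<aa>"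
proof (cases "int k * (int n - int k) + w \<ge> 0")
  case True
  have d: "dim_row A = m" "dim_col A = n" using A by auto
  have "coeff (gram_numerator k A) (nat (int k * (int n - int k) + w)) =
    (\<Sum>(I, J)\<in>k_subsets k m \<times> k_subsets k n. if weight I - weight J = w then minor k A (pick I) (pick J) ^ 2 else 0)"
    unfolding gram_numerator_def d coeff_sum
  proof (intro sum.cong refl)
    fix s assume "s \<in> k_subsets k m \<times> k_subsets k n"
    then obtain I J where s: "s = (I, J)" "I \<in> k_subsets k m" "J \<in> k_subsets k n" by blast
    then show "coeff (case s of (I, J) \<Rightarrow> monom (minor k A (pick I) (pick J) ^ 2) (nat (int k * (int n - int k) + (weight I - weight J))))
        (nat (int k * (int n - int k) + w)) = (case s of (I, J) \<Rightarrow> if weight I - weight J = w then minor k A (pick I) (pick J) ^ 2 else 0)"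
      using weight_diff_bound[OF s(2,3)] True by (auto simp: eq_nat_nat_iff)
  qed
  also have "\<dots> = (\<Sum>(I, J)\<in>{(I, J) \<in> k_subsets k m \<times> k_subsets k n. weight I - weight J = w}. minor k A (pick I) (pick J) ^ 2)"
    by (rule sum.mono_neutral_cong_right) (auto split: if_splits)
  finally show ?thesis using c by metis
next
  case False
  then have empty: "{(I, J) \<in> k_subsets k m \<times> k_subsets k n. weight I - weight J = w} = {}"
    using weight_diff_bound[of _ k m _ n] by auto
  show ?thesis unfolding empty using ideal_class_ringD(1)[OF J] by simp
qed

lemma minors_in_radical_gram_numerator:
  assumes van: "minors_vanish (Suc k) A" and A: "A \<in> carrier_mat m n" and J: "ideal \<aa> class_ring"
    and c: "\<And>e. coeff (gram_numerator k A) e \<in> \<aa>"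
    and f: "\<And>a. a < k \<Longrightarrow> f a < m" and g: "\<And>a. a < k \<Longrightarrow> g a < n"
  shows "minor k A f g \<in> radical \<aa>"
  by (rule minors_in_radical[OF van A J gram_numerator_sums_of_squares[OF A J c] f g])

lemma det_ideal_UNIV_of_primitive:
  assumes A: "A \<in> carrier_mat m n" and "primitive (gram_numerator k A)"
  shows "det_ideal k A = UNIV"
proof -
  note D = ideal_class_ringD[OF ideal_det_ideal[of k A]]
  have "coeff (gram_numerator k A) e \<in> det_ideal k A" for e
    unfolding gram_numerator_def coeff_sum
  proof (rule ideal_sum[OF ideal_det_ideal])
    fix s assume "s \<in> k_subsets k (dim_row A) \<times> k_subsets k (dim_col A)"
    then obtain I J where s: "s = (I, J)" "I \<in> k_subsets k m" "J \<in> k_subsets k n" using A by auto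
    have "minor k A (pick I) (pick J) \<in> det_ideal k A"
      using pick_k_subset(5)[OF s(2)] pick_k_subset(5)[OF s(3)] by (intro minor_in_det_ideal[OF A]) auto
    then have "minor k A (pick I) (pick J) ^ 2 \<in> det_ideal k A" unfolding power2_eq_square by (rule D(3))
    then show "coeff (case s of (I, J) \<Rightarrow> monom (minor k A (pick I) (pick J) ^ 2)
        (nat (int k * (int (dim_col A) - int k) + (weight I - weight J)))) e \<in> det_ideal k A"
      using D(1) s by simp
  qed
  then have "Idl\<^bsub>class_ring\<^esub> (range (coeff (gram_numerator k A))) \<subseteq> det_ideal k A"
    by (intro Idl_mono_ideal ideal_det_ideal) auto
  then show ?thesis using assms(2) by (auto simp: primitive_def)
qed

text \<open>
  From right to left: the ideal of the coefficients has a radical that contains all minors of order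
  \<open>k\<close>, hence \<open>1\<close>, and then the ideal itself contains \<open>1\<close>.
\<close>

theorem primitive_gram_numerator_iff:
  assumes van: "minors_vanish (Suc k) A" and A: "A \<in> carrier_mat m n"
  shows "primitive (gram_numerator k A) \<longleftrightarrow> det_ideal k A = UNIV"
proof
  assume *: "det_ideal k A = UNIV"
  let ?\<aa> = "Idl\<^bsub>class_ring\<^esub> (range (coeff (gram_numerator k A)))"
  have "coeff (gram_numerator k A) e \<in> ?\<aa>" for e by (rule subsetD[OF genideal_superset]) simp
  then have "det_ideal k A \<subseteq> radical ?\<aa>"
    by (intro det_ideal_subset[OF A ideal_radical[OF ideal_genideal]] minors_in_radical_gram_numerator[OF van A ideal_genideal]) auto
  then have "1 \<in> radical ?\<aa>" using * by blast
  then have "1 \<in> ?\<aa>" by (simp add: radical_def)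
  then show "primitive (gram_numerator k A)" unfolding primitive_def ideal_eq_UNIV_iff[OF ideal_genideal] .
qed (rule det_ideal_UNIV_of_primitive[OF A])

lemma minor_nilpotent_of_gram_coeff:
  assumes van: "minors_vanish (Suc l) A" and A: "A \<in> carrier_mat m n"
    and "gram_coeff (over_nagata A) (circ_mat A) l = 0"
    and f: "\<And>a. a < l \<Longrightarrow> f a < m" and g: "\<And>a. a < l \<Longrightarrow> g a < n"
  shows "\<exists>e. minor l A f g ^ e = 0"
proof -
  have "nagata_of_poly (gram_numerator l A) = nagata_of_poly 0"
    using gram_coeff_circ[OF A, of l] assms(3) by (simp add: nagata_of_poly_hom)
  then have "gram_numerator l A = 0" by (simp only: nagata_of_poly_eq_iff)
  then have "minor l A f g \<in> radical {0}"
    by (intro minors_in_radical_gram_numerator[OF van A ideal_zero _ f g]) auto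
  then show ?thesis by (simp add: radical_def)
qed

text \<open>
  Downward induction from the orders that exceed the number of rows.
\<close>

lemma minors_vanish_descend:
  assumes A: "A \<in> carrier_mat m n"
    and step: "\<And>l. l > k \<Longrightarrow> minors_vanish (Suc l) A \<Longrightarrow> minors_vanish l A"
  shows "minors_vanish (Suc k) A"
proof (cases "Suc k \<le> Suc m")
  case True
  then show ?thesis
    by (induction rule: inc_induct) (use minors_vanish_large[OF A] step in auto)
qed (rule minors_vanish_large[OF A], simp)

text \<open>
  The quasi-inverse \<open>B\<close> need only exist over the Nagata ring, where it makes the ideal of the minors
  idempotent; the nilpotency of the minors comes from the base ring.
\<close>

lemma minors_vanish_of_degree_regular:
  fixes A :: "'a::comm_ring_1 mat"
  assumes A: "A \<in> carrier_mat m n" and deg: "\<And>l. l > k \<Longrightarrow> gram_coeff (over_nagata A) (circ_mat A) l = 0"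
    and B: "B \<in> carrier_mat n m" "over_nagata A * B * over_nagata A = over_nagata A"
  shows "minors_vanish (Suc k) A"
proof (rule minors_vanish_descend[OF A])
  fix l assume l: "l > k" and van: "minors_vanish (Suc l) A"
  have "minors_vanish l (over_nagata A)"
  proof (rule minors_vanish_of_nilpotent[OF over_nagata_carrier[OF A] B])
    fix I J assume I: "I \<in> k_subsets l m" and J: "J \<in> k_subsets l n"
    obtain e where "minor l A (pick I) (pick J) ^ e = 0"
      using minor_nilpotent_of_gram_coeff[OF van A deg[OF l]] pick_k_subset(5)[OF I] pick_k_subset(5)[OF J] by blast
    moreover have "minor l (over_nagata A) (pick I) (pick J) = nagata_const (minor l A (pick I) (pick J))"
      using pick_k_subset(5)[OF I] pick_k_subset(5)[OF J] by (intro minor_over_nagata[OF A]) auto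
    ultimately show "\<exists>e. minor l (over_nagata A) (pick I) (pick J) ^ e = 0"
      by (metis nagata_const.hom_power nagata_const.hom_zero)
  qed
  then show "minors_vanish l A" by (simp add: minors_vanish_over_nagata[OF A])
qed

lemma minors_vanish_of_degree_reduced:
  fixes A :: "'a::comm_ring_1 mat"
  assumes A: "A \<in> carrier_mat m n" and deg: "\<And>l. l > k \<Longrightarrow> gram_coeff (over_nagata A) (circ_mat A) l = 0"
    and red: "\<And>(x::'a) e. x ^ e = 0 \<Longrightarrow> x = 0"
  shows "minors_vanish (Suc k) A"
proof (rule minors_vanish_descend[OF A])
  fix l assume l: "l > k" and van: "minors_vanish (Suc l) A"
  show "minors_vanish l A"
    unfolding minors_vanish_def using minor_nilpotent_of_gram_coeff[OF van A deg[OF l]] red A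
      by (metis carrier_matD)
qed

section \<open>The equivalences\<close>

text \<open>
  Each condition is compared with \<open>D\<close>: the minors of order \<open>k\<close> generate the unit ideal and
  those of order \<open>k + 1\<close> vanish.
\<close>

theorem mainTheorem4:
  fixes A :: "'a::comm_ring_1 mat" and m n k :: nat
  assumes "A \<in> carrier_mat m n"
  shows
    "let A\<^sub>t = over_nagata A;
         A\<^sub>o = circ_mat A;
         g = gram_coeff A\<^sub>t A\<^sub>o;
         Adj = Adj_cross k A\<^sub>t A\<^sub>o;
         deg_cond = (degree (gram_poly A\<^sub>t A\<^sub>o) \<le> k);
         prim_cond = is_primitive_poly_in_nagata (nagata_tpow (int k * (int n - int k)) * g k);
         c1 = locally_simple_of_rank k A;
         c2 = locally_simple_of_rank k A\<^sub>t;
         c3 = simple_of_rank k A\<^sub>t;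
         c4 = (rank_le k A \<and> prim_cond);
         c5 = crossed_of_rank k A\<^sub>t A\<^sub>o;
         c6 = (crossed A\<^sub>t A\<^sub>o \<and> deg_cond \<and> prim_cond);
         c7 = (deg_cond \<and> prim_cond \<and> A\<^sub>t * Adj * A\<^sub>t = g k \<cdot>\<^sub>m A\<^sub>t)
     in (c1 \<longleftrightarrow> c2) \<and> (c1 \<longleftrightarrow> c3) \<and> (c1 \<longleftrightarrow> c4) \<and> (c1 \<longleftrightarrow> c5) \<and> (c1 \<longleftrightarrow> c6) \<and> (c1 \<longleftrightarrow> c7) \<and>
        ((\<forall>(x::'a) e. x ^ e = 0 \<longrightarrow> x = 0) \<longrightarrow> (c7 \<longleftrightarrow> deg_cond \<and> prim_cond)) \<and>
        (c1 \<longrightarrow> (\<exists>c. c * g k = 1 \<and> is_generalized_inverse A\<^sub>t A\<^sub>o (c \<cdot>\<^sub>m Adj)))"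
proof -
  note A = assms
  define At where "At = over_nagata A"
  define Ao where "Ao = circ_mat A"
  define g where "g = gram_coeff At Ao"
  define Adj where "Adj = Adj_cross k At Ao"
  define deg where "deg \<longleftrightarrow> degree (gram_poly At Ao) \<le> k"
  define prim where "prim \<longleftrightarrow> is_primitive_poly_in_nagata (nagata_tpow (int k * (int n - int k)) * g k)"
  have At: "At \<in> carrier_mat m n" and Ao: "Ao \<in> carrier_mat n m"
    unfolding At_def Ao_def using A by simp_all
  have Adj: "Adj \<in> carrier_mat n m" unfolding Adj_def by (rule Adj_cross_carrier[OF At])
  have gram: "nagata_tpow (int k * (int n - int k)) * g k = nagata_of_poly (gram_numerator k A)"
    unfolding g_def At_def Ao_def by (rule gram_coeff_circ[OF A])
  have prim: "prim \<longleftrightarrow> primitive (gram_numerator k A)"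
    unfolding prim_def gram is_primitive_poly_in_nagata_def by (auto simp: nagata_of_poly_eq_iff)
  have deg: "deg \<longleftrightarrow> (\<forall>l>k. gram_coeff (over_nagata A) (circ_mat A) l = 0)"
    unfolding deg_def At_def Ao_def by (rule degree_gram_poly_le_iff)
  have unit: "\<exists>c. c * g k = 1" if prim
  proof -
    have "primitive (gram_numerator k A)" using that prim by simp
    then have "nagata_Fract 1 (gram_numerator k A) * nagata_tpow (int k * (int n - int k)) * g k = 1"
      unfolding mult.assoc gram by (simp add: nagata_of_poly_def mult_nagata One_nagata_def eq_nagata)
    then show ?thesis by blast
  qed
  define D where "D \<longleftrightarrow> det_ideal k A = UNIV \<and> minors_vanish (Suc k) A"
  have Dt: "D \<longleftrightarrow> det_ideal k At = UNIV \<and> minors_vanish (Suc k) At"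
    unfolding D_def At_def by (simp add: det_ideal_over_nagata[OF A] minors_vanish_over_nagata[OF A])
  have c1: "locally_simple_of_rank k A \<longleftrightarrow> D"
    by (simp add: locally_simple_of_rank_iff D_def)
  have c2: "locally_simple_of_rank k At \<longleftrightarrow> D" by (simp add: locally_simple_of_rank_iff Dt)
  have c3: "simple_of_rank k At \<longleftrightarrow> D"
    using simple_of_rankD[of k At] simple_of_rankI[OF At _ _ nagata_bilinear_unit] Dt by blast
  have prim_D: "D \<longleftrightarrow> minors_vanish (Suc k) A \<and> prim"
    unfolding D_def prim using primitive_gram_numerator_iff[OF _ A] by blast
  have c4: "rank_le k A \<and> prim \<longleftrightarrow> D"
    unfolding prim_D rank_le_def det_ideal_zero_iff ..
  have deg_D: deg if D
    unfolding deg using that gram_coeff_vanish[OF over_nagata_carrier[OF A] circ_mat_carrier[OF A]]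
      minors_vanish_mono[of "Suc k" A] by (auto simp: D_def minors_vanish_over_nagata[OF A])
  have gi: "\<exists>c. c * g k = 1 \<and> is_generalized_inverse At Ao (c \<cdot>\<^sub>m Adj)" if D: D
  proof -
    obtain c where c: "c * g k = 1" using unit D prim_D by blast
    have "is_generalized_inverse At Ao (c \<cdot>\<^sub>m Adj)"
      unfolding Adj_def
    proof (rule Adj_cross_generalized_inverse[OF At Ao])
      show "minors_vanish (Suc k) At" using D Dt by simp
      show "minors_vanish (Suc k) Ao" unfolding Ao_def using D
        by (intro minors_vanish_circ_mat[OF A]) (simp add: D_def)
      show "c * gram_coeff At Ao k = 1" using c by (simp add: g_def)
    qed
    with c show ?thesis by blast
  qed
  have crossed_B: "\<exists>B\<in>carrier_mat n m. At * B * At = At" if "crossed At Ao"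
  proof -
    have "is_direct_sum m (mat_range At) (mat_kernel Ao)" using that At by (simp add: crossed_def)
    then show ?thesis using direct_summand_quasi_inverse[OF At] by blast
  qed
  have deg_prim_D: D if deg prim "B \<in> carrier_mat n m" "At * B * At = At" for B
    unfolding prim_D using minors_vanish_of_degree_regular[OF A, of k B] that deg At_def by auto
  have crossed_D: "crossed At Ao" if D using gi[OF that] by (auto simp: is_generalized_inverse_def)
  have c5: "crossed_of_rank k At Ao \<longleftrightarrow> D"
    unfolding crossed_of_rank_def using crossed_D crossed_B projective_range_iff[OF At, of _ k] Dt by metis
  have c6: "crossed At Ao \<and> deg \<and> prim \<longleftrightarrow> D"
    using crossed_D deg_D prim_D crossed_B deg_prim_D by blast
  have c7: "deg \<and> prim \<and> At * Adj * At = g k \<cdot>\<^sub>m At \<longleftrightarrow> D"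
  proof
    assume *: "deg \<and> prim \<and> At * Adj * At = g k \<cdot>\<^sub>m At"
    then obtain c where c: "c * g k = 1" using unit by blast
    have "At * (c \<cdot>\<^sub>m Adj) * At = c \<cdot>\<^sub>m (At * Adj * At)"
      using At Adj by (simp add: mult_smult_distrib[of _ m n _ m] mult_smult_assoc_mat[of _ m m _ n])
    also have "\<dots> = At" using * c At by (intro eq_matI) (auto simp: mult.assoc[symmetric])
    finally show D using * Adj by (intro deg_prim_D[of "c \<cdot>\<^sub>m Adj"]) auto
  next
    assume D
    then have "At * Adj * At = g k \<cdot>\<^sub>m At"
      unfolding Adj_def g_def using Dt by (intro Adj_cross_identity[OF At Ao]) auto
    then show "deg \<and> prim \<and> At * Adj * At = g k \<cdot>\<^sub>m At"
      using \<open>D\<close> deg_D prim_D by blast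
  qed
  have reduced: "deg \<and> prim \<longrightarrow> D"
    if "\<forall>(x::'a) e. x ^ e = 0 \<longrightarrow> x = 0"
    using minors_vanish_of_degree_reduced[OF A, of k] that deg prim_D by blast
  show ?thesis
    unfolding Let_def At_def[symmetric] Ao_def[symmetric] g_def[symmetric] Adj_def[symmetric]
      deg_def[symmetric] prim_def[symmetric] c1 c2 c3 c4 c5 c6 c7
    using gi reduced deg_D prim_D by blast
qed

end
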